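(* Let $(H,V,a)$ be a triple with $a$ a bounded, $V$-coercive sesquilinear form on $V$ with boundedness and coercivity constants $C_3,C_4>0$ and $k\ge0$ (as specified in the context), let $A$ be the induced Lax--Milgram operator, and let $0<T<\infty$. For $u_0\in H$ and $f\in L_2(0,T;V^* )$, let $u$ be the unique solution in $$X=L_2(0,T;V)\cap C([0,T];H)\cap H^1(0,T;V^* )$$ of the Cauchy problem $$\partial_tu+Au=f\ \text{ in }\mathcal{D}'(0,T;V^* ),\qquad u(0)=u_0\ \text{ in }H .$$ Then, for $0\le t\le T$, $$\int_0^t\|u(s)\|^2\,ds+\sup_{0\le s\le t}|u(s)|^2+\int_0^t\|u'(s)\|_*^2\,ds\le\Big(2+\frac{2C_3^2+C_4+1}{C_4^2}e^{2kt}\Big)\Big(C_4|u_0|^2+\int_0^t\|f(s)\|_*^2\,ds\Big).$$ For $t=T$, this entails boundedness $L_2(0,T;V^* )\oplus H\to X$ of the solution operator $(f,u_0)\mapsto u$.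
   Context: Setting: $V\hookrightarrow H\hookrightarrow V^*$ is a Gelfand triple of separable, densely and continuously injected complex Hilbert spaces with norms $\|\cdot\|$, $|\cdot|$, $\|\cdot\|_*$, respectively; $V^*$ is the antidual of $V$ (with dual norm), $(\,\cdot\,|\,\cdot\,)$ is the inner product of $H$ and $\langle\cdot,\cdot\rangle$ is the duality of $V^*$ and $V$. There are constants $C_1,C_2>0$ with $\|v\|_*\le C_1|v|\le C_2\|v\|$ for $v\in V$. The sesquilinear form $a(\cdot,\cdot)$ on $V$ is bounded and $V$-coercive: for all $u,v\in V$ $$|a(u,v)|\le C_3\|u\|\,\|v\|,\qquad \operatorname{Re}a(v,v)\ge C_4\|v\|^2-k|v|^2 .$$ The Lax--Milgram operator $A$ is the unbounded operator in $H$ whose domain $D(A)$ consists of those $u\in V$ for which there is $f\in H$ with $a(u,v)=(f|v)$ for all $v\in V$; then $Au=f$. It has a unique extension $A\in\mathbb{B}(V,V^* )$, given by $\langle Au,v\rangle=a(u,v)$ for $u,v\in V$. Spaces: $\mathcal{D}'(0,T;V^* )$ is the space of continuous linear maps $C_0^\infty(]0,T[)\to V^*$ (vector distributions), and $\partial_tu=u'$ is the distributional derivative. $H^1(0,T;V^* )=\{u\in L_2(0,T;V^* )\mid \partial_tu\in L_2(0,T;V^* )\}$. The norm on $X$ is $$\|u\|_X=\Big(\int_0^T\|u(t)\|^2\,dt+\sup_{0\le t\le T}|u(t)|^2+\int_0^T(\|u(t)\|_*^2+\|u'(t)\|_*^2)\,dt\Big)^{1/2}.$$ It is known (Lions--Magenes)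 that for all $u_0\in H$, $f\in L_2(0,T;V^* )$ the Cauchy problem has a unique solution in $X$. *)

theory Defs
  imports "HOL-Analysis.Analysis"
begin

section \<open>Complex Hilbert spaces\<close>

class scaleC =
  fixes scaleC :: "complex \<Rightarrow> 'a \<Rightarrow> 'a" (infixr \<open>*\<^sub>C\<close> 75)

class complex_vector = scaleC + real_vector +
  assumes scaleC_add_right: "c *\<^sub>C (x + y) = c *\<^sub>C x + c *\<^sub>C y"
    and scaleC_add_left: "(c + d) *\<^sub>C x = c *\<^sub>C x + d *\<^sub>C x"
    and scaleC_scaleC: "c *\<^sub>C d *\<^sub>C x = (c * d) *\<^sub>C x"
    and scaleR_scaleC: "r *\<^sub>R x = complex_of_real r *\<^sub>C x"

class complex_normed_vector = complex_vector + real_normed_vector +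
  assumes norm_scaleC: "norm (c *\<^sub>C x) = cmod c * norm x"

text \<open>The inner product is linear in its first and antilinear in its second argument.\<close>

class complex_inner = complex_normed_vector +
  fixes cinner :: "'a \<Rightarrow> 'a \<Rightarrow> complex"
  assumes cinner_commute: "cinner x y = cnj (cinner y x)"
    and cinner_add_left: "cinner (x + y) z = cinner x z + cinner y z"
    and cinner_scaleC_left: "cinner (c *\<^sub>C x) y = c * cinner x y"
    and cinner_ge_zero: "0 \<le> Re (cinner x x)"
    and norm_eq_sqrt_cinner: "norm x = sqrt (Re (cinner x x))"

class chilbert_space = complex_inner + complete_space
begin
subclass banach ..
end

instantiation complex :: chilbert_space
begin
definition scaleC_complex :: "complex \<Rightarrow> complex \<Rightarrow> complex" where "scaleC_complex c x = c * x"
definition cinner_complex :: "complex \<Rightarrow> complex \<Rightarrow> complex" where "cinner_complex x y = x * cnj y"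
instance
proof
  fix x y z c d :: complex and r :: real
  show "c *\<^sub>C (x + y) = c *\<^sub>C x + c *\<^sub>C y" "(c + d) *\<^sub>C x = c *\<^sub>C x + d *\<^sub>C x"
    "c *\<^sub>C d *\<^sub>C x = (c * d) *\<^sub>C x" "r *\<^sub>R x = complex_of_real r *\<^sub>C x"
    "norm (c *\<^sub>C x) = cmod c * norm x"
    by (simp_all add: scaleC_complex_def algebra_simps scaleR_conv_of_real norm_mult)
  show "cinner x y = cnj (cinner y x)" "cinner (x + y) z = cinner x z + cinner y z"
    "cinner (c *\<^sub>C x) y = c * cinner x y"
    by (simp_all add: cinner_complex_def scaleC_complex_def algebra_simps)
  show "0 \<le> Re (cinner x x)" "norm x = sqrt (Re (cinner x x))"
    by (simp_all add: cinner_complex_def cmod_def power2_eq_square)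
qed
end

lemma cinner_add_right: "cinner x (y + z) = cinner x y + cinner x z"
  by (metis cinner_add_left cinner_commute complex_cnj_add)

lemma cinner_scaleC_right: "cinner x (c *\<^sub>C y) = cnj c * cinner x y"
  by (metis cinner_commute cinner_scaleC_left complex_cnj_mult)

lemma power2_norm_eq_cinner: "(norm x)\<^sup>2 = Re (cinner x x)"
  by (simp add: norm_eq_sqrt_cinner cinner_ge_zero)

lemma power2_norm_add: "(norm (x + y))\<^sup>2 = (norm x)\<^sup>2 + (norm y)\<^sup>2 + 2 * Re (cinner x y)"
proof -
  have "Re (cinner y x) = Re (cinner x y)"
    by (subst cinner_commute) simp
  then show ?thesis
    by (simp add: power2_norm_eq_cinner cinner_add_left cinner_add_right)
qed

lemma cinner_scaleR_right: "cinner x (r *\<^sub>R y) = r *\<^sub>R cinner x y"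
  by (simp only: scaleR_scaleC[of r y] cinner_scaleC_right scaleR_conv_of_real) simp

lemma cinner_minus_right: "cinner x (- y) = - cinner x y"
  using cinner_scaleR_right[of x "-1" y] by simp

lemma parallelogram:
  fixes x y :: "'a::complex_inner"
  shows "(norm (x + y))\<^sup>2 + (norm (x - y))\<^sup>2 = 2 * (norm x)\<^sup>2 + 2 * (norm y)\<^sup>2"
  using power2_norm_add[of x y] power2_norm_add[of x "- y"] by (simp add: cinner_minus_right)

lemma cinner_Cauchy_Schwarz: "cmod (cinner x y) \<le> norm x * norm y"
proof -
  have re: "Re (cinner u v) \<le> norm u * norm v" for u v :: 'a
  proof -
    have "(norm (u + v))\<^sup>2 \<le> (norm u + norm v)\<^sup>2"
      by (intro power_mono norm_triangle_ineq) simp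
    then show ?thesis
      by (simp add: power2_norm_add power2_sum)
  qed
  show ?thesis
  proof (cases "cinner x y = 0")
    case False
    define c where "c = cnj (sgn (cinner x y))"
    have "cmod c = 1" and "c * cinner x y = cmod (cinner x y)"
      using False by (simp_all add: c_def norm_sgn norm_divide sgn_eq complex_norm_square[symmetric]
          power2_eq_square mult.commute flip: of_real_mult) (simp add: norm_mult)
    then show ?thesis
      using re[of "c *\<^sub>C x" y] by (simp add: cinner_scaleC_left norm_scaleC)
  qed simp
qed

section \<open>The antidual\<close>

definition bounded_clinear :: "('a::complex_normed_vector \<Rightarrow> 'b::complex_normed_vector) \<Rightarrow> bool" where
  "bounded_clinear f \<longleftrightarrow> bounded_linear f \<and> (\<forall>c x. f (c *\<^sub>C x) = c *\<^sub>C f x)"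

definition bounded_antilinear :: "('a::complex_normed_vector \<Rightarrow> complex) \<Rightarrow> bool" where
  "bounded_antilinear f \<longleftrightarrow> bounded_linear f \<and> (\<forall>c x. f (c *\<^sub>C x) = cnj c * f x)"

typedef (overloaded) 'v antidual = "{f :: 'v::complex_normed_vector \<Rightarrow> complex. bounded_antilinear f}"
  morphisms pairing Antidual
  by (rule exI[of _ "\<lambda>_. 0"]) (simp add: bounded_antilinear_def bounded_linear_zero)

setup_lifting type_definition_antidual

lemma bounded_antilinear_pairing: "bounded_antilinear (pairing f)"
  using pairing by auto

lemma bounded_linear_pairing: "bounded_linear (pairing f)"
  using bounded_antilinear_pairing bounded_antilinear_def by blast

lemma pairing_Antidual: "bounded_antilinear f \<Longrightarrow> pairing (Antidual f) = f"
  by (simp add: Antidual_inverse)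

instantiation antidual :: (complex_normed_vector) complex_normed_vector
begin

lift_definition norm_antidual :: "'a antidual \<Rightarrow> real" is onorm .

lift_definition zero_antidual :: "'a antidual" is "\<lambda>_. 0"
  by (simp add: bounded_antilinear_def bounded_linear_zero)

lift_definition plus_antidual :: "'a antidual \<Rightarrow> 'a antidual \<Rightarrow> 'a antidual" is "\<lambda>f g x. f x + g x"
  by (simp add: bounded_antilinear_def bounded_linear_add ring_distribs)

lift_definition minus_antidual :: "'a antidual \<Rightarrow> 'a antidual \<Rightarrow> 'a antidual" is "\<lambda>f g x. f x - g x"
  by (simp add: bounded_antilinear_def bounded_linear_sub ring_distribs)

lift_definition uminus_antidual :: "'a antidual \<Rightarrow> 'a antidual" is "\<lambda>f x. - f x"
  by (simp add: bounded_antilinear_def bounded_linear_minus)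

lift_definition scaleC_antidual :: "complex \<Rightarrow> 'a antidual \<Rightarrow> 'a antidual" is "\<lambda>c f x. c * f x"
  by (simp add: bounded_antilinear_def bounded_linear_const_mult)

lift_definition scaleR_antidual :: "real \<Rightarrow> 'a antidual \<Rightarrow> 'a antidual" is "\<lambda>r f x. r *\<^sub>R f x"
  by (simp add: bounded_antilinear_def bounded_linear_const_scaleR)

definition dist_antidual :: "'a antidual \<Rightarrow> 'a antidual \<Rightarrow> real" where
  "dist_antidual f g = norm (f - g)"

definition uniformity_antidual :: "('a antidual \<times> 'a antidual) filter" where
  [code del]: "uniformity_antidual = (INF e\<in>{0 <..}. principal {(x, y). dist x y < e})"

definition open_antidual :: "'a antidual set \<Rightarrow> bool" where
  [code del]: "open_antidual S = (\<forall>x\<in>S. \<forall>\<^sub>F (x', y) in uniformity. x' = x \<longrightarrow> y \<in> S)"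

definition sgn_antidual :: "'a antidual \<Rightarrow> 'a antidual" where
  "sgn_antidual f = inverse (norm f) *\<^sub>R f"

instance
proof
  fix f g h :: "'a antidual" and c d :: complex and r s :: real and S :: "'a antidual set"
  show "f + g + h = f + (g + h)" "f + g = g + f" "0 + f = f" "- f + f = 0" "f - g = f + - g"
    by (transfer; simp add: fun_eq_iff algebra_simps)+
  show "r *\<^sub>R (f + g) = r *\<^sub>R f + r *\<^sub>R g" "(r + s) *\<^sub>R f = r *\<^sub>R f + s *\<^sub>R f"
    "r *\<^sub>R s *\<^sub>R f = (r * s) *\<^sub>R f" "1 *\<^sub>R f = f"
    by (transfer; simp add: fun_eq_iff algebra_simps)+
  show "c *\<^sub>C (f + g) = c *\<^sub>C f + c *\<^sub>C g" "(c + d) *\<^sub>C f = c *\<^sub>C f + d *\<^sub>C f"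
    "c *\<^sub>C d *\<^sub>C f = (c * d) *\<^sub>C f"
    by (transfer; simp add: fun_eq_iff algebra_simps)+
  show "r *\<^sub>R f = complex_of_real r *\<^sub>C f"
    by transfer (simp add: fun_eq_iff scaleR_conv_of_real)
  show "dist f g = norm (f - g)" "sgn f = inverse (norm f) *\<^sub>R f"
    "uniformity = (INF e\<in>{0 <..}. principal {(x :: 'a antidual, y). dist x y < e})"
    "open S = (\<forall>x\<in>S. \<forall>\<^sub>F (x', y) in uniformity. x' = x \<longrightarrow> y \<in> S)"
    by (rule dist_antidual_def sgn_antidual_def uniformity_antidual_def open_antidual_def)+
  show "norm f = 0 \<longleftrightarrow> f = 0"
    by transfer (simp add: bounded_antilinear_def onorm_eq_0 fun_eq_iff)
  show "norm (f + g) \<le> norm f + norm g"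
    by transfer (simp add: bounded_antilinear_def onorm_triangle)
  show "norm (r *\<^sub>R f) = \<bar>r\<bar> * norm f"
    by transfer (simp add: bounded_antilinear_def onorm_scaleR)
  show "norm (c *\<^sub>C f) = cmod c * norm f"
  proof (transfer fixing: c)
    fix f :: "'a \<Rightarrow> complex" assume "bounded_antilinear f"
    then have f: "bounded_linear f" by (simp add: bounded_antilinear_def)
    have "onorm (\<lambda>x. c * f x) = onorm (\<lambda>x. cmod c *\<^sub>R f x)"
      by (simp add: onorm_def norm_mult)
    then show "onorm (\<lambda>x. c * f x) = cmod c * onorm f"
      by (simp add: onorm_scaleR[OF f])
  qed
qed

end

lemma norm_pairing: "cmod (pairing f v) \<le> norm f * norm v"
  by transfer (simp add: bounded_antilinear_def onorm)

lemma norm_antidual_bound: "0 \<le> b \<Longrightarrow> (\<And>v. cmod (pairing f v) \<le> b * norm v) \<Longrightarrow> norm f \<le> b"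
  by transfer (rule onorm_bound)

instance antidual :: (complex_normed_vector) banach
proof
  fix X :: "nat \<Rightarrow> 'a antidual"
  assume X: "Cauchy X"
  define Y where "Y n = Blinfun (pairing (X n))" for n
  have Y: "blinfun_apply (Y n) = pairing (X n)" for n
    by (simp add: Y_def bounded_linear_Blinfun_apply bounded_linear_pairing)
  have "norm (Y m - Y n) = norm (X m - X n)" for m n
    by (simp add: norm_blinfun.rep_eq norm_antidual.rep_eq blinfun.diff_left[abs_def] Y
        minus_antidual.rep_eq cong: arg_cong[where f=onorm])
  then have "Cauchy Y"
    using X by (simp add: Cauchy_def dist_norm)
  then obtain L where L: "Y \<longlonglongrightarrow> L"
    using Cauchy_convergent convergent_def by blast
  then have lim: "(\<lambda>n. pairing (X n) v) \<longlonglongrightarrow> L v" for v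
    using blinfun.tendsto[OF L tendsto_const[of v]] by (simp add: Y)
  have "L (c *\<^sub>C v) = cnj c * L v" for c v
  proof (rule LIMSEQ_unique[OF lim])
    have "pairing (X n) (c *\<^sub>C v) = cnj c * pairing (X n) v" for n
      using bounded_antilinear_pairing[of "X n"] by (simp add: bounded_antilinear_def)
    then show "(\<lambda>n. pairing (X n) (c *\<^sub>C v)) \<longlonglongrightarrow> cnj c * L v"
      by (simp add: tendsto_mult_left lim)
  qed
  then have pL: "pairing (Antidual L) = blinfun_apply L"
    by (intro pairing_Antidual) (simp add: bounded_antilinear_def blinfun.bounded_linear_right)
  have "norm (X n - Antidual L) = norm (Y n - L)" for n
    by (simp add: norm_blinfun.rep_eq norm_antidual.rep_eq blinfun.diff_left[abs_def] Y pL
        minus_antidual.rep_eq cong: arg_cong[where f=onorm])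
  then have "X \<longlonglongrightarrow> Antidual L"
    using L by (simp add: LIMSEQ_iff)
  then show "convergent X"
    by (rule convergentI)
qed

subsection \<open>Riesz representation and separability of the antidual\<close>

lemma Riesz_antidual:
  fixes f :: "'v::chilbert_space \<Rightarrow> complex"
  assumes "bounded_antilinear f"
  obtains u where "\<And>v. f v = cinner u v"
proof -
  interpret f: bounded_linear f
    using assms by (simp add: bounded_antilinear_def)
  have f_scaleC: "f (c *\<^sub>C v) = cnj c * f v" for c and v :: 'v
    using assms by (simp add: bounded_antilinear_def)
  define J where "J v = (norm v)\<^sup>2 - 2 * Re (f v)" for v
  define m where "m = Inf (range J)"
  obtain K where K: "\<And>v. cmod (f v) \<le> norm v * K"
    using f.bounded by blast
  have bdd: "bdd_below (range J)"
  proof (rule bdd_belowI2)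
    fix v :: 'v
    have "0 \<le> (norm v - K)\<^sup>2" by simp
    moreover have "Re (f v) \<le> norm v * K"
      using K[of v] complex_Re_le_cmod order_trans by blast
    ultimately show "- K\<^sup>2 \<le> J v"
      by (simp add: J_def power2_diff)
  qed
  have m_le: "m \<le> J v" for v
    unfolding m_def by (rule cINF_lower[OF bdd]) simp
  have "\<exists>v. J v < m + 1 / real (Suc n)" for n
  proof -
    have "Inf (range J) < m + 1 / real (Suc n)" by (simp add: m_def)
    then show ?thesis
      using cInf_lessD[of "range J"] by blast
  qed
  then obtain x where x: "\<And>n. J (x n) < m + 1 / real (Suc n)"
    by metis
  have x_diff: "(norm (x i - x j))\<^sup>2 < 2 / real (Suc i) + 2 / real (Suc j)" for i j
  proof -
    have "J ((1/2) *\<^sub>R (x i + x j)) = (norm (x i + x j))\<^sup>2 / 4 - Re (f (x i)) - Re (f (x j))"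
      by (simp add: J_def f.scaleR f.add power_divide add_divide_distrib)
    then have "(norm (x i - x j))\<^sup>2 = 2 * J (x i) + 2 * J (x j) - 4 * J ((1/2) *\<^sub>R (x i + x j))"
      using parallelogram[of "x i" "x j"] by (simp add: J_def)
    then show ?thesis
      using x[of i] x[of j] m_le[of "(1/2) *\<^sub>R (x i + x j)"] by simp
  qed
  have "Cauchy x"
  proof (rule CauchyI)
    fix e :: real assume e: "0 < e"
    obtain N where N: "4 / e\<^sup>2 < real N"
      using reals_Archimedean2 by blast
    have "norm (x i - x j) < e" if ij: "N \<le> i" "N \<le> j" for i j
    proof -
      have "2 / real (Suc l) \<le> e\<^sup>2 / 2" if "N \<le> l" for l
      proof -
        have "4 / e\<^sup>2 < real (Suc l)" using N that by linarith
        then show ?thesis using e by (simp add: field_simps)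
      qed
      then have "(norm (x i - x j))\<^sup>2 < e\<^sup>2"
        using x_diff[of i j] ij by (smt (verit) field_sum_of_halves)
      then show ?thesis
        using e power2_less_imp_less by fastforce
    qed
    then show "\<exists>N. \<forall>i\<ge>N. \<forall>j\<ge>N. norm (x i - x j) < e" by blast
  qed
  then obtain u where u: "x \<longlonglongrightarrow> u"
    using Cauchy_convergent convergent_def by blast
  have "(\<lambda>n. J (x n)) \<longlonglongrightarrow> J u"
    unfolding J_def by (intro tendsto_intros u f.tendsto)
  moreover have "(\<lambda>n. m + 1 / real (Suc n)) \<longlonglongrightarrow> m + 0"
    by (intro tendsto_add tendsto_const LIMSEQ_Suc lim_1_over_n)
  ultimately have Ju: "J u \<le> m"
    by (metis (no_types, lifting) LIMSEQ_le add.right_neutral less_imp_le x)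
  have Re_eq: "Re (f v) = Re (cinner u v)" for v
  proof -
    define d where "d = Re (cinner u v) - Re (f v)"
    have J_line: "J (u + t *\<^sub>R v) = J u + t\<^sup>2 * (norm v)\<^sup>2 + 2 * t * d" for t
      by (simp add: J_def power2_norm_add f.add f.scaleR cinner_scaleR_right power_mult_distrib
          d_def algebra_simps)
    then have q: "0 \<le> t\<^sup>2 * (norm v)\<^sup>2 + 2 * t * d" for t
      using Ju m_le[of "u + t *\<^sub>R v"] J_line[of t] by linarith
    define M where "M = (norm v)\<^sup>2 + 1"
    have M: "0 < M" "(norm v)\<^sup>2 < M" by (simp_all add: M_def add_nonneg_pos)
    have "0 \<le> (d\<^sup>2 / M\<^sup>2) * (norm v)\<^sup>2 - 2 * d\<^sup>2 / M"
      using q[of "- d / M"] by (simp add: power_divide power2_eq_square)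
    also have "(d\<^sup>2 / M\<^sup>2) * (norm v)\<^sup>2 \<le> (d\<^sup>2 / M\<^sup>2) * M"
      using M by (intro mult_left_mono) auto
    also have "(d\<^sup>2 / M\<^sup>2) * M = d\<^sup>2 / M"
      using M by (simp add: power2_eq_square)
    finally have "d\<^sup>2 / M \<le> 0" by simp
    then have "d = 0"
      using M by (simp add: divide_le_0_iff)
    then show ?thesis by (simp add: d_def)
  qed
  have "f v = cinner u v" for v
  proof (rule complex_eqI)
    show "Im (f v) = Im (cinner u v)"
      using Re_eq[of "\<i> *\<^sub>C v"] by (simp add: f_scaleC cinner_scaleC_right)
  qed (rule Re_eq)
  then show ?thesis by (rule that)
qed

instance antidual :: ("{chilbert_space, second_countable_topology}") second_countable_topology
proof
  define R :: "'a \<Rightarrow> 'a antidual" where "R u = Antidual (cinner u)" for u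
  have anti: "bounded_antilinear (cinner u)" for u :: 'a
  proof -
    have "bounded_linear (cinner u)"
      by (rule bounded_linear_intro[where K="norm u"])
        (simp_all add: cinner_add_right cinner_scaleR_right cinner_Cauchy_Schwarz mult.commute[of _ "norm u"])
    then show ?thesis
      by (simp add: bounded_antilinear_def cinner_scaleC_right)
  qed
  have R: "pairing (R u) v = cinner u v" for u v
    by (simp add: R_def pairing_Antidual anti)
  have R_diff: "R (u - w) = R u - R w" for u w
  proof -
    have "cinner (u - w) v = cinner u v - cinner w v" for v
      by (metis add_diff_cancel_right' cinner_add_left diff_add_cancel)
    then show ?thesis
      by (simp add: pairing_inject[symmetric] fun_eq_iff R minus_antidual.rep_eq)
  qed
  have R_norm: "norm (R u) = norm u" for u
  proof (rule antisym)
    show "norm (R u) \<le> norm u"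
      by (rule norm_antidual_bound) (simp_all add: R cinner_Cauchy_Schwarz)
    have "(norm u)\<^sup>2 \<le> norm (R u) * norm u"
      using norm_pairing[of "R u" u] complex_Re_le_cmod[of "cinner u u"]
      by (simp add: R power2_norm_eq_cinner)
    then show "norm u \<le> norm (R u)"
      by (cases "u = 0") (simp_all add: power2_eq_square)
  qed
  have R_dist: "dist (R u) (R w) = dist u w" for u w
    by (simp add: dist_norm R_norm flip: R_diff)
  have R_surj: "\<exists>u. R u = f" for f
  proof -
    obtain u where "\<And>v. pairing f v = cinner u v"
      using Riesz_antidual[OF bounded_antilinear_pairing] by blast
    then have "R u = f"
      by (simp add: pairing_inject[symmetric] fun_eq_iff R)
    then show ?thesis ..
  qed
  obtain B :: "'a set set" where B: "countable B" "topological_basis B"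
    using ex_countable_basis by blast
  have "topological_basis ((`) R ` B)"
  proof (rule topological_basisI)
    fix S assume "S \<in> (`) R ` B"
    then obtain b where b: "S = R ` b" "open b"
      using B(2) topological_basis_open by blast
    show "open S"
      unfolding open_dist
    proof
      fix f assume "f \<in> S"
      then obtain u e where "u \<in> b" "f = R u" "0 < e" "\<And>w. dist w u < e \<Longrightarrow> w \<in> b"
        using b by (auto simp: open_dist)
      then show "\<exists>e>0. \<forall>g. dist g f < e \<longrightarrow> g \<in> S"
        using R_surj R_dist b(1) by (metis imageI)
    qed
  next
    fix O' :: "'a antidual set" and f assume O': "open O'" "f \<in> O'"
    obtain u where u: "R u = f" using R_surj by blast
    have "continuous_on UNIV R"
      by (auto simp: continuous_on_iff R_dist)
    then have "open (R -` O')"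
      using O' by (simp add: open_vimage)
    then obtain b where "b \<in> B" "u \<in> b" "b \<subseteq> R -` O'"
      using B(2) O' u by (metis topological_basisE vimageI)
    then show "\<exists>S\<in>(`) R ` B. f \<in> S \<and> S \<subseteq> O'"
      using u by blast
  qed
  then show "\<exists>B :: 'a antidual set set. countable B \<and> open = generate_topology B"
    using B(1) topological_basis_imp_subbasis by blast
qed

section \<open>The Gelfand triple and the form\<close>

text \<open>
  The inclusion of \<open>V\<close> in \<open>H\<close> is an explicit map \<open>\<iota>\<close>; the inclusion of \<open>H\<close> in \<open>V\<^sup>*\<close> is its adjoint
  \<open>embed \<iota>\<close>. Continuity of the inclusions amounts to the existence of \<open>C\<^sub>1\<close>, \<open>C\<^sub>2\<close> with
  \<open>\<parallel>v\<parallel>\<^sub>* \<le> C\<^sub>1 |v| \<le> C\<^sub>2 \<parallel>v\<parallel>\<close>, see \<open>gelfand_triple_constants\<close> below.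
\<close>

definition gelfand_triple :: "('v::chilbert_space \<Rightarrow> 'h::chilbert_space) \<Rightarrow> bool" where
  "gelfand_triple \<iota> \<longleftrightarrow> bounded_clinear \<iota> \<and> inj \<iota> \<and> closure (range \<iota>) = UNIV"

definition embed :: "('v::chilbert_space \<Rightarrow> 'h::chilbert_space) \<Rightarrow> 'h \<Rightarrow> 'v antidual" where
  "embed \<iota> h = Antidual (\<lambda>v. cinner h (\<iota> v))"

lemma pairing_embed:
  assumes "gelfand_triple \<iota>"
  shows "pairing (embed \<iota> h) v = cinner h (\<iota> v)"
proof -
  interpret \<iota>: bounded_linear \<iota>
    using assms by (simp add: gelfand_triple_def bounded_clinear_def)
  obtain K where K: "\<And>v. norm (\<iota> v) \<le> norm v * K"
    using \<iota>.bounded by blast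
  have "bounded_linear (\<lambda>v. cinner h (\<iota> v))"
  proof (rule bounded_linear_intro)
    fix v
    have "cmod (cinner h (\<iota> v)) \<le> norm h * (norm v * K)"
      by (rule order_trans[OF cinner_Cauchy_Schwarz mult_left_mono[OF K norm_ge_zero]])
    then show "cmod (cinner h (\<iota> v)) \<le> norm v * (norm h * K)"
      by (simp add: algebra_simps)
  qed (simp_all add: \<iota>.add \<iota>.scaleR cinner_add_right cinner_scaleR_right)
  then have "bounded_antilinear (\<lambda>v. cinner h (\<iota> v))"
    using assms
    by (simp add: bounded_antilinear_def gelfand_triple_def bounded_clinear_def cinner_scaleC_right)
  then show ?thesis
    by (simp add: embed_def pairing_Antidual)
qed

lemma gelfand_triple_constants:
  assumes "gelfand_triple \<iota>"
  shows "\<exists>C1>0. \<exists>C2>0. \<forall>v. norm (embed \<iota> (\<iota> v)) \<le> C1 * norm (\<iota> v) \<and> C1 * norm (\<iota> v) \<le> C2 * norm v"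
proof -
  interpret \<iota>: bounded_linear \<iota>
    using assms by (simp add: gelfand_triple_def bounded_clinear_def)
  obtain K where K: "0 < K" "\<And>v. norm (\<iota> v) \<le> norm v * K"
    using \<iota>.pos_bounded by blast
  have "norm (embed \<iota> h) \<le> K * norm h" for h
  proof (rule norm_antidual_bound)
    fix v
    have "cmod (cinner h (\<iota> v)) \<le> norm h * (norm v * K)"
      by (rule order_trans[OF cinner_Cauchy_Schwarz mult_left_mono[OF K(2) norm_ge_zero]])
    then show "cmod (pairing (embed \<iota> h) v) \<le> K * norm h * norm v"
      using assms by (simp add: pairing_embed algebra_simps)
  qed (use K(1) in simp)
  moreover have "K * norm (\<iota> v) \<le> (K * K) * norm v" for v
    using K by (simp add: algebra_simps)
  ultimately show ?thesis
    using K(1) by (intro exI[of _ K] exI[of _ "K * K"] conjI allI) auto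
qed

definition sesquilinear :: "('v::complex_vector \<Rightarrow> 'v \<Rightarrow> complex) \<Rightarrow> bool" where
  "sesquilinear a \<longleftrightarrow>
     (\<forall>u u' v. a (u + u') v = a u v + a u' v) \<and> (\<forall>c u v. a (c *\<^sub>C u) v = c * a u v) \<and>
     (\<forall>u v v'. a u (v + v') = a u v + a u v') \<and> (\<forall>c u v. a u (c *\<^sub>C v) = cnj c * a u v)"

definition bounded_form :: "('v::complex_normed_vector \<Rightarrow> 'v \<Rightarrow> complex) \<Rightarrow> real \<Rightarrow> bool" where
  "bounded_form a C3 \<longleftrightarrow> (\<forall>u v. cmod (a u v) \<le> C3 * norm u * norm v)"

definition coercive_form ::
  "('v::complex_normed_vector \<Rightarrow> 'h::complex_normed_vector) \<Rightarrow> ('v \<Rightarrow> 'v \<Rightarrow> complex) \<Rightarrow> real \<Rightarrow> real \<Rightarrow> bool" where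
  "coercive_form \<iota> a C4 k \<longleftrightarrow> (\<forall>v. Re (a v v) \<ge> C4 * (norm v)\<^sup>2 - k * (norm (\<iota> v))\<^sup>2)"

text \<open>
  The unbounded Lax--Milgram operator in \<open>H\<close>, as a graph, and its extension to an operator
  from \<open>V\<close> to \<open>V\<^sup>*\<close>.
\<close>

definition lax_milgram_graph ::
  "('v \<Rightarrow> 'h::complex_inner) \<Rightarrow> ('v \<Rightarrow> 'v \<Rightarrow> complex) \<Rightarrow> ('v \<times> 'h) set" where
  "lax_milgram_graph \<iota> a = {(u, f). \<forall>v. a u v = cinner f (\<iota> v)}"

definition lax_milgram :: "('v::complex_normed_vector \<Rightarrow> 'v \<Rightarrow> complex) \<Rightarrow> 'v \<Rightarrow> 'v antidual" where
  "lax_milgram a u = Antidual (a u)"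

lemma pairing_lax_milgram:
  assumes "sesquilinear a" "bounded_form a C3"
  shows "pairing (lax_milgram a u) v = a u v"
proof -
  have "bounded_linear (a u)"
  proof (rule bounded_linear_intro)
    show "a u (r *\<^sub>R v) = r *\<^sub>R a u v" for r v
      using assms(1) by (simp add: sesquilinear_def scaleR_scaleC[of r v] scaleR_conv_of_real)
    show "cmod (a u v) \<le> norm v * (C3 * norm u)" for v
      using assms(2) by (simp add: bounded_form_def algebra_simps)
  qed (use assms(1) in \<open>simp add: sesquilinear_def\<close>)
  then show ?thesis
    using assms(1)
    by (simp add: lax_milgram_def pairing_Antidual bounded_antilinear_def sesquilinear_def)
qed

lemma lax_milgram_extends:
  "(u, f) \<in> lax_milgram_graph \<iota> a \<Longrightarrow> lax_milgram a u = embed \<iota> f"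
  by (auto simp: lax_milgram_graph_def lax_milgram_def embed_def intro!: arg_cong[where f=Antidual])

section \<open>Vector-valued functions and distributions\<close>

definition L2 :: "real \<Rightarrow> (real \<Rightarrow> 'a::real_normed_vector) set" where
  "L2 T = {f \<in> borel_measurable (lebesgue_on {0<..<T}).
             integrable (lebesgue_on {0<..<T}) (\<lambda>t. (norm (f t))\<^sup>2)}"

definition test_functions :: "real \<Rightarrow> (real \<Rightarrow> complex) set" where
  "test_functions T = {\<phi>. (\<forall>n. ((\<lambda>g t. vector_derivative g (at t)) ^^ n) \<phi> differentiable_on UNIV) \<and>
                          closure {t. \<phi> t \<noteq> 0} \<subseteq> {0<..<T}}"

text \<open>
  Only distributions of the form \<open>regular T g\<close> and their derivatives occur below. They are
  automatically continuous, so equality in \<open>\<D>'(0,T;E)\<close> is equality on all test functions.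
\<close>

definition regular ::
  "real \<Rightarrow> (real \<Rightarrow> 'e::{complex_normed_vector, banach, second_countable_topology}) \<Rightarrow> (real \<Rightarrow> complex) \<Rightarrow> 'e" where
  "regular T g = (\<lambda>\<phi>. integral\<^sup>L (lebesgue_on {0<..<T}) (\<lambda>t. \<phi> t *\<^sub>C g t))"

definition distr_deriv :: "((real \<Rightarrow> complex) \<Rightarrow> 'e::real_vector) \<Rightarrow> (real \<Rightarrow> complex) \<Rightarrow> 'e" where
  "distr_deriv \<Lambda> = (\<lambda>\<phi>. - \<Lambda> (\<lambda>t. vector_derivative \<phi> (at t)))"

definition has_L2_deriv ::
  "real \<Rightarrow> (real \<Rightarrow> 'e::{complex_normed_vector, banach, second_countable_topology}) \<Rightarrow> (real \<Rightarrow> 'e) \<Rightarrow> bool" where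
  "has_L2_deriv T w g \<longleftrightarrow>
     g \<in> L2 T \<and> (\<forall>\<phi>\<in>test_functions T. distr_deriv (regular T w) \<phi> = regular T g \<phi>)"

definition H1 ::
  "real \<Rightarrow> (real \<Rightarrow> 'e::{complex_normed_vector, banach, second_countable_topology}) set" where
  "H1 T = {w \<in> L2 T. \<exists>g. has_L2_deriv T w g}"

text \<open>The choice below is unique up to a null set.\<close>

definition L2_deriv ::
  "real \<Rightarrow> (real \<Rightarrow> 'e::{complex_normed_vector, banach, second_countable_topology}) \<Rightarrow> real \<Rightarrow> 'e" where
  "L2_deriv T w = (SOME g. has_L2_deriv T w g)"

section \<open>The Cauchy problem\<close>

text \<open>
  An element of \<open>X\<close> is represented by its continuous \<open>H\<close>-valued version \<open>u\<close>, which takes values in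
  \<open>V\<close> almost everywhere; the corresponding \<open>V\<close>-valued function is \<open>inv \<iota> \<circ> u\<close>.
\<close>

definition sol_space ::
  "('v::{chilbert_space, second_countable_topology} \<Rightarrow> 'h::chilbert_space) \<Rightarrow> real \<Rightarrow> (real \<Rightarrow> 'h) set" where
  "sol_space \<iota> T = {u. ((AE t in lebesgue_on {0<..<T}. u t \<in> range \<iota>) \<and> inv \<iota> \<circ> u \<in> L2 T) \<and>
                       continuous_on {0..T} u \<and>
                       embed \<iota> \<circ> u \<in> H1 T}"

definition sol_norm ::
  "('v::{chilbert_space, second_countable_topology} \<Rightarrow> 'h::chilbert_space) \<Rightarrow> real \<Rightarrow> (real \<Rightarrow> 'h) \<Rightarrow> real" where
  "sol_norm \<iota> T u = sqrt (
     (LINT t|lebesgue_on {0<..<T}. (norm (inv \<iota> (u t)))\<^sup>2) +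
     (SUP t\<in>{0..T}. (norm (u t))\<^sup>2) +
     (LINT t|lebesgue_on {0<..<T}. (norm (embed \<iota> (u t)))\<^sup>2 + (norm (L2_deriv T (embed \<iota> \<circ> u) t))\<^sup>2))"

definition solves_cauchy ::
  "('v::{chilbert_space, second_countable_topology} \<Rightarrow> 'h::chilbert_space) \<Rightarrow> ('v \<Rightarrow> 'v \<Rightarrow> complex) \<Rightarrow>
   real \<Rightarrow> (real \<Rightarrow> 'v antidual) \<Rightarrow> 'h \<Rightarrow> (real \<Rightarrow> 'h) \<Rightarrow> bool" where
  "solves_cauchy \<iota> a T f u0 u \<longleftrightarrow>
     u \<in> sol_space \<iota> T \<and>
     (\<forall>\<phi>\<in>test_functions T.
        distr_deriv (regular T (embed \<iota> \<circ> u)) \<phi> + regular T (lax_milgram a \<circ> inv \<iota> \<circ> u) \<phi> = regular T f \<phi>) \<and>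
     u 0 = u0"

end

theory Submission
  imports Defs
begin

text \<open>
  Taking the real part of \<open>\<langle>u', u\<rangle> + a(u, u) = \<langle>f, u\<rangle>\<close> and using coercivity and Young's inequality gives
  \<open>|u(t)|\<^sup>2 + C\<^sub>4 \<integral>\<parallel>u\<parallel>\<^sup>2 \<le> |u\<^sub>0|\<^sup>2 + C\<^sub>4\<^sup>-\<^sup>1 \<integral>\<parallel>f\<parallel>\<^sub>*\<^sup>2 + 2k \<integral>|u|\<^sup>2\<close>; Gronwall's lemma removes the last term, and
  \<open>\<parallel>u'\<parallel>\<^sub>*\<^sup>2 \<le> 2 \<parallel>f\<parallel>\<^sub>*\<^sup>2 + 2 C\<^sub>3\<^sup>2 \<parallel>u\<parallel>\<^sup>2\<close> bounds the derivative.

  The substance is the energy identity \<open>|u(t)|\<^sup>2 - |u(s)|\<^sup>2 = 2 Re \<integral>\<langle>u', u\<rangle>\<close> for \<open>u \<in> X\<close>. Testing the weak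
  derivative with smoothed indicator functions gives \<open>u(q) - u(p) = \<integral> u'\<close> in \<open>V\<^sup>*\<close>, hence
  \<open>|u(q)|\<^sup>2 - |u(p)|\<^sup>2 = Re \<integral>\<langle>u', u(p) + u(q)\<rangle>\<close> whenever \<open>u(p), u(q) \<in> V\<close>. This is summed over an equidistant
  partition whose offset is chosen, by averaging, such that the Riemann sum of \<open>\<parallel>u\<parallel>\<^sup>2\<close> does not exceed
  its integral. To replace \<open>u(p) + u(q)\<close> by \<open>2u\<close> as the mesh tends to \<open>0\<close>, approximate \<open>u'\<close> in
  \<open>L\<^sub>2(V\<^sup>*)\<close> by \<open>H\<close>-valued functions: for these, continuity of \<open>u\<close> in \<open>H\<close> suffices, and the error is
  controlled by the bound on the Riemann sums. Thus no mollification in time is needed.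
\<close>

section \<open>Smooth step functions\<close>

text \<open>The parameters \<open>p\<close> and \<open>n\<close> make the family closed under
  differentiation: the derivative of a member is another member. Smoothness of all orders then
  follows from one first-order lemma.\<close>

definition bump :: "real poly \<Rightarrow> nat \<Rightarrow> real \<Rightarrow> real" where
  "bump p n x = (if 0 < x \<and> x < 1 then poly p x / (x * (1 - x)) ^ n * exp (- 1 / (x * (1 - x))) else 0)"

text \<open>The numerator of the derivative of \<open>p / q\<^sup>n \<cdot> exp(-1/q)\<close> with \<open>q = x(1 - x)\<close> over the denominator \<open>q\<^sup>n\<^sup>+\<^sup>2\<close>.\<close>

definition bump_deriv :: "real poly \<Rightarrow> nat \<Rightarrow> real poly" where
  "bump_deriv p n = (let q = [:0, 1, -1:]; q' = [:1, -2:] in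
     pderiv p * q\<^sup>2 - smult (of_nat n) (p * q' * q) + p * q')"

text \<open>The exponential series has nonnegative terms for such \<open>y\<close>, so it dominates
  its single term of index \<open>m\<close>.\<close>

lemma power_le_fact_exp: "0 \<le> (y::real) \<Longrightarrow> y ^ m \<le> fact m * exp y"
proof -
  assume "0 \<le> y"
  then have "(\<Sum>k\<in>{m}. y ^ k /\<^sub>R fact k) \<le> (\<Sum>k. y ^ k /\<^sub>R fact k)"
    by (intro sum_le_suminf summable_exp_generic) auto
  then show ?thesis
    by (simp add: exp_def field_simps)
qed

text \<open>With q = x(1 - x), the factor exp(-1/q) beats every power of q. Taking the exponent
  \<open>n + 2\<close> cancels the denominator q^n and leaves q^2, which is just enough for the
  derivative to vanish at the endpoints 0 and 1.\<close>

lemma bump_quadratic_bound: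
  obtains K where "0 \<le> K" "\<And>x. 0 < x \<Longrightarrow> x < 1 \<Longrightarrow> \<bar>bump p n x\<bar> \<le> K * (x * (1 - x))\<^sup>2"
proof -
  have "compact (poly p ` {0..1})"
    by (intro compact_continuous_image continuous_intros) auto
  then obtain L where L: "\<And>x. 0 \<le> x \<Longrightarrow> x \<le> 1 \<Longrightarrow> \<bar>poly p x\<bar> \<le> L"
    using compact_imp_bounded[of "poly p ` {0..1}"] that unfolding bounded_iff by force
  have "0 \<le> L"
    using L[of 0] by simp
  have "\<bar>bump p n x\<bar> \<le> (L * fact (n + 2)) * (x * (1 - x))\<^sup>2" if x: "0 < x" "x < 1" for x
  proof -
    define q where "q = x * (1 - x)"
    have q: "0 < q" using x by (simp add: q_def)
    have "(1 / q) ^ (n + 2) \<le> fact (n + 2) * exp (1 / q)"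
      using q by (intro power_le_fact_exp) simp
    then have "exp (- 1 / q) \<le> fact (n + 2) * q ^ (n + 2)"
      using q by (simp add: exp_minus field_simps del: fact_Suc)
    then have "exp (- 1 / q) / q ^ n \<le> fact (n + 2) * q\<^sup>2"
      using q by (simp add: field_simps power_add power2_eq_square del: fact_Suc)
    then have "\<bar>poly p x\<bar> * (exp (- 1 / q) / q ^ n) \<le> L * (fact (n + 2) * q\<^sup>2)"
      using q x L[of x] \<open>0 \<le> L\<close> by (intro mult_mono) auto
    then show ?thesis
      using x q by (simp add: bump_def q_def[symmetric] abs_mult field_simps del: fact_Suc)
  qed
  then show ?thesis
    using that[of "L * fact (n + 2)"] \<open>0 \<le> L\<close> by simp
qed

lemma quadratic_bound_DERIV_0:
  fixes f :: "real \<Rightarrow> real"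
  assumes "\<And>x. \<bar>f x\<bar> \<le> K * (x - a)\<^sup>2"
  shows "(f has_real_derivative 0) (at a)"
proof -
  have fa: "f a = 0"
    using assms[of a] by simp
  have "((\<lambda>x. (f x - f a) / (x - a)) \<longlongrightarrow> 0) (at a)"
  proof (rule Lim_null_comparison)
    show "\<forall>\<^sub>F x in at a. norm ((f x - f a) / (x - a)) \<le> K * \<bar>x - a\<bar>"
      unfolding eventually_at_filter
    proof (intro always_eventually allI impI)
      fix x assume "x \<noteq> a"
      then show "norm ((f x - f a) / (x - a)) \<le> K * \<bar>x - a\<bar>"
        using assms[of x] fa by (simp add: abs_divide pos_divide_le_eq power2_eq_square mult.assoc)
    qed
    show "((\<lambda>x. K * \<bar>x - a\<bar>) \<longlongrightarrow> 0) (at a)"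
      by (rule tendsto_eq_intros | simp)+
  qed
  then show ?thesis
    by (simp add: has_field_derivative_iff)
qed

lemma DERIV_bump: "(bump p n has_real_derivative bump (bump_deriv p n) (n + 2) x) (at x)"
proof -
  consider "0 < x \<and> x < 1" | "x = 0 \<or> x = 1" | "x < 0 \<or> 1 < x"
    by linarith
  then show ?thesis
  proof cases
    case 1
    define q where "q = x * (1 - x)"
    have q: "q \<noteq> 0" using 1 by (simp add: q_def)
    \<comment> \<open>An abstract inner function \<open>Q\<close> keeps the simplifier from
      expanding x(1 - x) while it differentiates.\<close>
    have gen: "((\<lambda>x. poly p x / Q x ^ n * exp (- 1 / Q x)) has_real_derivative
            ((poly (pderiv p) x * q ^ n - poly p x * (n * q ^ (n - 1) * (1 - 2 * x))) / (q ^ n * q ^ n)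
              * exp (- 1 / q) + poly p x / q ^ n * (exp (- 1 / q) * ((1 - 2 * x) / (q * q))))) (at x)"
      if "(Q has_real_derivative 1 - 2 * x) (at x)" "Q x = q" for Q
      using q that(2) by (auto intro!: derivative_eq_intros that(1)) (simp add: field_simps)
    have dq: "((\<lambda>x. x * (1 - x)) has_real_derivative 1 - 2 * x) (at x)"
      by (auto intro!: derivative_eq_intros)
    have "((\<lambda>x. poly p x / (x * (1 - x)) ^ n * exp (- 1 / (x * (1 - x)))) has_real_derivative
            ((poly (pderiv p) x * q ^ n - poly p x * (n * q ^ (n - 1) * (1 - 2 * x))) / (q ^ n * q ^ n)
              * exp (- 1 / q) + poly p x / q ^ n * (exp (- 1 / q) * ((1 - 2 * x) / (q * q))))) (at x)"
      by (rule gen[OF dq]) (simp add: q_def)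
    moreover have "(poly (pderiv p) x * q ^ n - poly p x * (n * q ^ (n - 1) * (1 - 2 * x))) / (q ^ n * q ^ n)
              * exp (- 1 / q) + poly p x / q ^ n * (exp (- 1 / q) * ((1 - 2 * x) / (q * q)))
        = bump (bump_deriv p n) (n + 2) x"
    proof -
      have P: "poly (bump_deriv p n) x
          = poly (pderiv p) x * q\<^sup>2 - n * (poly p x * (1 - 2 * x) * q) + poly p x * (1 - 2 * x)"
        by (simp add: bump_deriv_def Let_def q_def algebra_simps power2_eq_square)
      \<comment> \<open>For \<open>n = 0\<close> the exponent is truncated to 0, but the factor
        \<open>n\<close> makes both sides vanish.\<close>
      have m: "n * q ^ (n - 1) = n * q ^ n / q"
        using q by (cases n) (simp_all add: field_simps)
      have b: "bump (bump_deriv p n) (n + 2) x = poly (bump_deriv p n) x / (q ^ n * q\<^sup>2) * exp (- 1 / q)"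
        using 1 by (simp add: bump_def q_def power_add power2_eq_square)
      show ?thesis
        using q unfolding b P mult.assoc[symmetric] m by (simp add: field_simps power2_eq_square)
    qed
    ultimately have *: "((\<lambda>x. poly p x / (x * (1 - x)) ^ n * exp (- 1 / (x * (1 - x)))) has_real_derivative
            bump (bump_deriv p n) (n + 2) x) (at x)" by simp
    show ?thesis
      by (rule has_field_derivative_transform_within_open[OF *, of "{0<..<1}"])
        (use 1 in \<open>auto simp: bump_def\<close>)
  next
    case 2
    obtain K where K: "0 \<le> K" "\<And>x. 0 < x \<Longrightarrow> x < 1 \<Longrightarrow> \<bar>bump p n x\<bar> \<le> K * (x * (1 - x))\<^sup>2"
      by (rule bump_quadratic_bound[of p n]) blast
    have "\<bar>bump p n y\<bar> \<le> K * (y - x)\<^sup>2" for y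
    proof (cases "0 < y \<and> y < 1")
      case True
      \<comment> \<open>As \<open>x\<close> is 0 or 1, one of the factors y and 1 - y is the
        distance from y to \<open>x\<close>, and the other is at most 1.\<close>
      then have "(y * (1 - y))\<^sup>2 \<le> (y - x)\<^sup>2"
        using 2 by (intro abs_le_square_iff[THEN iffD1]) (auto simp: abs_mult mult_le_cancel_left1 mult_le_cancel_right1)
      then show ?thesis
        using K(2)[of y] True mult_left_mono[OF _ K(1)] order_trans by blast
    next
      case False
      then have "bump p n y = 0"
        unfolding bump_def by (rule if_not_P)
      then show ?thesis
        using K(1) by simp
    qed
    then have "(bump p n has_real_derivative 0) (at x)"
      by (rule quadratic_bound_DERIV_0)
    then show ?thesis
      using 2 by (auto simp: bump_def)
  next
    case 3
    have "((\<lambda>_. 0) has_real_derivative 0) (at x)" by simp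
    then have "(bump p n has_real_derivative 0) (at x)"
      by (rule has_field_derivative_transform_within_open[of _ _ _ "{..<0} \<union> {1<..}"])
        (use 3 in \<open>auto simp: bump_def\<close>)
    moreover have "bump (bump_deriv p n) (n + 2) x = 0"
      unfolding bump_def by (rule if_not_P) (use 3 in auto)
    ultimately show ?thesis
      by simp
  qed
qed

text \<open>The step is the antiderivative of a bump, shifted and divided by its total increase;
  \<open>c\<close> is the reciprocal of that increase. Its derivative is given as a bump so that the
  closure under differentiation remains applicable.\<close>

lemma smooth_step_exists:
  obtains \<Phi> :: "real \<Rightarrow> real" and c :: real where
    "\<And>x. (\<Phi> has_real_derivative bump [:c:] 0 x) (at x)"
    "0 < c" "\<And>x. x \<le> 0 \<Longrightarrow> \<Phi> x = 0" "\<And>x. 1 \<le> x \<Longrightarrow> \<Phi> x = 1" "mono \<Phi>"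
proof -
  define \<rho> where "\<rho> = bump [:1:] 0"
  have \<rho>: "0 \<le> \<rho> x" "x \<le> 0 \<Longrightarrow> \<rho> x = 0" "1 \<le> x \<Longrightarrow> \<rho> x = 0" "0 < x \<Longrightarrow> x < 1 \<Longrightarrow> 0 < \<rho> x" for x
    by (auto simp: \<rho>_def bump_def)
  have "isCont \<rho> x" for x
    unfolding \<rho>_def by (rule DERIV_isCont[OF DERIV_bump])
  then obtain F where F: "\<And>x. (F has_real_derivative \<rho> x) (at x)"
    using einterval_antiderivative[of "-\<infinity>" \<infinity> \<rho>] by (auto simp: has_real_derivative_iff_has_vector_derivative)
  have contF: "continuous_on S F" for S
    using F DERIV_isCont by (intro continuous_at_imp_continuous_on) blast
  have "mono F"
    by (rule monoI, rule DERIV_nonneg_imp_nondecreasing) (use F \<rho> in auto)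
  have F0: "F x = F 0" if "x \<le> 0" for x
  proof (cases "x = 0")
    case False
    show ?thesis
      by (rule DERIV_isconst_end[of x 0 F, symmetric])
        (use \<rho> that False contF in \<open>auto intro: F[THEN DERIV_cong]\<close>)
  qed simp
  have F1: "F x = F 1" if "1 \<le> x" for x
  proof (cases "x = 1")
    case False
    show ?thesis
      by (rule DERIV_isconst_end[of 1 x F])
        (use \<rho> that False contF in \<open>auto intro: F[THEN DERIV_cong]\<close>)
  qed simp
  have lt: "F 0 < F 1"
    by (rule DERIV_pos_imp_increasing_open[of 0 1 F]) (use F \<rho>(4) contF in \<open>simp, blast, simp\<close>)
  define \<Phi> where "\<Phi> x = (F x - F 0) / (F 1 - F 0)" for x
  show ?thesis
  proof (rule that[of \<Phi> "1 / (F 1 - F 0)"])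
    fix x
    have "(\<Phi> has_real_derivative \<rho> x / (F 1 - F 0)) (at x)"
      unfolding \<Phi>_def using lt by (auto intro!: derivative_eq_intros F)
    then show "(\<Phi> has_real_derivative bump [:1 / (F 1 - F 0):] 0 x) (at x)"
      by (auto simp: \<rho>_def bump_def split: if_splits)
    show "mono \<Phi>"
      using \<open>mono F\<close> lt by (auto simp: mono_def \<Phi>_def divide_right_mono)
    show "x \<le> 0 \<Longrightarrow> \<Phi> x = 0" "1 \<le> x \<Longrightarrow> \<Phi> x = 1"
      using lt F0[of x] F1[of x] by (simp_all add: \<Phi>_def)
  qed (use lt in simp)
qed

text \<open>Smoothness without computing any iterate: a set of functions that contains a derivative
  of each of its members also contains all the iterated derivatives.\<close>

lemma iterated_vector_derivative_differentiable:
  fixes f :: "real \<Rightarrow> complex"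
  assumes "f \<in> S" "\<And>g. g \<in> S \<Longrightarrow> \<exists>g'\<in>S. \<forall>x. (g has_vector_derivative g' x) (at x)"
  shows "((\<lambda>g t. vector_derivative g (at t)) ^^ n) f differentiable_on UNIV"
proof -
  have D: "(\<lambda>t. vector_derivative g (at t)) \<in> S" if g: "g \<in> S" for g
  proof -
    obtain g' where "g' \<in> S" "\<forall>x. (g has_vector_derivative g' x) (at x)"
      using assms(2)[OF g] by (elim bexE)
    moreover from this have "(\<lambda>t. vector_derivative g (at t)) = g'"
      by (auto simp: vector_derivative_at)
    ultimately show ?thesis by simp
  qed
  have S: "((\<lambda>g t. vector_derivative g (at t)) ^^ n) f \<in> S"
    by (induction n) (simp_all add: assms(1) D)
  then obtain g' where "\<forall>x. (((\<lambda>g t. vector_derivative g (at t)) ^^ n) f has_vector_derivative g' x) (at x)"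
    using assms(2)[OF S] by (elim bexE)
  then show ?thesis
    by (auto simp: differentiable_on_def intro: differentiableI_vector)
qed

text \<open>A difference of two scaled steps climbs to 1 on [s, s + 1/m] and its second step starts
  at t and is complete at t + 1/m, so its support lies in [s, t + 1/m]. These functions approximate
  the indicator of ]s, t], and their derivatives are differences of approximate identities.\<close>

lemma test_function_steps_exist:
  obtains \<Phi> \<Phi>' :: "real \<Rightarrow> real" where
    "\<And>x. (\<Phi> has_real_derivative \<Phi>' x) (at x)" "continuous_on UNIV \<Phi>'"
    "\<And>x. 0 \<le> \<Phi>' x" "\<And>x. x \<le> 0 \<Longrightarrow> \<Phi>' x = 0" "\<And>x. 1 \<le> x \<Longrightarrow> \<Phi>' x = 0"
    "\<And>x. 0 \<le> \<Phi> x" "\<And>x. \<Phi> x \<le> 1" "\<And>x. x \<le> 0 \<Longrightarrow> \<Phi> x = 0" "\<And>x. 1 \<le> x \<Longrightarrow> \<Phi> x = 1"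
    "\<And>m s t T. 0 < m \<Longrightarrow> 0 < s \<Longrightarrow> s \<le> t \<Longrightarrow> t + 1 / m < T \<Longrightarrow>
       (\<lambda>x. complex_of_real (\<Phi> (m * (x - s)) - \<Phi> (m * (x - t)))) \<in> test_functions T"
proof -
  obtain \<Phi> c where \<Phi>: "\<And>x. (\<Phi> has_real_derivative bump [:c:] 0 x) (at x)" "0 < c"
    "\<And>x. x \<le> 0 \<Longrightarrow> \<Phi> x = 0" "\<And>x. 1 \<le> x \<Longrightarrow> \<Phi> x = 1" "mono \<Phi>"
    by (rule smooth_step_exists) blast
  have \<Phi>01: "0 \<le> \<Phi> x \<and> \<Phi> x \<le> 1" for x
    using \<Phi>(3)[of "min x 0"] \<Phi>(4)[of "max x 1"] monoD[OF \<Phi>(5), of "min x 0" x]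
      monoD[OF \<Phi>(5), of x "max x 1"] by auto
  \<comment> \<open>The step is not itself a bump; only its derivatives are.\<close>
  define B where "B = insert \<Phi> {bump p n | p n. True}"
  have B: "\<exists>\<beta>'\<in>B. \<forall>x. (\<beta> has_real_derivative \<beta>' x) (at x)" if "\<beta> \<in> B" for \<beta>
    using that \<Phi>(1) DERIV_bump unfolding B_def by blast
  show ?thesis
  proof (rule that[of \<Phi> "bump [:c:] 0"])
    show "continuous_on UNIV (bump [:c:] 0)"
      by (intro continuous_at_imp_continuous_on ballI DERIV_isCont[OF DERIV_bump])
    show "(\<Phi> has_real_derivative bump [:c:] 0 x) (at x)" "0 \<le> bump [:c:] 0 x"
      "x \<le> 0 \<Longrightarrow> bump [:c:] 0 x = 0" "1 \<le> x \<Longrightarrow> bump [:c:] 0 x = 0"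
      "0 \<le> \<Phi> x" "\<Phi> x \<le> 1" "x \<le> 0 \<Longrightarrow> \<Phi> x = 0" "1 \<le> x \<Longrightarrow> \<Phi> x = 1" for x
      using \<Phi>(1)[of x] \<Phi>(2) \<Phi>01[of x] \<Phi>(3,4)[of x] by (assumption | simp add: bump_def)+
  next
    fix m s t T :: real
    assume *: "0 < m" "0 < s" "s \<le> t" "t + 1 / m < T"
    define \<phi> where "\<phi> = (\<lambda>x. complex_of_real (\<Phi> (m * (x - s)) - \<Phi> (m * (x - t))))"
    \<comment> \<open>The scalar \<open>d\<close> absorbs the factors \<open>m\<close> that the
      chain rule produces at each differentiation.\<close>
    define S where "S = {\<lambda>x. complex_of_real (d * (\<beta> (m * (x - s)) - \<beta> (m * (x - t)))) | d \<beta>. \<beta> \<in> B}"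
    have "((\<lambda>g t. vector_derivative g (at t)) ^^ n) \<phi> differentiable_on UNIV" for n
    proof (rule iterated_vector_derivative_differentiable[of _ S])
      show "\<phi> \<in> S"
        unfolding S_def \<phi>_def by (intro CollectI exI[of _ 1] exI[of _ \<Phi>]) (auto simp: B_def)
      fix g assume "g \<in> S"
      then obtain d \<beta> where g: "g = (\<lambda>x. complex_of_real (d * (\<beta> (m * (x - s)) - \<beta> (m * (x - t)))))" "\<beta> \<in> B"
        unfolding S_def by blast
      then obtain \<beta>' where \<beta>': "\<beta>' \<in> B" "\<And>x. (\<beta> has_real_derivative \<beta>' x) (at x)"
        using B by blast
      have "(g has_vector_derivative complex_of_real (d * m * (\<beta>' (m * (x - s)) - \<beta>' (m * (x - t))))) (at x)" for x
      proof -
        have "((\<lambda>x. \<beta> (m * (x - r))) has_real_derivative \<beta>' (m * (x - r)) * m) (at x)" for r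
          by (rule DERIV_chain2[OF \<beta>'(2)]) (auto intro!: derivative_eq_intros)
        from this[of s] this[of t]
        have "((\<lambda>x. d * (\<beta> (m * (x - s)) - \<beta> (m * (x - t)))) has_real_derivative
            d * m * (\<beta>' (m * (x - s)) - \<beta>' (m * (x - t)))) (at x)"
          by (auto intro!: derivative_eq_intros) (simp add: algebra_simps)
        then show ?thesis
          unfolding g(1) by (intro has_vector_derivative_of_real)
            (simp add: has_real_derivative_iff_has_vector_derivative)
      qed
      moreover have "(\<lambda>x. complex_of_real (d * m * (\<beta>' (m * (x - s)) - \<beta>' (m * (x - t))))) \<in> S"
        using \<beta>'(1) unfolding S_def by (intro CollectI exI[of _ "d * m"] exI[of _ \<beta>'] conjI) simp_all
      ultimately show "\<exists>g'\<in>S. \<forall>x. (g has_vector_derivative g' x) (at x)"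
        by (intro bexI allI)
    qed
    moreover have "{x. \<phi> x \<noteq> 0} \<subseteq> {s..t + 1 / m}"
    proof (rule subsetI, rule ccontr)
      fix x assume x: "x \<in> {x. \<phi> x \<noteq> 0}" "x \<notin> {s..t + 1 / m}"
      consider "x < s" | "t + 1 / m < x" using x by fastforce
      then show False
      proof cases
        case 1
        then show False
          using x * \<Phi>(3) by (simp add: \<phi>_def mult_nonneg_nonpos)
      next
        case 2
        then have "1 \<le> m * (x - t)" using * by (simp add: field_simps)
        moreover from this have "1 \<le> m * (x - s)"
          using * by (smt (verit) mult_left_mono)
        ultimately show False
          using x \<Phi>(4) by (simp add: \<phi>_def)
      qed
    qed
    then have "closure {x. \<phi> x \<noteq> 0} \<subseteq> {s..t + 1 / m}"
      by (intro closure_minimal) auto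
    ultimately show "\<phi> \<in> test_functions T"
      using * by (force simp: test_functions_def)
  qed
qed

text \<open>The kernel is nonnegative, has mass 1 and vanishes outside [s, s + 1/n], so the integral
  is a weighted mean of \<open>c\<close> just to the right of \<open>s\<close>.\<close>

lemma approximate_identity:
  fixes c :: "real \<Rightarrow> complex"
  assumes \<Phi>: "\<And>x. (\<Phi> has_real_derivative \<Phi>' x) (at x)" "continuous_on UNIV \<Phi>'"
    "\<And>x. 0 \<le> \<Phi>' x" "\<And>x. x \<le> 0 \<Longrightarrow> \<Phi>' x = 0" "\<And>x. 1 \<le> x \<Longrightarrow> \<Phi>' x = 0"
    "\<And>x. x \<le> 0 \<Longrightarrow> \<Phi> x = 0" "\<And>x. 1 \<le> x \<Longrightarrow> \<Phi> x = 1"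
    and c: "continuous_on {0..T} c" and s: "0 < s" "s < T"
  shows "(\<lambda>n. integral {0..T} (\<lambda>x. complex_of_real (real n * \<Phi>' (real n * (x - s))) * c x)) \<longlonglongrightarrow> c s"
proof (rule LIMSEQ_I)
  fix e :: real assume "0 < e"
  then have "0 < e / 2" "s \<in> {0..T}" using s by auto
  then obtain d where d: "0 < d" "\<And>x. x \<in> {0..T} \<Longrightarrow> dist x s < d \<Longrightarrow> dist (c x) (c s) < e / 2"
    using c unfolding continuous_on_iff by blast
  \<comment> \<open>The first summand places the support within distance \<open>d\<close> of
    \<open>s\<close>; the second keeps it inside [0, T], so that no mass is lost at T.\<close>
  obtain N where N: "1 / d + 1 / (T - s) < real N"
    using reals_Archimedean2 by blast
  have "norm (integral {0..T} (\<lambda>x. complex_of_real (real n * \<Phi>' (real n * (x - s))) * c x) - c s) < e" if "N \<le> n" for n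
  proof -
    have "0 < 1 / d" "0 < 1 / (T - s)" using d s by auto
    moreover have "real N \<le> real n" using that by simp
    ultimately have n: "1 / d < n" "1 / (T - s) < n" "0 < real n" using N by linarith+
    define \<psi> where "\<psi> x = real n * \<Phi>' (real n * (x - s))" for x
    have "((\<lambda>x. \<Phi> (real n * (x - s))) has_vector_derivative \<psi> x) (at x within {0..T})" for x
    proof -
      have "((\<lambda>x. \<Phi> (real n * (x - s))) has_real_derivative \<Phi>' (real n * (x - s)) * real n) (at x)"
        by (rule DERIV_chain2[OF \<Phi>(1)]) (auto intro!: derivative_eq_intros)
      then show ?thesis
        by (simp add: \<psi>_def mult.commute has_real_derivative_iff_has_vector_derivative has_vector_derivative_at_within)
    qed
    then have "(\<psi> has_integral \<Phi> (real n * (T - s)) - \<Phi> (real n * (0 - s))) {0..T}"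
      using s by (intro fundamental_theorem_of_calculus) auto
    moreover have "\<Phi> (real n * (T - s)) = 1"
      using n s by (intro \<Phi>) (simp add: field_simps)
    moreover have "\<Phi> (real n * (0 - s)) = 0"
      using s by (intro \<Phi>) simp
    ultimately have \<psi>1: "(\<psi> has_integral 1) {0..T}" by simp
    have cont\<psi>: "continuous_on {0..T} \<psi>"
      unfolding \<psi>_def by (intro continuous_intros continuous_on_compose2[OF \<Phi>(2)]) auto
    have "integral {0..T} (\<lambda>x. complex_of_real (\<psi> x) * c x) - c s
        = integral {0..T} (\<lambda>x. complex_of_real (\<psi> x) * c x) - integral {0..T} (\<lambda>x. complex_of_real (\<psi> x) * c s)"
      using integral_unique[OF has_integral_mult_left[OF has_integral_of_real[OF \<psi>1, where 'b=complex], of "c s"]] by simp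
    also have "\<dots> = integral {0..T} (\<lambda>x. complex_of_real (\<psi> x) * (c x - c s))"
      by (subst Henstock_Kurzweil_Integration.integral_diff[symmetric])
        (auto intro!: integrable_continuous_interval continuous_intros cont\<psi> c simp: algebra_simps)
    also have "norm \<dots> \<le> integral {0..T} (\<lambda>x. \<psi> x * (e / 2))"
    proof (rule integral_norm_bound_integral)
      fix x assume x: "x \<in> {0..T}"
      show "norm (complex_of_real (\<psi> x) * (c x - c s)) \<le> \<psi> x * (e / 2)"
      proof (cases "\<psi> x = 0")
        case False
        then have "\<not> n * (x - s) \<le> 0" "\<not> 1 \<le> n * (x - s)"
          using \<Phi>(4,5) by (auto simp: \<psi>_def)
        then have "0 < x - s" "x - s < 1 / n"
          using n by (auto simp: field_simps zero_less_mult_iff mult_le_0_iff)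
        moreover have "1 / n < d" using n d by (simp add: field_simps)
        ultimately have "norm (c x - c s) \<le> e / 2"
          using d(2)[OF x] by (auto simp: dist_norm intro: less_imp_le)
        moreover have "0 \<le> \<psi> x" using \<Phi>(3) by (simp add: \<psi>_def)
        ultimately show ?thesis
          using mult_left_mono[of "norm (c x - c s)" "e / 2" "\<psi> x"] by (simp add: norm_mult)
      qed simp
    qed (auto intro!: integrable_continuous_interval continuous_intros cont\<psi> c)
    also have "\<dots> = e / 2"
      using integral_unique[OF has_integral_mult_left[OF \<psi>1, of "e / 2"]] by simp
    finally show ?thesis
      using \<open>0 < e\<close> by (simp add: \<psi>_def)
  qed
  then show "\<exists>no. \<forall>n\<ge>no. norm (integral {0..T} (\<lambda>x. complex_of_real (real n * \<Phi>' (real n * (x - s))) * c x) - c s) < e"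
    by blast
qed

section \<open>Weak derivatives and primitives\<close>

lemma absolutely_integrable_on_Icc:
  fixes f :: "real \<Rightarrow> 'b::euclidean_space"
  assumes f: "integrable (lebesgue_on {0<..<T}) f" and "0 \<le> s" "t \<le> T"
  shows "f absolutely_integrable_on {s..t}"
proof -
  have "set_integrable lebesgue (box 0 T) f"
    using f by (simp add: set_integrable_def integrable_restrict_space)
  then have "set_integrable lebesgue (cbox 0 T) f"
    unfolding absolutely_integrable_on_open_interval .
  then show ?thesis
    by (rule set_integrable_subset) (use assms in auto)
qed

lemma LINT_eq_integral_Icc:
  fixes f :: "real \<Rightarrow> 'b::euclidean_space"
  assumes f: "integrable (lebesgue_on {0<..<T}) f" and "0 \<le> s" "t \<le> T"
  shows "(LINT x|lebesgue_on {s<..<t}. f x) = integral {s..t} f"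
proof -
  have "set_integrable lebesgue {s<..<t} f"
    by (rule set_integrable_subset[OF absolutely_integrable_on_Icc[OF assms]]) auto
  then have "integrable (lebesgue_on {s<..<t}) f"
    by (rule absolutely_integrable_imp_integrable) simp
  then show ?thesis
    by (simp add: lebesgue_integral_eq_integral integral_open_interval_real)
qed

text \<open>Half-open intervals arise as limits of smooth steps and generate the Borel sets, whereas
  the interval calculus is done on closed ones; the two differ by the null set {s}.\<close>

lemma set_LINT_eq_integral_Icc:
  fixes f :: "real \<Rightarrow> 'b::euclidean_space"
  assumes f: "integrable (lebesgue_on {0<..<T}) f" and st: "0 < s" "t < T"
  shows "(LINT x:{s<..t}|lebesgue_on {0<..<T}. f x) = integral {s..t} f"
proof -
  let ?M = "lebesgue_on {0<..<T}"
  have "{s<..t} \<in> sets ?M"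
    using st by (auto simp: sets_restrict_space_iff)
  then have int: "integrable ?M (\<lambda>x. indicat_real {s<..t} x *\<^sub>R f x)"
    by (rule integrable_mult_indicator[OF _ f])
  have "(LINT x:{s<..t}|?M. f x) = integral {0<..<T} (\<lambda>x. if x \<in> {s<..t} then f x else 0)"
    unfolding set_lebesgue_integral_def lebesgue_integral_eq_integral[OF int, simplified]
    by (rule Henstock_Kurzweil_Integration.integral_cong) (simp add: indicator_def)
  also have "\<dots> = integral {s<..t} f"
    using st by (subst Henstock_Kurzweil_Integration.integral_restrict_Int) (auto intro!: arg_cong[where f="\<lambda>S. integral S f"])
  also have "\<dots> = integral {s..t} f"
    by (rule integral_spike_set) (auto intro: negligible_subset[of "{s}"])
  finally show ?thesis .
qed

text \<open>The weak formula is tested with smoothed indicators of ]s, t]. On the right, dominated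
  convergence yields the integral of \<gamma>; on the left, the two derivative kernels concentrate
  at \<open>s\<close> and \<open>t\<close> and yield the values of \<open>c\<close>.\<close>

lemma weak_derivative_integral:
  fixes c \<gamma> :: "real \<Rightarrow> complex"
  assumes c: "continuous_on {0..T} c" and \<gamma>: "integrable (lebesgue_on {0<..<T}) \<gamma>"
    and weak: "\<And>\<phi>. \<phi> \<in> test_functions T \<Longrightarrow>
      - (LINT x|lebesgue_on {0<..<T}. vector_derivative \<phi> (at x) * c x)
        = (LINT x|lebesgue_on {0<..<T}. \<phi> x * \<gamma> x)"
    and st: "0 < s" "s \<le> t" "t < T"
  shows "c t - c s = integral {s..t} \<gamma>"
proof -
  obtain \<Phi> \<Phi>' :: "real \<Rightarrow> real" where
    \<Phi>: "\<And>x. (\<Phi> has_real_derivative \<Phi>' x) (at x)" "continuous_on UNIV \<Phi>'"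
    "\<And>x. 0 \<le> \<Phi>' x" "\<And>x. x \<le> 0 \<Longrightarrow> \<Phi>' x = 0" "\<And>x. 1 \<le> x \<Longrightarrow> \<Phi>' x = 0"
    "\<And>x. x \<le> 0 \<Longrightarrow> \<Phi> x = 0" "\<And>x. 1 \<le> x \<Longrightarrow> \<Phi> x = 1"
    and \<Phi>01: "\<And>x. 0 \<le> \<Phi> x" "\<And>x. \<Phi> x \<le> 1"
    and test: "\<And>m s t T. 0 < m \<Longrightarrow> 0 < s \<Longrightarrow> s \<le> t \<Longrightarrow> t + 1 / m < T \<Longrightarrow>
       (\<lambda>x. complex_of_real (\<Phi> (m * (x - s)) - \<Phi> (m * (x - t)))) \<in> test_functions T"
    by (rule test_function_steps_exist) blast
  define \<phi> where "\<phi> n x = complex_of_real (\<Phi> (real n * (x - s)) - \<Phi> (real n * (x - t)))" for n x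
  define K where "K n r x = complex_of_real (real n * \<Phi>' (real n * (x - r)))" for n r x
  let ?M = "lebesgue_on {0<..<T}"
  have T: "0 < T" using st by linarith
  have contK: "continuous_on UNIV (K n r)" for n r
    unfolding K_def by (intro continuous_intros continuous_on_compose2[OF \<Phi>(2)]) auto
  have Kc: "integrable ?M (\<lambda>x. K n r x * c x)" "(LINT x|?M. K n r x * c x) = integral {0..T} (\<lambda>x. K n r x * c x)" for n r
  proof -
    have "continuous_on {0..T} (\<lambda>x. K n r x * c x)"
      by (intro continuous_intros c continuous_on_subset[OF contK]) auto
    then have "(\<lambda>x. K n r x * c x) absolutely_integrable_on {0..T}"
      by (rule absolutely_integrable_continuous_real)
    then have "(\<lambda>x. K n r x * c x) absolutely_integrable_on {0<..<T}"
      by (rule set_integrable_subset) auto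
    then show *: "integrable ?M (\<lambda>x. K n r x * c x)"
      by (rule absolutely_integrable_imp_integrable) simp
    show "(LINT x|?M. K n r x * c x) = integral {0..T} (\<lambda>x. K n r x * c x)"
      by (simp add: lebesgue_integral_eq_integral[OF *] integral_open_interval_real)
  qed
  have lim: "(\<lambda>n. LINT x|?M. \<phi> n x * \<gamma> x) \<longlonglongrightarrow> (LINT x|?M. indicat_real {s<..t} x *\<^sub>R \<gamma> x)"
  proof (rule integral_dominated_convergence)
    show "integrable ?M (\<lambda>x. norm (\<gamma> x))" using \<gamma> by simp
    have "continuous_on UNIV \<Phi>"
      using \<Phi>(1) DERIV_isCont by (intro continuous_at_imp_continuous_on) blast
    then have "continuous_on {0<..<T} (\<lambda>x. \<Phi> (real n * (x - r)))" for n r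
      by (rule continuous_on_compose2) (auto intro!: continuous_intros)
    then have "continuous_on {0<..<T} (\<phi> n)" for n
      unfolding \<phi>_def by (intro continuous_on_of_real continuous_on_diff)
    then have "\<phi> n \<in> borel_measurable ?M" for n
      by (rule continuous_imp_measurable_on_sets_lebesgue) simp
    then show "(\<lambda>x. \<phi> n x * \<gamma> x) \<in> borel_measurable ?M" for n
      using \<gamma> by (intro borel_measurable_times) auto
    have "{s<..t} \<in> sets ?M"
      using st by (auto simp: sets_restrict_space_iff)
    then show "(\<lambda>x. indicat_real {s<..t} x *\<^sub>R \<gamma> x) \<in> borel_measurable ?M"
      using \<gamma> by auto
    show "AE x in ?M. (\<lambda>n. \<phi> n x * \<gamma> x) \<longlonglongrightarrow> indicat_real {s<..t} x *\<^sub>R \<gamma> x"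
    proof (intro AE_I2)
      fix x
      \<comment> \<open>At x = r the step is still 0, so the limit is the indicator of the open
        half-line. This is why the limiting interval excludes \<open>s\<close> and includes
        \<open>t\<close>.\<close>
      have step: "(\<lambda>n. \<Phi> (real n * (x - r))) \<longlonglongrightarrow> (if r < x then 1 else 0)" for r
      proof (cases "r < x")
        case True
        obtain N where N: "1 / (x - r) < real N" using reals_Archimedean2 by blast
        have "\<Phi> (real n * (x - r)) = 1" if "N \<le> n" for n
        proof (rule \<Phi>(7))
          have "1 / (x - r) < real n" using N that by (simp add: order_less_le_trans)
          then show "1 \<le> real n * (x - r)"
            using True by (simp add: pos_divide_less_eq)
        qed
        then have "\<forall>\<^sub>F n in sequentially. \<Phi> (real n * (x - r)) = 1"
          using eventually_sequentially by blast
        then show ?thesis using True by (simp add: tendsto_eventually)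
      next
        case False
        then show ?thesis using \<Phi>(6) by (simp add: mult_nonneg_nonpos)
      qed
      have "(\<lambda>n. \<phi> n x * \<gamma> x) \<longlonglongrightarrow> complex_of_real ((if s < x then 1 else 0) - (if t < x then 1 else 0)) * \<gamma> x"
        unfolding \<phi>_def by (intro tendsto_intros step)
      also have "complex_of_real ((if s < x then 1 else 0) - (if t < x then 1 else 0)) * \<gamma> x = indicat_real {s<..t} x *\<^sub>R \<gamma> x"
        using st by auto
      finally show "(\<lambda>n. \<phi> n x * \<gamma> x) \<longlonglongrightarrow> indicat_real {s<..t} x *\<^sub>R \<gamma> x" .
    qed
    show "AE x in ?M. norm (\<phi> n x * \<gamma> x) \<le> norm (\<gamma> x)" for n
    proof (intro AE_I2)
      fix x
      have "norm (\<phi> n x) \<le> 1"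
        using \<Phi>01(1)[of "n * (x - s)"] \<Phi>01(1)[of "n * (x - t)"] \<Phi>01(2)[of "n * (x - s)"] \<Phi>01(2)[of "n * (x - t)"]
        unfolding \<phi>_def norm_of_real by linarith
      then show "norm (\<phi> n x * \<gamma> x) \<le> norm (\<gamma> x)"
        by (simp add: norm_mult mult_left_le_one_le)
    qed
  qed
  have "(\<lambda>n. LINT x|?M. \<phi> n x * \<gamma> x) \<longlonglongrightarrow> c t - c s"
  proof (rule Lim_transform_eventually)
    have "(\<lambda>n. integral {0..T} (\<lambda>x. K n r x * c x)) \<longlonglongrightarrow> c r" if "0 < r" "r < T" for r
      unfolding K_def by (rule approximate_identity[OF \<Phi> c that])
    then show "(\<lambda>n. integral {0..T} (\<lambda>x. K n t x * c x) - integral {0..T} (\<lambda>x. K n s x * c x)) \<longlonglongrightarrow> c t - c s"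
      using st by (intro tendsto_diff) auto
    \<comment> \<open>From this index on, t + 1/n < T, so that the smoothed indicator is a test
      function.\<close>
    obtain N where N: "1 / (T - t) < real N" using reals_Archimedean2 by blast
    have "integral {0..T} (\<lambda>x. K n t x * c x) - integral {0..T} (\<lambda>x. K n s x * c x) = (LINT x|?M. \<phi> n x * \<gamma> x)"
      if n: "N \<le> n" for n
    proof -
      have "0 < 1 / (T - t)" using st by simp
      moreover have "real N \<le> n" using n by simp
      ultimately have n': "0 < real n" "1 / (T - t) < real n" using N by linarith+
      then have "\<phi> n \<in> test_functions T"
        unfolding \<phi>_def using st by (intro test) (auto simp: field_simps)
      then have w: "- (LINT x|?M. vector_derivative (\<phi> n) (at x) * c x) = (LINT x|?M. \<phi> n x * \<gamma> x)"
        by (rule weak)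
      \<comment> \<open>The kernel at \<open>s\<close> enters with a plus and the one at
        \<open>t\<close> with a minus; the sign in the definition of the weak derivative reverses
        this.\<close>
      have "vector_derivative (\<phi> n) (at x) = K n s x - K n t x" for x
      proof (rule vector_derivative_at)
        have d: "((\<lambda>x. \<Phi> (real n * (x - r))) has_real_derivative \<Phi>' (real n * (x - r)) * real n) (at x)" for r
          by (rule DERIV_chain2[OF \<Phi>(1)]) (auto intro!: derivative_eq_intros)
        from d[of s] d[of t]
        have "((\<lambda>x. \<Phi> (real n * (x - s)) - \<Phi> (real n * (x - t))) has_real_derivative
            real n * \<Phi>' (real n * (x - s)) - real n * \<Phi>' (real n * (x - t))) (at x)"
          by (auto intro!: derivative_eq_intros)
        then have "((\<lambda>x. complex_of_real (\<Phi> (real n * (x - s)) - \<Phi> (real n * (x - t)))) has_vector_derivative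
            complex_of_real (real n * \<Phi>' (real n * (x - s)) - real n * \<Phi>' (real n * (x - t)))) (at x)"
          by (intro has_vector_derivative_of_real) (simp add: has_real_derivative_iff_has_vector_derivative)
        then show "(\<phi> n has_vector_derivative K n s x - K n t x) (at x)"
          by (simp add: \<phi>_def[abs_def] K_def)
      qed
      then have "(LINT x|?M. vector_derivative (\<phi> n) (at x) * c x) = (LINT x|?M. K n s x * c x - K n t x * c x)"
        by (simp only: left_diff_distrib)
      also have "\<dots> = integral {0..T} (\<lambda>x. K n s x * c x) - integral {0..T} (\<lambda>x. K n t x * c x)"
        by (simp add: Kc)
      finally show ?thesis using w by simp
    qed
    then show "\<forall>\<^sub>F n in sequentially. integral {0..T} (\<lambda>x. K n t x * c x) - integral {0..T} (\<lambda>x. K n s x * c x)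
        = (LINT x|?M. \<phi> n x * \<gamma> x)"
      using eventually_sequentially by blast
  qed
  from LIMSEQ_unique[OF this lim] show ?thesis
    using set_LINT_eq_integral_Icc[OF \<gamma> st(1,3)] by (simp add: set_lebesgue_integral_def)
qed

text \<open>The vanishing is extended from intervals to Borel sets by the pi-lambda argument, then
  to Lebesgue sets up to null sets; a function whose integral over every measurable set is zero
  vanishes almost everywhere. This will give uniqueness of weak derivatives.\<close>

lemma AE_zero_of_interval_integrals:
  fixes q :: "real \<Rightarrow> 'b::{banach, second_countable_topology}"
  assumes q: "integrable (lebesgue_on {0<..<T}) q"
    and zero: "\<And>s t. 0 < s \<Longrightarrow> s \<le> t \<Longrightarrow> t < T \<Longrightarrow> (LINT x:{s<..t}|lebesgue_on {0<..<T}. q x) = 0"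
  shows "AE x in lebesgue_on {0<..<T}. q x = 0"
proof (cases "0 < T")
  case True
  let ?M = "lebesgue_on {0<..<T}"
  interpret finite_measure ?M
    by (rule finite_measure_lebesgue_on) simp
  have sets: "A \<inter> {0<..<T} \<in> sets ?M" if "A \<in> sets lebesgue" for A
    using that by (auto simp: sets_restrict_space)
  have int: "set_integrable ?M (A \<inter> {0<..<T}) q" if "A \<in> sets lebesgue" for A
    unfolding set_integrable_def by (intro integrable_mult_indicator sets that q)
  have cut: "(LINT x:A|?M. q x) = (LINT x:A \<inter> {0<..<T}|?M. q x)" for A
    unfolding set_lebesgue_integral_def by (intro Bochner_Integration.integral_cong) (auto simp: indicator_def)
  have Ioc: "(LINT x:{a<..b}|?M. q x) = 0" for a b
  proof -
    \<comment> \<open>The hypothesis covers only intervals with endpoints strictly inside ]0, T[. A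
      general interval is exhausted from within, at the positive distance \<open>d n\<close> from 0
      and T.\<close>
    define d where "d n = T / (n + 3)" for n :: nat
    define A where "A n = {max a (d n)<..min b (T - d n)} \<inter> {0<..<T}" for n
    have d: "0 < d n" "d n \<le> T / 3" for n
      using True by (auto simp: d_def field_simps)
    have dlim: "d \<longlonglongrightarrow> 0"
      unfolding d_def by real_asymp
    have decd: "d n \<le> d m" if "m \<le> n" for m n
      using that True by (auto simp: d_def intro!: divide_left_mono)
    have "incseq A"
      unfolding incseq_def
    proof (intro allI impI subsetI)
      fix m n x assume "m \<le> n" "x \<in> A m"
      then show "x \<in> A n"
        using decd[of m n] by (auto simp: A_def)
    qed
    have "(\<Union>n. A n) = {a<..b} \<inter> {0<..<T}"
    proof (intro equalityI subsetI)
      fix x assume x: "x \<in> {a<..b} \<inter> {0<..<T}"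
      then have "\<forall>\<^sub>F n in sequentially. d n < min x (T - x)"
        by (intro order_tendstoD[OF dlim]) auto
      then obtain n where "d n < min x (T - x)"
        using eventually_happens'[OF sequentially_bot] by blast
      then show "x \<in> (\<Union>n. A n)"
        using x by (auto simp: A_def intro!: exI[of _ n])
    qed (auto simp: A_def)
    moreover have "(LINT x:A n|?M. q x) = 0" for n
    proof (cases "max a (d n) \<le> min b (T - d n)")
      case True
      show ?thesis
        unfolding A_def cut[symmetric] using True d[of n] by (intro zero) auto
    qed (auto simp: A_def set_lebesgue_integral_def)
    moreover have "(\<lambda>n. LINT x:A n|?M. q x) \<longlonglongrightarrow> (LINT x:(\<Union>n. A n)|?M. q x)"
    proof (rule set_integral_cont_up)
      show "A n \<in> sets ?M" for n
        unfolding A_def by (rule sets) simp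
      show "set_integrable ?M (\<Union>n. A n) q"
        unfolding \<open>(\<Union>n. A n) = {a<..b} \<inter> {0<..<T}\<close> by (rule int) simp
    qed fact
    ultimately have "(\<lambda>n::nat. 0) \<longlonglongrightarrow> (LINT x:{a<..b} \<inter> {0<..<T}|?M. q x)" by simp
    then show ?thesis
      unfolding cut[of "{a<..b}"] by (simp add: LIMSEQ_const_iff)
  qed
  have borel: "(LINT x:A|?M. q x) = 0" if "A \<in> sets borel" for A
  proof -
    have A: "A \<in> sigma_sets UNIV (range (\<lambda>(a, b). {a<..b}))"
      using that unfolding borel_sigma_sets_Ioc by simp
    have stable: "Int_stable (range (\<lambda>(a, b). {a<..b::real}))"
      by (auto simp: Int_stable_def)
    have lebesgue: "B \<in> sets lebesgue" if "B \<in> sigma_sets UNIV (range (\<lambda>(a, b). {a<..b::real}))" for B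
    proof -
      have "B \<in> sets borel"
        using that unfolding borel_sigma_sets_Ioc by simp
      then show ?thesis by simp
    qed
    show ?thesis
      using stable subset_Pow_Union[THEN subset_trans, OF Pow_mono[OF subset_UNIV]] A
    proof (induction rule: sigma_sets_induct_disjoint)
      case (compl A)
      \<comment> \<open>A set and its complement together fill ]0, T[, which is the trace of the
        half-open interval from 0 to T and hence already has integral 0.\<close>
      have "(A \<inter> {0<..<T}) \<union> ((UNIV - A) \<inter> {0<..<T}) = {0<..T} \<inter> {0<..<T}"
        by auto
      then have 0: "(LINT x:(A \<inter> {0<..<T}) \<union> ((UNIV - A) \<inter> {0<..<T})|?M. q x) = 0"
        using Ioc[of 0 T] cut[of "{0<..T}"] by simp
      have "(LINT x:(A \<inter> {0<..<T}) \<union> ((UNIV - A) \<inter> {0<..<T})|?M. q x)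
          = (LINT x:A|?M. q x) + (LINT x:UNIV - A|?M. q x)"
        unfolding cut[of A] cut[of "UNIV - A"]
        using lebesgue[OF compl(1)] by (intro set_integral_Un int) auto
      then show ?case
        using 0 compl(2) by simp
    next
      case (union A)
      have "(LINT x:(\<Union>i. A i \<inter> {0<..<T})|?M. q x) = (\<Sum>i. LINT x:A i \<inter> {0<..<T}|?M. q x)"
      proof (rule lebesgue_integral_countable_add)
        show "A i \<inter> {0<..<T} \<in> sets ?M" for i
          using union(2) by (intro sets lebesgue) auto
        show "set_integrable ?M (\<Union>i. A i \<inter> {0<..<T}) q"
          using int[of "\<Union> (range A)"] union(2) lebesgue by (auto simp: image_subset_iff)
      qed (use union(1) in \<open>auto simp: disjoint_family_on_def\<close>)
      also have "\<dots> = 0"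
        using union(3) by (simp flip: cut)
      finally show ?case
        unfolding cut[of "\<Union> (range A)"] by simp
    qed (use Ioc in \<open>auto simp: set_lebesgue_integral_def\<close>)
  qed
  show ?thesis
  proof (rule density_zero[OF q])
    fix A assume "A \<in> sets ?M"
    then obtain A' where A': "A' \<in> sets lebesgue" "A = A' \<inter> {0<..<T}"
      by (auto simp: sets_restrict_space)
    \<comment> \<open>A Lebesgue set is a Borel set up to a subset of a Borel null set, which the
      integral does not see.\<close>
    then obtain S N N' where S: "A' = S \<union> N" "N \<subseteq> N'" "N' \<in> null_sets lborel" "S \<in> sets lborel"
      using sets_completionE by blast
    have "N' \<in> null_sets lebesgue"
      using S(3) by (rule null_sets_completionI)
    then have "AE x in lebesgue. x \<notin> N'"
      by (rule AE_not_in)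
    then have "AE x in ?M. x \<notin> N'"
      by (subst AE_restrict_space_iff) auto
    then have "(LINT x:A|?M. q x) = (LINT x:S|?M. q x)"
      unfolding set_lebesgue_integral_def
    proof (intro integral_cong_AE)
      assume "AE x in ?M. x \<notin> N'"
      then show "AE x in ?M. indicat_real A x *\<^sub>R q x = indicat_real S x *\<^sub>R q x"
        using AE_space by eventually_elim (use S A' in \<open>auto simp: indicator_def\<close>)
    next
      show "(\<lambda>x. indicat_real A x *\<^sub>R q x) \<in> borel_measurable ?M"
        using \<open>A \<in> sets ?M\<close> q by auto
      have "(\<lambda>x. indicat_real S x) \<in> borel_measurable ?M"
        using S(4) by (intro measurable_restrict_space1 measurable_completion) auto
      then show "(\<lambda>x. indicat_real S x *\<^sub>R q x) \<in> borel_measurable ?M"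
        using q by (intro borel_measurable_scaleR) auto
    qed
    then show "(LINT x:A|?M. q x) = 0"
      using borel S(4) by simp
  qed
qed (simp add: AE_restrict_space_iff)

section \<open>Measurability and integrability of products and pairings\<close>

lemma bounded_bilinear_scaleC:
  "bounded_bilinear (scaleC :: complex \<Rightarrow> 'a::complex_normed_vector \<Rightarrow> 'a)"
proof (rule bounded_bilinear.intro)
  fix r :: real and c :: complex and x :: 'a
  show "(r *\<^sub>R c) *\<^sub>C x = r *\<^sub>R (c *\<^sub>C x)"
    unfolding scaleR_scaleC[of r "c *\<^sub>C x"] by (simp add: scaleC_scaleC scaleR_conv_of_real)
  show "c *\<^sub>C (r *\<^sub>R x) = r *\<^sub>R (c *\<^sub>C x)"
    unfolding scaleR_scaleC[of r "c *\<^sub>C x"] scaleR_scaleC[of r x] by (simp add: scaleC_scaleC mult.commute)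
  show "\<exists>K. \<forall>(a::complex) (b::'a). norm (a *\<^sub>C b) \<le> norm a * norm b * K"
    by (rule exI[of _ 1]) (simp add: norm_scaleC)
qed (simp_all add: scaleC_add_left scaleC_add_right)

lemma bounded_bilinear_pairing:
  "bounded_bilinear (pairing :: 'v::complex_normed_vector antidual \<Rightarrow> 'v \<Rightarrow> complex)"
proof (rule bounded_bilinear.intro)
  interpret p: bounded_linear "pairing f" for f :: "'v antidual"
    by (rule bounded_linear_pairing)
  fix f g :: "'v antidual" and v w :: 'v and r :: real
  show "pairing (f + g) v = pairing f v + pairing g v"
    by (simp add: plus_antidual.rep_eq)
  show "pairing (r *\<^sub>R f) v = r *\<^sub>R pairing f v"
    by (simp add: scaleR_antidual.rep_eq)
  show "pairing f (v + w) = pairing f v + pairing f w" "pairing f (r *\<^sub>R v) = r *\<^sub>R pairing f v"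
    by (rule p.add p.scaleR)+
  show "\<exists>K. \<forall>(f::'v antidual) v. norm (pairing f v) \<le> norm f * norm v * K"
    by (rule exI[of _ 1]) (simp add: norm_pairing)
qed

lemma bounded_bilinear_measurable:
  fixes f :: "'m \<Rightarrow> 'a::{real_normed_vector, second_countable_topology}"
    and g :: "'m \<Rightarrow> 'b::{real_normed_vector, second_countable_topology}"
  assumes "bounded_bilinear H" "f \<in> borel_measurable M" "g \<in> borel_measurable M"
  shows "(\<lambda>x. H (f x) (g x)) \<in> borel_measurable M"
proof (rule borel_measurable_continuous_Pair[OF assms(2,3)])
  show "continuous_on UNIV (\<lambda>x. H (fst x) (snd x))"
    by (rule bounded_bilinear.continuous_on[OF assms(1)])
      (intro continuous_on_fst continuous_on_snd continuous_on_id)+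
qed

text \<open>The interval has finite measure and r is at most 1 + r^2.\<close>

lemma L2_imp_integrable_norm:
  assumes "f \<in> L2 T"
  shows "integrable (lebesgue_on {0<..<T}) (\<lambda>t. norm (f t))"
proof -
  interpret finite_measure "lebesgue_on {0<..<T}"
    by (rule finite_measure_lebesgue_on) simp
  have "norm (f t) \<le> 1 + (norm (f t))\<^sup>2" for t
  proof -
    have "2 * norm (f t) \<le> 1 + (norm (f t))\<^sup>2"
      using zero_le_power2[of "norm (f t) - 1"] by (simp add: power2_diff)
    then show ?thesis
      using norm_ge_zero[of "f t"] by linarith
  qed
  then have bound: "norm (norm (f t)) \<le> norm (1 + (norm (f t))\<^sup>2)" for t
    by (simp add: abs_of_nonneg)
  show ?thesis
  proof (rule Bochner_Integration.integrable_bound)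
    show "integrable (lebesgue_on {0<..<T}) (\<lambda>t. 1 + (norm (f t))\<^sup>2)"
      using assms by (simp add: L2_def)
    show "(\<lambda>t. norm (f t)) \<in> borel_measurable (lebesgue_on {0<..<T})"
      by (rule measurable_compose[OF _ borel_measurable_norm]) (use assms in \<open>simp add: L2_def\<close>)
  qed (intro AE_I2 bound)
qed

lemma integrable_pairing_const:
  fixes g :: "real \<Rightarrow> 'v::{chilbert_space, second_countable_topology} antidual"
  assumes "g \<in> L2 T"
  shows "integrable (lebesgue_on {0<..<T}) (\<lambda>\<tau>. pairing (g \<tau>) v)"
proof (rule Bochner_Integration.integrable_bound)
  show "integrable (lebesgue_on {0<..<T}) (\<lambda>t. norm (g t) * norm v)"
    using L2_imp_integrable_norm[OF assms] by simp
  show "(\<lambda>\<tau>. pairing (g \<tau>) v) \<in> borel_measurable (lebesgue_on {0<..<T})"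
    using assms by (intro bounded_bilinear_measurable[OF bounded_bilinear_pairing]) (simp_all add: L2_def)
  show "AE x in lebesgue_on {0<..<T}. norm (pairing (g x) v) \<le> norm (norm (g x) * norm v)"
    by (intro AE_I2) (simp add: norm_pairing)
qed

lemma integrable_pairing_L2:
  fixes g :: "real \<Rightarrow> 'v::{chilbert_space, second_countable_topology} antidual"
  assumes g: "g \<in> L2 T" and y: "y \<in> L2 T"
  shows "integrable (lebesgue_on {0<..<T}) (\<lambda>\<tau>. pairing (g \<tau>) (y \<tau>))"
proof (rule Bochner_Integration.integrable_bound)
  show "integrable (lebesgue_on {0<..<T}) (\<lambda>t. (norm (g t))\<^sup>2 + (norm (y t))\<^sup>2)"
    using assms by (simp add: L2_def)
  show "(\<lambda>\<tau>. pairing (g \<tau>) (y \<tau>)) \<in> borel_measurable (lebesgue_on {0<..<T})"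
    using assms by (intro bounded_bilinear_measurable[OF bounded_bilinear_pairing]) (simp_all add: L2_def)
  have "norm (pairing (g x) (y x)) \<le> norm ((norm (g x))\<^sup>2 + (norm (y x))\<^sup>2)" for x
  proof -
    have "2 * (norm (g x) * norm (y x)) \<le> (norm (g x))\<^sup>2 + (norm (y x))\<^sup>2"
      using sum_squares_bound[of "norm (g x)" "norm (y x)"] by simp
    moreover have "0 \<le> norm (g x) * norm (y x)" by simp
    ultimately have "norm (pairing (g x) (y x)) \<le> (norm (g x))\<^sup>2 + (norm (y x))\<^sup>2"
      using norm_pairing[of "g x" "y x"] by linarith
    then show ?thesis by simp
  qed
  then show "AE x in lebesgue_on {0<..<T}. norm (pairing (g x) (y x)) \<le> norm ((norm (g x))\<^sup>2 + (norm (y x))\<^sup>2)"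
    by (intro AE_I2)
qed

lemma bounded_linear_embed:
  fixes \<iota> :: "'v::chilbert_space \<Rightarrow> 'h::chilbert_space"
  assumes G: "gelfand_triple \<iota>"
  shows "bounded_linear (embed \<iota>)"
proof -
  interpret \<iota>: bounded_linear \<iota>
    using G by (simp add: gelfand_triple_def bounded_clinear_def)
  obtain K where K: "0 < K" "\<And>v. norm (\<iota> v) \<le> norm v * K"
    using \<iota>.pos_bounded by blast
  show ?thesis
  proof (rule bounded_linear_intro[where K=K])
    fix h h' :: 'h and r :: real
    show "embed \<iota> (h + h') = embed \<iota> h + embed \<iota> h'"
      by (simp add: pairing_inject[symmetric] fun_eq_iff pairing_embed[OF G] plus_antidual.rep_eq cinner_add_left)
    have "cinner (r *\<^sub>R h) v = r *\<^sub>R cinner h v" for v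
      by (simp add: scaleR_scaleC[of r h] cinner_scaleC_left scaleR_conv_of_real)
    then show "embed \<iota> (r *\<^sub>R h) = r *\<^sub>R embed \<iota> h"
      by (simp add: pairing_inject[symmetric] fun_eq_iff pairing_embed[OF G] scaleR_antidual.rep_eq)
    show "norm (embed \<iota> h) \<le> norm h * K"
    proof (rule norm_antidual_bound)
      fix v
      have "cmod (cinner h (\<iota> v)) \<le> norm h * (norm v * K)"
        by (rule order_trans[OF cinner_Cauchy_Schwarz mult_left_mono[OF K(2) norm_ge_zero]])
      then show "cmod (pairing (embed \<iota> h) v) \<le> norm h * K * norm v"
        by (simp add: pairing_embed[OF G] algebra_simps)
    qed (use K in simp)
  qed
qed

lemma test_function_continuous:
  assumes "\<phi> \<in> test_functions T"
  shows "continuous_on UNIV \<phi>" "continuous_on UNIV (\<lambda>t. vector_derivative \<phi> (at t))"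
proof -
  have *: "((\<lambda>g t. vector_derivative g (at t)) ^^ n) \<phi> differentiable_on UNIV" for n
    using assms by (simp add: test_functions_def)
  show "continuous_on UNIV \<phi>" "continuous_on UNIV (\<lambda>t. vector_derivative \<phi> (at t))"
    using *[of 0] *[of 1] by (auto intro: differentiable_imp_continuous_on)
qed

lemma bounded_on_open_interval:
  fixes \<psi> :: "real \<Rightarrow> 'a::real_normed_vector"
  assumes "continuous_on {0..T} \<psi>"
  shows "\<exists>B. \<forall>x\<in>{0<..<T}. norm (\<psi> x) \<le> B"
proof -
  have "bounded (\<psi> ` {0..T})"
    using assms by (intro compact_imp_bounded compact_continuous_image) auto
  then show ?thesis by (force simp: bounded_iff)
qed

lemma measurable_on_open_interval:
  assumes "continuous_on {0..T::real} \<psi>"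
  shows "\<psi> \<in> borel_measurable (lebesgue_on {0<..<T})"
  by (rule continuous_imp_measurable_on_sets_lebesgue[OF continuous_on_subset[OF assms]]) auto

lemma integrable_scaleC_continuous:
  fixes f :: "real \<Rightarrow> 'e::{complex_normed_vector, banach, second_countable_topology}"
  assumes \<psi>: "continuous_on {0..T} \<psi>" and f: "f \<in> borel_measurable (lebesgue_on {0<..<T})"
    "integrable (lebesgue_on {0<..<T}) (\<lambda>t. norm (f t))"
  shows "integrable (lebesgue_on {0<..<T}) (\<lambda>x. \<psi> x *\<^sub>C f x)"
proof -
  obtain B where B: "\<And>x. x \<in> {0<..<T} \<Longrightarrow> norm (\<psi> x) \<le> B"
    using bounded_on_open_interval[OF \<psi>] by blast
  show ?thesis
  proof (rule Bochner_Integration.integrable_bound)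
    show "integrable (lebesgue_on {0<..<T}) (\<lambda>t. B * norm (f t))" using f(2) by simp
    show "(\<lambda>x. \<psi> x *\<^sub>C f x) \<in> borel_measurable (lebesgue_on {0<..<T})"
      by (intro bounded_bilinear_measurable[OF bounded_bilinear_scaleC] measurable_on_open_interval \<psi> f)
    show "AE x in lebesgue_on {0<..<T}. norm (\<psi> x *\<^sub>C f x) \<le> norm (B * norm (f x))"
    proof (rule AE_I2)
      fix x assume "x \<in> space (lebesgue_on {0<..<T})"
      then have "norm (\<psi> x) \<le> B" using B by simp
      then show "norm (\<psi> x *\<^sub>C f x) \<le> norm (B * norm (f x))"
        using norm_ge_zero[of "\<psi> x"] by (simp add: norm_scaleC abs_mult mult_right_mono)
    qed
  qed
qed

text \<open>Evaluation at \<open>v\<close> is a bounded linear functional on the antidual, so it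
  commutes with the integrals defining the distributions. The vector equation thereby reduces to the
  scalar lemma for the continuous function \<tau> -> (u(\<tau>) | \<iota> v).\<close>

lemma weak_derivative_increment:
  fixes \<iota> :: "'v::{chilbert_space, second_countable_topology} \<Rightarrow> 'h::chilbert_space"
  assumes G: "gelfand_triple \<iota>" and u: "continuous_on {0..T} u"
    and g: "has_L2_deriv T (embed \<iota> \<circ> u) g" and st: "0 < s" "s \<le> t" "t < T"
  shows "cinner (u t - u s) (\<iota> v) = integral {s..t} (\<lambda>\<tau>. pairing (g \<tau>) v)"
proof -
  let ?M = "lebesgue_on {0<..<T}"
  interpret finite_measure ?M
    by (rule finite_measure_lebesgue_on) simp
  interpret P: bounded_bilinear "pairing :: 'v antidual \<Rightarrow> 'v \<Rightarrow> complex"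
    by (rule bounded_bilinear_pairing)
  note evalv = P.bounded_linear_left[of v]
  define w where "w = embed \<iota> \<circ> u"
  have gL2: "g \<in> L2 T" and weak: "\<And>\<phi>. \<phi> \<in> test_functions T \<Longrightarrow> distr_deriv (regular T w) \<phi> = regular T g \<phi>"
    using g by (auto simp: has_L2_deriv_def w_def)
  have gm: "g \<in> borel_measurable ?M" using gL2 by (simp add: L2_def)
  have w: "continuous_on {0..T} w"
    unfolding w_def comp_def by (intro bounded_linear.continuous_on[OF bounded_linear_embed[OF G]] u)
  have eval: "pairing (LINT x|?M. \<psi> x *\<^sub>C f x) v = (LINT x|?M. \<psi> x * pairing (f x) v)"
    if \<psi>: "continuous_on {0..T} \<psi>" and f: "f \<in> borel_measurable ?M" "integrable ?M (\<lambda>t. norm (f t))"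
    for \<psi> :: "real \<Rightarrow> complex" and f :: "real \<Rightarrow> 'v antidual"
  proof -
    from integral_bounded_linear[OF evalv integrable_scaleC_continuous[OF \<psi> f]] show ?thesis
      by (simp add: scaleC_antidual.rep_eq)
  qed
  define c where "c x = cinner (u x) (\<iota> v)" for x
  have c: "c x = pairing (w x) v" for x
    by (simp add: c_def w_def pairing_embed[OF G])
  have "c t - c s = integral {s..t} (\<lambda>\<tau>. pairing (g \<tau>) v)"
  proof (rule weak_derivative_integral[OF _ _ _ st])
    show "continuous_on {0..T} c"
      unfolding c by (intro bounded_linear.continuous_on[OF evalv] w)
    show "integrable ?M (\<lambda>\<tau>. pairing (g \<tau>) v)"
      by (rule integrable_pairing_const[OF gL2])
    fix \<phi> assume \<phi>: "\<phi> \<in> test_functions T"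
    note cont = test_function_continuous[OF \<phi>, THEN continuous_on_subset, of "{0..T}", simplified]
    obtain B where B: "\<And>x. x \<in> {0<..<T} \<Longrightarrow> norm (w x) \<le> B"
      using bounded_on_open_interval[OF w] by blast
    have wint: "integrable ?M (\<lambda>t. norm (w t))"
      by (intro integrable_const_bound[of _ B] AE_I2) (use B measurable_on_open_interval[OF w] in auto)
    have "pairing (distr_deriv (regular T w) \<phi>) v = pairing (regular T g \<phi>) v"
      using weak[OF \<phi>] by simp
    then show "- (LINT x|?M. vector_derivative \<phi> (at x) * c x) = (LINT x|?M. \<phi> x * pairing (g x) v)"
      unfolding distr_deriv_def regular_def c
      by (simp add: uminus_antidual.rep_eq eval cont measurable_on_open_interval w wint gm L2_imp_integrable_norm[OF gL2])
  qed
  moreover have "cinner (u t - u s) (\<iota> v) = c t - c s"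
    using cinner_add_left[of "u t - u s" "u s" "\<iota> v"] by (simp add: c_def)
  ultimately show ?thesis by simp
qed

section \<open>Density of \<open>H\<close> in \<open>V\<^sup>*\<close>\<close>

text \<open>The projection argument: a minimizing sequence for the distance from \<open>x\<close> to
  \<open>S\<close> is Cauchy by the parallelogram law, and \<open>x\<close> minus its limit is
  orthogonal to \<open>S\<close>, hence zero. The limit lies only in the closure, since
  \<open>S\<close> need not be closed.\<close>

lemma closure_subspace_eq_UNIV:
  fixes S :: "'v::chilbert_space set"
  assumes add: "\<And>x y. x \<in> S \<Longrightarrow> y \<in> S \<Longrightarrow> x + y \<in> S"
    and scale: "\<And>c x. x \<in> S \<Longrightarrow> c *\<^sub>C x \<in> S" and "S \<noteq> {}"
    and annihilator: "\<And>v. (\<And>s. s \<in> S \<Longrightarrow> cinner s v = 0) \<Longrightarrow> v = 0"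
  shows "closure S = UNIV"
proof (intro equalityI subset_UNIV subsetI)
  fix x :: 'v
  have scaleR: "r *\<^sub>R y \<in> S" if "y \<in> S" for r y
    using scale[OF that] by (simp add: scaleR_scaleC)
  define m where "m = (INF s\<in>S. (norm (x - s))\<^sup>2)"
  have m_le: "m \<le> (norm (x - s))\<^sup>2" if "s \<in> S" for s
    unfolding m_def by (rule cINF_lower[OF bdd_belowI2[of _ 0] that]) simp
  have "\<exists>s\<in>S. (norm (x - s))\<^sup>2 < m + 1 / real (Suc n)" for n
  proof -
    have "(INF s\<in>S. (norm (x - s))\<^sup>2) < m + 1 / real (Suc n)" by (simp add: m_def)
    then show ?thesis
      using cInf_lessD[of "(\<lambda>s. (norm (x - s))\<^sup>2) ` S"] \<open>S \<noteq> {}\<close> by blast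
  qed
  then obtain y where y: "\<And>n. y n \<in> S" "\<And>n. (norm (x - y n))\<^sup>2 < m + 1 / real (Suc n)"
    by metis
  have y_diff: "(norm (y i - y j))\<^sup>2 < 2 / real (Suc i) + 2 / real (Suc j)" for i j
  proof -
    have "(norm ((x - y i) + (x - y j)))\<^sup>2 = 4 * (norm (x - (1/2) *\<^sub>R (y i + y j)))\<^sup>2"
    proof -
      have "(x - y i) + (x - y j) = 2 *\<^sub>R (x - (1/2) *\<^sub>R (y i + y j))"
        by (simp add: algebra_simps scaleR_2)
      then show ?thesis by (simp only: norm_scaleR power_mult_distrib) simp
    qed
    moreover have "(norm ((x - y i) - (x - y j)))\<^sup>2 = (norm (y i - y j))\<^sup>2"
      by (simp add: norm_minus_commute)
    moreover have "m \<le> (norm (x - (1/2) *\<^sub>R (y i + y j)))\<^sup>2"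
      by (intro m_le scaleR add y)
    ultimately show ?thesis
      using parallelogram[of "x - y i" "x - y j"] y(2)[of i] y(2)[of j] by simp
  qed
  have "Cauchy y"
  proof (rule CauchyI)
    fix e :: real assume e: "0 < e"
    obtain N where N: "4 / e\<^sup>2 < real N"
      using reals_Archimedean2 by blast
    have small: "2 / real (Suc l) \<le> e\<^sup>2 / 2" if "N \<le> l" for l
    proof -
      have "4 / e\<^sup>2 < real (Suc l)" using N that by linarith
      then show ?thesis using e by (simp add: field_simps)
    qed
    have "norm (y i - y j) < e" if "N \<le> i" "N \<le> j" for i j
    proof (rule power2_less_imp_less)
      show "(norm (y i - y j))\<^sup>2 < e\<^sup>2"
        using y_diff[of i j] small[OF that(1)] small[OF that(2)] by linarith
    qed (use e in simp)
    then show "\<exists>N. \<forall>i\<ge>N. \<forall>j\<ge>N. norm (y i - y j) < e" by blast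
  qed
  then obtain l where l: "y \<longlonglongrightarrow> l"
    using Cauchy_convergent convergent_def by blast
  have lim: "(norm (x - l))\<^sup>2 \<le> m"
  proof (rule LIMSEQ_le)
    show "(\<lambda>n. (norm (x - y n))\<^sup>2) \<longlonglongrightarrow> (norm (x - l))\<^sup>2"
      by (intro tendsto_intros l)
    show "(\<lambda>n. m + 1 / real (Suc n)) \<longlonglongrightarrow> m"
      using tendsto_add[OF tendsto_const LIMSEQ_Suc[OF lim_1_over_n]] by simp
  qed (use y(2) less_imp_le in blast)
  have Re0: "Re (cinner (x - l) s) = 0" if s: "s \<in> S" for s
  proof -
    have q: "0 \<le> t\<^sup>2 * (norm s)\<^sup>2 + 2 * t * Re (cinner (x - l) s)" for t :: real
    proof -
      have "m \<le> (norm ((x - l) + t *\<^sub>R s))\<^sup>2"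
      proof (rule LIMSEQ_le_const)
        have "(\<lambda>n. (norm ((x - y n) + t *\<^sub>R s))\<^sup>2) \<longlonglongrightarrow> (norm ((x - l) + t *\<^sub>R s))\<^sup>2"
          by (intro tendsto_intros l)
        then show "(\<lambda>n. (norm ((x - y n) + t *\<^sub>R s))\<^sup>2) \<longlonglongrightarrow> (norm ((x - l) + t *\<^sub>R s))\<^sup>2" .
        have "m \<le> (norm ((x - y n) + t *\<^sub>R s))\<^sup>2" for n
          using m_le[OF add[OF y(1)[of n] scaleR[OF s, of "- t"]]] by (simp add: algebra_simps)
        then show "\<exists>N. \<forall>n\<ge>N. m \<le> (norm ((x - y n) + t *\<^sub>R s))\<^sup>2" by blast
      qed
      then show ?thesis
        using lim by (simp add: power2_norm_add cinner_scaleR_right power_mult_distrib)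
    qed
    \<comment> \<open>The test value t = -d/M makes the quadratic at most -d^2/M, which forces d =
      0. The summand 1 keeps \<open>M\<close> positive even for s = 0.\<close>
    define M where "M = (norm s)\<^sup>2 + 1"
    define d where "d = Re (cinner (x - l) s)"
    have M: "0 < M" by (simp add: M_def add_nonneg_pos)
    have "0 \<le> (- d / M)\<^sup>2 * (norm s)\<^sup>2 + 2 * (- d / M) * d"
      using q[of "- d / M"] by (simp add: d_def)
    also have "\<dots> \<le> (- d / M)\<^sup>2 * M + 2 * (- d / M) * d"
      by (rule add_right_mono[OF mult_left_mono]) (auto simp: M_def)
    also have "\<dots> = - d\<^sup>2 / M"
      using M by (simp add: power2_eq_square)
    finally have "d = 0"
      using M by (simp add: divide_le_0_iff zero_le_divide_iff)
    then show ?thesis by (simp add: d_def)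
  qed
  have "cinner s (x - l) = 0" if s: "s \<in> S" for s
  proof -
    have "cinner (x - l) s = 0"
    proof (rule complex_eqI)
      show "Im (cinner (x - l) s) = Im 0"
        \<comment> \<open>Multiplying \<open>s\<close> by the imaginary unit turns the real part
          into the imaginary part.\<close>
        using Re0[OF scale[OF s, of \<i>]] by (simp add: cinner_scaleC_right)
    qed (simp add: Re0[OF s])
    then show ?thesis
      by (subst cinner_commute) simp
  qed
  then have "x = l"
    using annihilator by force
  then show "x \<in> closure S"
    using l y(1) closure_sequential by blast
qed

text \<open>Riesz representation moves the question into \<open>V\<close>, where orthogonality can
  be used. Density of the image of \<open>H\<close> is dual to the injectivity of \<iota>.\<close>

lemma embed_dense:
  fixes \<iota> :: "'v::chilbert_space \<Rightarrow> 'h::chilbert_space"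
  assumes G: "gelfand_triple \<iota>" and e: "0 < e"
  obtains h where "norm (embed \<iota> h - y) < e"
proof -
  define S where "S = {u. \<exists>h. \<forall>v. cinner u v = cinner h (\<iota> v)}"
  have Riesz: "\<exists>u. \<forall>v. pairing z v = cinner u v" for z :: "'v antidual"
    using Riesz_antidual[OF bounded_antilinear_pairing] by metis
  have "closure S = UNIV"
  proof (rule closure_subspace_eq_UNIV)
    show "x + y \<in> S" if "x \<in> S" "y \<in> S" for x y
      using that unfolding S_def by (auto simp: cinner_add_left) (metis cinner_add_left)
    show "c *\<^sub>C x \<in> S" if "x \<in> S" for c x
      using that unfolding S_def by (auto simp: cinner_scaleC_left) (metis cinner_scaleC_left)
    show "S \<noteq> {}"
      using Riesz[of "embed \<iota> 0"] by (auto simp: S_def pairing_embed[OF G]) metis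
    fix v assume v: "\<And>s. s \<in> S \<Longrightarrow> cinner s v = 0"
    \<comment> \<open>A vector \<open>v\<close> orthogonal to all of \<open>S\<close> is tested
      against the representative of its own image, which gives |\<iota> v|^2 = 0.\<close>
    obtain u where u: "\<And>w. pairing (embed \<iota> (\<iota> v)) w = cinner u w"
      using Riesz by blast
    then have "u \<in> S"
      unfolding S_def by (intro CollectI exI[of _ "\<iota> v"]) (simp add: pairing_embed[OF G])
    from v[OF this] u[of v] have "cinner (\<iota> v) (\<iota> v) = 0"
      by (simp add: pairing_embed[OF G])
    then have "(norm (\<iota> v))\<^sup>2 = 0"
      unfolding power2_norm_eq_cinner by simp
    then have "\<iota> v = 0"
      by simp
    moreover have "\<iota> 0 = 0"
      using G by (simp add: gelfand_triple_def bounded_clinear_def linear_0 bounded_linear.linear)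
    ultimately show "v = 0"
      using G injD[of \<iota> v 0] by (simp add: gelfand_triple_def)
  qed
  obtain x where x: "\<And>v. pairing y v = cinner x v"
    using Riesz by blast
  have "x \<in> closure S" by (simp add: \<open>closure S = UNIV\<close>)
  then obtain u where u: "u \<in> S" "dist u x < e / 2"
    using e closure_approachable by (metis half_gt_zero)
  then obtain h where h: "\<And>v. cinner u v = cinner h (\<iota> v)"
    by (auto simp: S_def)
  have "norm (embed \<iota> h - y) \<le> norm (u - x)"
  proof (rule norm_antidual_bound)
    fix v
    have "pairing (embed \<iota> h - y) v = cinner (u - x) v"
      using cinner_add_left[of "u - x" x v]
      by (simp add: minus_antidual.rep_eq pairing_embed[OF G] x h[symmetric])
    then show "cmod (pairing (embed \<iota> h - y) v) \<le> norm (u - x) * norm v"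
      by (simp add: cinner_Cauchy_Schwarz)
  qed simp
  then show ?thesis
    using u e by (intro that[of h]) (simp add: dist_norm)
qed

text \<open>Simple functions approximate \<open>g\<close> pointwise, and each of their values is
  replaced by a nearby element of \<open>H\<close>. Dominated convergence then makes the error small
  in L2.\<close>

lemma L2_approximation_by_embed:
  fixes \<iota> :: "'v::{chilbert_space, second_countable_topology} \<Rightarrow> 'h::{chilbert_space, second_countable_topology}"
    and g :: "real \<Rightarrow> 'v antidual"
  assumes G: "gelfand_triple \<iota>" and g: "g \<in> L2 T" and e: "0 < e"
  obtains h where "integrable (lebesgue_on {0<..<T}) h"
    "integrable (lebesgue_on {0<..<T}) (\<lambda>t. (norm (g t - embed \<iota> (h t)))\<^sup>2)"
    "(LINT t|lebesgue_on {0<..<T}. (norm (g t - embed \<iota> (h t)))\<^sup>2) < e"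
proof -
  let ?M = "lebesgue_on {0<..<T}"
  interpret finite_measure ?M
    by (rule finite_measure_lebesgue_on) simp
  have gm: "g \<in> borel_measurable ?M" and g2: "integrable ?M (\<lambda>t. (norm (g t))\<^sup>2)"
    using g by (auto simp: L2_def)
  have embed0: "embed \<iota> 0 = 0"
    by (simp add: pairing_inject[symmetric] fun_eq_iff pairing_embed[OF G] zero_antidual.rep_eq)
      (metis cinner_scaleR_right cinner_commute complex_cnj_zero scaleR_zero_left)
  obtain s where s: "\<And>i. simple_function ?M (s i)" "\<And>x. x \<in> space ?M \<Longrightarrow> (\<lambda>i. s i x) \<longlonglongrightarrow> g x"
    "\<And>i x. x \<in> space ?M \<Longrightarrow> dist (s i x) 0 \<le> 2 * dist (g x) 0"
    using borel_measurable_implies_sequence_metric[OF gm, of 0] by blast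
  \<comment> \<open>The error is taken relative to the norm of y: then y = 0 is hit exactly, and the
    approximants stay dominated by a multiple of |g|.\<close>
  have "\<exists>h. norm (embed \<iota> h - y) \<le> norm y / Suc n" for n :: nat and y :: "'v antidual"
  proof (cases "y = 0")
    case False
    then show ?thesis
      using embed_dense[OF G, of "norm y / Suc n" y] by (metis less_imp_le of_nat_0_less_iff zero_less_Suc zero_less_divide_iff zero_less_norm_iff)
  qed (auto simp: embed0 intro!: exI[of _ 0])
  define P where "P n y = (SOME h. norm (embed \<iota> h - y) \<le> norm y / Suc n)" for n :: nat and y :: "'v antidual"
  have P: "norm (embed \<iota> (P n y) - y) \<le> norm y / Suc n" for n y
    unfolding P_def by (rule someI_ex) fact
  define h where "h n t = P n (s n t)" for n t
  have hs: "simple_function ?M (h n)" for n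
    using simple_function_compose1[OF s(1)[of n], of "P n"] by (simp add: h_def[abs_def] comp_def)
  have es: "simple_function ?M (\<lambda>t. embed \<iota> (h n t))" for n
    using simple_function_compose1[OF hs[of n], of "embed \<iota>"] by (simp add: comp_def)
  have diff: "norm (g t - embed \<iota> (h n t)) \<le> norm (s n t) / Suc n + norm (s n t - g t)" for n t
  proof -
    have "norm (g t - embed \<iota> (h n t)) \<le> norm (embed \<iota> (h n t) - s n t) + norm (s n t - g t)"
      using norm_triangle_ineq[of "embed \<iota> (h n t) - s n t" "s n t - g t"] by (simp add: norm_minus_commute)
    then show ?thesis
      using P[of n "s n t"] by (simp add: h_def)
  qed
  have meas: "(\<lambda>t. (norm (g t - embed \<iota> (h n t)))\<^sup>2) \<in> borel_measurable ?M" for n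
    using gm borel_measurable_simple_function[OF es[of n]] by measurable
  have bound: "(norm (g t - embed \<iota> (h n t)))\<^sup>2 \<le> 25 * (norm (g t))\<^sup>2" if "t \<in> space ?M" for n t
  proof -
    have st: "norm (s n t) \<le> 2 * norm (g t)" using s(3)[OF that, of n] by simp
    have "norm (s n t) / Suc n \<le> norm (s n t)"
      by (simp add: divide_le_eq mult_le_cancel_left1)
    moreover have "norm (s n t - g t) \<le> norm (s n t) + norm (g t)"
      by (rule norm_triangle_ineq4)
    \<comment> \<open>The 5 is 2 + (2 + 1): the simple functions satisfy |s| <= 2 |g|, and their
      distance to \<open>g\<close> is at most 3 |g|.\<close>
    ultimately have "norm (g t - embed \<iota> (h n t)) \<le> 5 * norm (g t)"
      using diff[of t n] st by linarith
    then have "(norm (g t - embed \<iota> (h n t)))\<^sup>2 \<le> (5 * norm (g t))\<^sup>2"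
      by (intro power_mono) auto
    then show ?thesis by (simp add: power_mult_distrib)
  qed
  have int: "integrable ?M (\<lambda>t. (norm (g t - embed \<iota> (h n t)))\<^sup>2)" for n
    by (rule Bochner_Integration.integrable_bound[OF integrable_mult_right[OF g2, of 25] meas])
      (use bound in \<open>auto intro!: AE_I2\<close>)
  have "(\<lambda>n. LINT t|?M. (norm (g t - embed \<iota> (h n t)))\<^sup>2) \<longlonglongrightarrow> (LINT t|?M. 0)"
  proof (rule integral_dominated_convergence[where w="\<lambda>t. 25 * (norm (g t))\<^sup>2"])
    show "AE t in ?M. (\<lambda>n. (norm (g t - embed \<iota> (h n t)))\<^sup>2) \<longlonglongrightarrow> 0"
    proof (rule AE_I2)
      fix t assume t: "t \<in> space ?M"
      have "(\<lambda>n. norm (s n t) * (1 / Suc n) + norm (s n t - g t)) \<longlonglongrightarrow> norm (g t) * 0 + norm (g t - g t)"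
        by (intro tendsto_intros s(2)[OF t] LIMSEQ_Suc lim_1_over_n)
      then have "(\<lambda>n. norm (s n t) / Suc n + norm (s n t - g t)) \<longlonglongrightarrow> 0"
        by simp
      then have "(\<lambda>n. norm (g t - embed \<iota> (h n t))) \<longlonglongrightarrow> 0"
        by (rule Lim_null_comparison[rotated]) (use diff in \<open>auto intro!: always_eventually\<close>)
      then show "(\<lambda>n. (norm (g t - embed \<iota> (h n t)))\<^sup>2) \<longlonglongrightarrow> 0"
        using tendsto_power[of _ 0 _ 2] by fastforce
    qed
  qed (use meas g2 bound in \<open>auto intro!: AE_I2\<close>)
  then have "\<forall>\<^sub>F n in sequentially. (LINT t|?M. (norm (g t - embed \<iota> (h n t)))\<^sup>2) < e"
    using e by (intro order_tendstoD) simp_all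
  then obtain n where n: "(LINT t|?M. (norm (g t - embed \<iota> (h n t)))\<^sup>2) < e"
    using eventually_happens'[OF sequentially_bot] by blast
  have "integrable ?M (h n)"
  proof -
    have "finite (h n ` space ?M)"
      using hs by (simp add: simple_function_def)
    then have "bounded (h n ` space ?M)"
      by (rule finite_imp_bounded)
    then obtain B where "\<forall>y\<in>h n ` space ?M. norm y \<le> B"
      unfolding bounded_iff by blast
    then show ?thesis
      by (intro integrable_const_bound[of _ B] AE_I2) (use borel_measurable_simple_function[OF hs] in auto)
  qed
  then show ?thesis
    using that int n by blast
qed

section \<open>The energy identity\<close>

text \<open>Integrating the sum over all offsets r in [0, \<delta>] reassembles the integral of
  \<open>R\<close> over [s, t]. Hence a set of offsets of positive measure has a sum not above the
  average, and such an offset can avoid any null set. A fixed partition would give no such bound, as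
  \<open>R\<close> is merely integrable.\<close>

lemma average_partition_offset:
  fixes R :: "real \<Rightarrow> real"
  assumes R: "R absolutely_integrable_on {s..t}" and Z: "negligible Z" and "s < t" "0 < N"
  defines "\<delta> \<equiv> (t - s) / real N"
  obtains r where "0 < r" "r < \<delta>" "\<And>i. i < N \<Longrightarrow> s + real i * \<delta> + r \<notin> Z"
    "\<delta> * (\<Sum>i<N. R (s + real i * \<delta> + r)) \<le> integral {s..t} R"
proof -
  have \<delta>: "0 < \<delta>" "real N * \<delta> = t - s"
    using assms by (auto simp: \<delta>_def)
  define a where "a i = s + real i * \<delta>" for i :: nat
  have a: "a 0 = s" "a N = t" "a i \<le> a (Suc i)" "a (Suc i) - a i = \<delta>" "s \<le> a i" for i
    using \<delta> by (auto simp: a_def algebra_simps)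
  have aN: "a i \<le> t" if "i \<le> N" for i
  proof -
    have "real i * \<delta> \<le> real N * \<delta>" using that \<delta>(1) by (intro mult_right_mono) auto
    then show ?thesis unfolding \<delta>(2) a_def by simp
  qed
  have RI: "R integrable_on {s..t}" "(\<lambda>x. norm (R x)) integrable_on {s..t}"
    using R by (auto simp: absolutely_integrable_on_def)
  have shift: "((\<lambda>r. f (a i + r)) has_integral integral {a i..a (Suc i)} f) {0..\<delta>}"
    if f: "f integrable_on {s..t}" and i: "i < N" for f :: "real \<Rightarrow> real" and i
  proof -
    have "f integrable_on {a i..a (Suc i)}"
      by (rule integrable_on_subinterval[OF f]) (use a aN[of "Suc i"] i in auto)
    then have "(f has_integral integral {a i..a (Suc i)} f) (cbox (a i) (a (Suc i)))"
      by (simp add: integrable_integral)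
    from has_integral_affinity'[OF this, of 1 "a i"] show ?thesis
      using a(4)[of i] by (simp add: add.commute)
  qed
  have sum_eq: "(\<Sum>i<n. integral {a i..a (Suc i)} R) = integral {s..a n} R" if "n \<le> N" for n
    using that
  proof (induction n)
    case (Suc n)
    have "R integrable_on {s..a (Suc n)}"
      by (rule integrable_on_subinterval[OF RI(1)]) (use a aN[of "Suc n"] Suc.prems in auto)
    then have "integral {s..a n} R + integral {a n..a (Suc n)} R = integral {s..a (Suc n)} R"
      by (intro Henstock_Kurzweil_Integration.integral_combine a)
    then show ?case
      using Suc by simp
  qed (simp add: a)
  define F where "F r = (\<Sum>i<N. R (a i + r))" for r
  have "(F has_integral (\<Sum>i<N. integral {a i..a (Suc i)} R)) {0..\<delta>}"
    unfolding F_def by (intro has_integral_sum shift RI) auto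
  then have F: "(F has_integral integral {s..t} R) {0..\<delta>}"
    using sum_eq[of N] a(2) by simp
  have "F absolutely_integrable_on {0..\<delta>}"
    unfolding F_def
  proof (intro absolutely_integrable_sum)
    fix i assume "i \<in> {..<N}"
    then show "(\<lambda>r. R (a i + r)) absolutely_integrable_on {0..\<delta>}"
      using shift[OF RI(1), of i] shift[OF RI(2), of i]
      by (intro absolutely_integrable_onI) (auto simp: integrable_on_def)
  qed simp
  then have FL: "integrable (lebesgue_on {0..\<delta>}) F"
    by (rule absolutely_integrable_imp_integrable) simp
  have FI: "(LINT r|lebesgue_on {0..\<delta>}. F r) = integral {s..t} R"
    using F by (simp add: lebesgue_integral_eq_integral[OF FL] integral_unique)
  \<comment> \<open>All offsets to be avoided: the two endpoints, and those that put some partition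
    point into \<open>Z\<close>.\<close>
  define Z' where "Z' = {0, \<delta>} \<union> (\<Union>i<N. (+) (- a i) ` Z)"
  have "negligible Z'"
    unfolding Z'_def using negligible_translation[OF Z]
    by (intro negligible_Un negligible_Union) (auto simp only: finite_imageI finite_lessThan negligible_finite finite.intros)
  interpret finite_measure "lebesgue_on {0..\<delta>}"
    by (rule finite_measure_lebesgue_on) simp
  have "\<exists>r\<in>{0..\<delta>} - Z'. F r \<le> integral {s..t} R / \<delta>"
  proof (rule ccontr)
    assume "\<not> ?thesis"
    then have gt: "\<And>r. r \<in> {0..\<delta>} - Z' \<Longrightarrow> integral {s..t} R / \<delta> < F r"
      by force
    have "AE r in lebesgue. r \<notin> Z'"
      using \<open>negligible Z'\<close> by (intro AE_not_in) (simp add: negligible_iff_null_sets)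
    then have "AE r in lebesgue_on {0..\<delta>}. r \<notin> Z'"
      by (subst AE_restrict_space_iff) auto
    then have "AE r in lebesgue_on {0..\<delta>}. integral {s..t} R / \<delta> < F r"
      using AE_space by eventually_elim (use gt in auto)
    moreover have "emeasure (lebesgue_on {0..\<delta>}) (space (lebesgue_on {0..\<delta>})) \<noteq> 0"
      using \<delta> by (simp add: emeasure_restrict_space)
    \<comment> \<open>If \<open>F\<close> exceeded its mean almost everywhere on an interval of
      positive length, its integral would exceed itself.\<close>
    ultimately have "(LINT r|lebesgue_on {0..\<delta>}. integral {s..t} R / \<delta>) < (LINT r|lebesgue_on {0..\<delta>}. F r)"
      by (intro integral_less_AE_space FL integrable_const)
    moreover have "(LINT r|lebesgue_on {0..\<delta>}. integral {s..t} R / \<delta>) = integral {s..t} R"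
      using \<delta> by (simp add: measure_restrict_space)
    ultimately show False
      using FI by simp
  qed
  then obtain r where r: "r \<in> {0..\<delta>}" "r \<notin> Z'" "F r \<le> integral {s..t} R / \<delta>"
    by blast
  show ?thesis
  proof (rule that[of r])
    show "0 < r" "r < \<delta>"
      using r by (auto simp: Z'_def less_le)
    show "s + real i * \<delta> + r \<notin> Z" if "i < N" for i
    proof
      assume "s + real i * \<delta> + r \<in> Z"
      then have "r \<in> (+) (- a i) ` Z"
        by (intro image_eqI[of _ _ "a i + r"]) (auto simp: a_def)
      then show False
        using r(2) that by (auto simp: Z'_def)
    qed
    show "\<delta> * (\<Sum>i<N. R (s + real i * \<delta> + r)) \<le> integral {s..t} R"
      using r(3) \<delta> by (simp add: F_def a_def field_simps)
  qed
qed

section \<open>Comparison of integrals up to null sets, and a form of Young's inequality\<close>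

lemma AE_lebesgue_on_imp_negligible:
  assumes "AE x in lebesgue_on {0<..<T::real}. P x"
  shows "negligible {x \<in> {0<..<T}. \<not> P x}"
proof -
  have "AE x in lebesgue. x \<in> {0<..<T} \<longrightarrow> P x"
    using assms by (subst (asm) AE_restrict_space_iff) auto
  then obtain N where N: "N \<in> null_sets lebesgue" "{x \<in> space lebesgue. \<not> (x \<in> {0<..<T} \<longrightarrow> P x)} \<subseteq> N"
    unfolding eventually_ae_filter by blast
  have "negligible N"
    unfolding negligible_iff_null_sets by (rule N(1))
  then show ?thesis
    by (rule negligible_subset) (use N(2) in auto)
qed

lemma integral_le_negligible:
  fixes f g :: "real \<Rightarrow> real"
  assumes f: "f integrable_on S" and g: "g integrable_on S" and Z: "negligible Z"
    and le: "\<And>x. x \<in> S - Z \<Longrightarrow> f x \<le> g x"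
  shows "integral S f \<le> integral S g"
proof -
  define f' where "f' x = (if x \<in> Z then g x else f x)" for x
  have "f' integrable_on S"
    by (rule integrable_spike[OF f Z]) (auto simp: f'_def)
  then have "integral S f' \<le> integral S g"
    by (rule integral_le[OF _ g]) (use le in \<open>auto simp: f'_def\<close>)
  moreover have "integral S f' = integral S f"
    by (rule integral_spike[OF Z]) (auto simp: f'_def)
  ultimately show ?thesis by simp
qed

lemma integral_abs_bound_negligible:
  fixes f g :: "real \<Rightarrow> real"
  assumes f: "f integrable_on S" and g: "g integrable_on S" and Z: "negligible Z"
    and le: "\<And>x. x \<in> S - Z \<Longrightarrow> \<bar>f x\<bar> \<le> g x"
  shows "\<bar>integral S f\<bar> \<le> integral S g"
proof (rule abs_leI)
  show "integral S f \<le> integral S g"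
    by (rule integral_le_negligible[OF f g Z]) (use le in fastforce)
  have "integral S (\<lambda>x. - f x) \<le> integral S g"
    by (rule integral_le_negligible[OF Henstock_Kurzweil_Integration.integrable_neg[OF f] g Z]) (use le in fastforce)
  then show "- integral S f \<le> integral S g"
    by simp
qed

text \<open>Young's inequality a z <= a^2/(2\<eta>) + \<eta> z^2/2 is used with weights 1, 1, 2; the
  total weight 4 turns 1/(2\<eta>) into 2/\<eta>.\<close>

lemma young_three_terms:
  fixes a b c d \<eta> :: real
  assumes "0 < \<eta>"
  shows "a * (b + c + 2 * d) \<le> 2 / \<eta> * a\<^sup>2 + \<eta> / 2 * (b\<^sup>2 + c\<^sup>2 + 2 * d\<^sup>2)"
proof -
  have y: "a * z \<le> a\<^sup>2 / (2 * \<eta>) + \<eta> / 2 * z\<^sup>2" for z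
  proof -
    have "0 \<le> (a - \<eta> * z)\<^sup>2 / (2 * \<eta>)"
      using assms by simp
    also have "\<dots> = a\<^sup>2 / (2 * \<eta>) + \<eta> / 2 * z\<^sup>2 - a * z"
      using assms by (simp add: power2_eq_square field_simps)
    finally show ?thesis by simp
  qed
  have "a * (b + c + 2 * d) = a * b + a * c + 2 * (a * d)"
    by (simp add: algebra_simps)
  also have "\<dots> \<le> (a\<^sup>2 / (2 * \<eta>) + \<eta> / 2 * b\<^sup>2) + (a\<^sup>2 / (2 * \<eta>) + \<eta> / 2 * c\<^sup>2) + 2 * (a\<^sup>2 / (2 * \<eta>) + \<eta> / 2 * d\<^sup>2)"
    by (intro add_mono mult_left_mono y) simp
  also have "\<dots> = 2 / \<eta> * a\<^sup>2 + \<eta> / 2 * (b\<^sup>2 + c\<^sup>2 + 2 * d\<^sup>2)"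
    using assms by (simp add: field_simps)
  finally show ?thesis .
qed

lemma energy_identity:
  fixes \<iota> :: "'v::{chilbert_space, second_countable_topology} \<Rightarrow> 'h::{chilbert_space, second_countable_topology}"
  assumes G: "gelfand_triple \<iota>" and u: "continuous_on {0..T} u"
    and g: "g \<in> L2 T" and y: "y \<in> L2 T" and AEy: "AE \<tau> in lebesgue_on {0<..<T}. \<iota> (y \<tau>) = u \<tau>"
    and increment: "\<And>s t v. 0 < s \<Longrightarrow> s \<le> t \<Longrightarrow> t < T \<Longrightarrow>
      cinner (u t - u s) (\<iota> v) = integral {s..t} (\<lambda>\<tau>. pairing (g \<tau>) v)"
    and st: "0 \<le> s" "s \<le> t" "t \<le> T"
  shows "(norm (u t))\<^sup>2 - (norm (u s))\<^sup>2 = 2 * integral {s..t} (\<lambda>\<tau>. Re (pairing (g \<tau>) (y \<tau>)))"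
proof (cases "s = t")
  case False
  then have "s < t" using st by simp
  interpret \<iota>: bounded_linear \<iota>
    using G by (simp add: gelfand_triple_def bounded_clinear_def)
  interpret P: bounded_bilinear "pairing :: 'v antidual \<Rightarrow> 'v \<Rightarrow> complex"
    by (rule bounded_bilinear_pairing)
  let ?M = "lebesgue_on {0<..<T}"
  define Z where "Z = {\<tau> \<in> {0<..<T}. \<iota> (y \<tau>) \<noteq> u \<tau>}"
  have Z: "negligible Z"
    unfolding Z_def by (rule AE_lebesgue_on_imp_negligible[OF AEy])
  define \<beta> where "\<beta> \<tau> = Re (pairing (g \<tau>) (y \<tau>))" for \<tau>
  define R where "R \<tau> = (norm (y \<tau>))\<^sup>2" for \<tau>
  have \<beta>: "integrable ?M \<beta>"
    unfolding \<beta>_def by (intro integrable_Re integrable_pairing_L2 g y)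
  have RM: "integrable ?M R"
    using y by (simp add: L2_def R_def[abs_def])
  note HK = absolutely_integrable_on_Icc[THEN absolutely_integrable_on_def[THEN iffD1, THEN conjunct1]]
  \<comment> \<open>\<open>E\<close> is the defect in the identity; the goal is that it takes equal
    values at \<open>s\<close> and \<open>t\<close>. Its continuity disposes of the short end pieces
    that the shifted partition leaves uncovered.\<close>
  define E where "E x = (norm (u x))\<^sup>2 - 2 * integral {0..x} \<beta>" for x
  have T: "0 \<le> T" using st by linarith
  have \<beta>cont: "continuous_on {0..T} (\<lambda>x. integral {0..x} \<beta>)"
    by (rule indefinite_integral_continuous_1) (rule HK[OF \<beta>], simp_all)
  have Econt: "continuous_on {0..T} E"
    unfolding E_def by (intro continuous_intros u \<beta>cont)
  have Ediff: "E q - E p = (norm (u q))\<^sup>2 - (norm (u p))\<^sup>2 - 2 * integral {p..q} \<beta>"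
    if "0 \<le> p" "p \<le> q" "q \<le> T" for p q
  proof -
    have "integral {0..p} \<beta> + integral {p..q} \<beta> = integral {0..q} \<beta>"
      by (intro Henstock_Kurzweil_Integration.integral_combine HK[OF \<beta>]) (use that in auto)
    then show ?thesis by (simp add: E_def)
  qed
  \<comment> \<open>The bound on a single cell. Its last term involves point values of
    \<open>R\<close>, which only the averaged choice of the partition will control.\<close>
  have local: "\<bar>E q - E p\<bar> \<le> integral {p..q} (\<lambda>\<tau>. 2 * \<omega> * norm (h \<tau>) + 2 / \<eta> * (norm (g \<tau> - embed \<iota> (h \<tau>)))\<^sup>2 + \<eta> * R \<tau>)
      + \<eta> / 2 * (q - p) * (R p + R q)"
    if p: "0 < p" "p \<notin> Z" and q: "p \<le> q" "q < T" "q \<notin> Z" and \<omega>: "0 \<le> \<omega>" and \<eta>: "0 < \<eta>"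
      and osc: "\<And>\<tau>. \<tau> \<in> {p..q} \<Longrightarrow> norm (u p - u \<tau>) \<le> \<omega>" "\<And>\<tau>. \<tau> \<in> {p..q} \<Longrightarrow> norm (u q - u \<tau>) \<le> \<omega>"
      and h: "integrable ?M h" "integrable ?M (\<lambda>t. (norm (g t - embed \<iota> (h t)))\<^sup>2)"
    for p q \<omega> \<eta> :: real and h
  proof -
    have yp: "\<iota> (y p) = u p" and yq: "\<iota> (y q) = u q"
      using p q by (auto simp: Z_def)
    have pq: "0 \<le> p" "q \<le> T" using p q by auto
    define \<Psi> where "\<Psi> \<tau> = 2 * \<omega> * norm (h \<tau>) + 2 / \<eta> * (norm (g \<tau> - embed \<iota> (h \<tau>)))\<^sup>2 + \<eta> * R \<tau>" for \<tau>
    have \<Psi>: "\<Psi> integrable_on {p..q}"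
      unfolding \<Psi>_def by (rule HK[OF _ pq]) (use h RM in simp)
    have gv: "(\<lambda>\<tau>. pairing (g \<tau>) v) integrable_on {p..q}" for v
      by (rule HK[OF integrable_pairing_const[OF g] pq])
    then have gvRe: "(\<lambda>\<tau>. Re (pairing (g \<tau>) v)) integrable_on {p..q}" for v
      using integrable_linear[OF gv bounded_linear_Re] by (simp add: comp_def)
    \<comment> \<open>The mixed terms cancel in the real part. The symmetric factor u(p) + u(q) lies
      in the image of \<open>V\<close> because \<open>p\<close> and \<open>q\<close> avoid
      \<open>Z\<close>, so the increment formula applies to it.\<close>
    have "(norm (u q))\<^sup>2 - (norm (u p))\<^sup>2 = Re (cinner (u q - u p) (u p + u q))"
    proof -
      have "cinner (u q - u p) z = cinner (u q) z - cinner (u p) z" for z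
        using cinner_add_left[of "u q - u p" "u p" z] by simp
      moreover have "Re (cinner (u q) (u p)) = Re (cinner (u p) (u q))"
        by (subst cinner_commute) simp
      ultimately show ?thesis
        by (simp add: power2_norm_eq_cinner cinner_add_right)
    qed
    also have "\<dots> = Re (integral {p..q} (\<lambda>\<tau>. pairing (g \<tau>) (y p + y q)))"
      using increment[of p q "y p + y q"] p q by (simp add: \<iota>.add yp yq)
    also have "\<dots> = integral {p..q} (\<lambda>\<tau>. Re (pairing (g \<tau>) (y p + y q)))"
      using integral_linear[OF gv bounded_linear_Re] by (simp add: comp_def)
    finally have "E q - E p = integral {p..q} (\<lambda>\<tau>. Re (pairing (g \<tau>) (y p + y q))) - integral {p..q} (\<lambda>\<tau>. 2 * \<beta> \<tau>)"
      using Ediff[of p q] p q by simp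
    also have "\<dots> = integral {p..q} (\<lambda>\<tau>. Re (pairing (g \<tau>) (y p + y q)) - 2 * \<beta> \<tau>)"
      by (intro Henstock_Kurzweil_Integration.integral_diff[symmetric] gvRe integrable_on_mult_right HK[OF \<beta> pq])
    finally have eq: "E q - E p = integral {p..q} (\<lambda>\<tau>. Re (pairing (g \<tau>) (y p + y q)) - 2 * \<beta> \<tau>)" .
    have "\<bar>integral {p..q} (\<lambda>\<tau>. Re (pairing (g \<tau>) (y p + y q)) - 2 * \<beta> \<tau>)\<bar>
        \<le> integral {p..q} (\<lambda>\<tau>. \<Psi> \<tau> + \<eta> / 2 * (R p + R q))"
    proof (rule integral_abs_bound_negligible[OF _ _ Z])
      show "(\<lambda>\<tau>. Re (pairing (g \<tau>) (y p + y q)) - 2 * \<beta> \<tau>) integrable_on {p..q}"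
        by (intro Henstock_Kurzweil_Integration.integrable_diff gvRe integrable_on_mult_right HK[OF \<beta> pq])
      show "(\<lambda>\<tau>. \<Psi> \<tau> + \<eta> / 2 * (R p + R q)) integrable_on {p..q}"
        by (intro Henstock_Kurzweil_Integration.integrable_add \<Psi> integrable_const_ivl)
      fix \<tau> assume \<tau>: "\<tau> \<in> {p..q} - Z"
      then have y\<tau>: "\<iota> (y \<tau>) = u \<tau>" using p q by (auto simp: Z_def)
      define d where "d = y p + y q - 2 *\<^sub>R y \<tau>"
      have "Re (pairing (g \<tau>) (y p + y q)) - 2 * \<beta> \<tau> = Re (pairing (g \<tau>) d)"
        by (simp add: d_def \<beta>_def P.diff_right P.scaleR_right)
      \<comment> \<open>The part of \<open>g\<close> close to 0 in the antidual is paired with the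
        \<open>V\<close>-norms of \<open>y\<close>; the \<open>H\<close>-valued part sees
        \<open>d\<close> only in \<open>H\<close>, where it is small by the oscillation bound for
        \<open>u\<close>.\<close>
      also have "\<dots> = Re (pairing (g \<tau> - embed \<iota> (h \<tau>)) d) + Re (cinner (h \<tau>) (\<iota> d))"
        by (simp add: P.diff_left pairing_embed[OF G])
      also have "\<bar>\<dots>\<bar> \<le> cmod (pairing (g \<tau> - embed \<iota> (h \<tau>)) d) + cmod (cinner (h \<tau>) (\<iota> d))"
        by (rule order_trans[OF abs_triangle_ineq add_mono[OF abs_Re_le_cmod abs_Re_le_cmod]])
      also have "\<dots> \<le> norm (g \<tau> - embed \<iota> (h \<tau>)) * (norm (y p) + norm (y q) + 2 * norm (y \<tau>)) + norm (h \<tau>) * (2 * \<omega>)"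
      proof (rule add_mono)
        have "norm d \<le> norm (y p + y q) + norm (2 *\<^sub>R y \<tau>)"
          unfolding d_def by (rule norm_triangle_ineq4)
        then have "norm d \<le> norm (y p) + norm (y q) + 2 * norm (y \<tau>)"
          using norm_triangle_ineq[of "y p" "y q"] by simp
        then show "cmod (pairing (g \<tau> - embed \<iota> (h \<tau>)) d)
            \<le> norm (g \<tau> - embed \<iota> (h \<tau>)) * (norm (y p) + norm (y q) + 2 * norm (y \<tau>))"
          by (rule order_trans[OF norm_pairing mult_left_mono]) simp
        have "\<iota> d = (u p - u \<tau>) + (u q - u \<tau>)"
          by (simp add: d_def \<iota>.diff \<iota>.add \<iota>.scaleR yp yq y\<tau> scaleR_2)
        then have "norm (\<iota> d) \<le> 2 * \<omega>"
          using norm_triangle_ineq[of "u p - u \<tau>" "u q - u \<tau>"] osc[of \<tau>] \<tau> by simp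
        then show "cmod (cinner (h \<tau>) (\<iota> d)) \<le> norm (h \<tau>) * (2 * \<omega>)"
          by (rule order_trans[OF cinner_Cauchy_Schwarz mult_left_mono]) simp
      qed
      also have "\<dots> \<le> \<Psi> \<tau> + \<eta> / 2 * (R p + R q)"
        using young_three_terms[OF \<eta>, of "norm (g \<tau> - embed \<iota> (h \<tau>))" "norm (y p)" "norm (y q)" "norm (y \<tau>)"]
        by (simp add: \<Psi>_def R_def algebra_simps)
      finally show "\<bar>Re (pairing (g \<tau>) (y p + y q)) - 2 * \<beta> \<tau>\<bar> \<le> \<Psi> \<tau> + \<eta> / 2 * (R p + R q)" .
    qed
    also have "\<dots> = integral {p..q} \<Psi> + \<eta> / 2 * (q - p) * (R p + R q)"
      using q by (subst Henstock_Kurzweil_Integration.integral_add[OF \<Psi>]) auto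
    finally show ?thesis
      unfolding eq \<Psi>_def[abs_def] .
  qed
  have "\<bar>E t - E s\<bar> \<le> 5 * e" if e: "0 < e" for e
  proof -
    define I where "I = integral {0..T} R"
    have I: "0 \<le> I"
      unfolding I_def by (rule Henstock_Kurzweil_Integration.integral_nonneg[OF HK[OF RM]]) (auto simp: R_def)
    \<comment> \<open>The parameters are fixed in turn: \<eta> from the integral of |y|^2, then
      \<open>h\<close> with an error adapted to \<eta>, then \<omega> from the norm of
      \<open>h\<close>, and finally the mesh from \<omega>. The summand 1 guards against a vanishing
      denominator.\<close>
    define \<eta> where "\<eta> = e / (2 * I + 1)"
    have \<eta>: "0 < \<eta>" "2 * \<eta> * I \<le> e"
      using e I by (auto simp: \<eta>_def field_simps)
    have "0 < e * \<eta> / 2" using e \<eta> by simp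
    then obtain h where h: "integrable ?M h" "integrable ?M (\<lambda>t. (norm (g t - embed \<iota> (h t)))\<^sup>2)"
      "(LINT t|?M. (norm (g t - embed \<iota> (h t)))\<^sup>2) < e * \<eta> / 2"
      using L2_approximation_by_embed[OF G g] by blast
    define D where "D t = (norm (g t - embed \<iota> (h t)))\<^sup>2" for t
    define B where "B = integral {0..T} (\<lambda>t. norm (h t))"
    have DM: "integrable ?M D" using h(2) by (simp add: D_def[abs_def])
    have hM: "integrable ?M (\<lambda>t. norm (h t))" using h(1) by simp
    have D: "2 / \<eta> * integral {0..T} D \<le> e"
    proof -
      have "integral {0..T} D < e * \<eta> / 2"
        using h(3) LINT_eq_integral_Icc[OF DM, of 0 T] by (simp add: D_def[abs_def])
      then show ?thesis using \<eta>(1) by (simp add: field_simps)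
    qed
    have B: "0 \<le> B"
      unfolding B_def by (rule Henstock_Kurzweil_Integration.integral_nonneg[OF HK[OF hM]]) auto
    define \<omega> where "\<omega> = e / (2 * B + 1)"
    have \<omega>: "0 < \<omega>" "2 * \<omega> * B \<le> e"
      using e B by (auto simp: \<omega>_def field_simps)
    define \<Psi> where "\<Psi> \<tau> = 2 * \<omega> * norm (h \<tau>) + 2 / \<eta> * D \<tau> + \<eta> * R \<tau>" for \<tau>
    have \<Psi>M: "integrable ?M \<Psi>"
      unfolding \<Psi>_def using hM DM RM by simp
    have \<Psi>0: "0 \<le> \<Psi> \<tau>" for \<tau>
      using \<omega> \<eta> by (simp add: \<Psi>_def D_def R_def)
    have \<Psi>I: "integral {0..T} \<Psi> = 2 * \<omega> * B + 2 / \<eta> * integral {0..T} D + \<eta> * I"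
    proof -
      have "(\<lambda>t. norm (h t)) integrable_on {0..T}" "D integrable_on {0..T}" "R integrable_on {0..T}"
        by (rule HK[OF hM] HK[OF DM] HK[OF RM]; simp)+
      from this[THEN integrable_integral] show ?thesis
        unfolding \<Psi>_def[abs_def] I_def B_def
        by (intro integral_unique has_integral_add has_integral_mult_right)
    qed
    have uc: "uniformly_continuous_on {0..T} u" "uniformly_continuous_on {0..T} E"
      by (intro compact_uniformly_continuous u Econt compact_Icc)+
    obtain d1 where d1: "0 < d1" "\<And>x x'. x \<in> {0..T} \<Longrightarrow> x' \<in> {0..T} \<Longrightarrow> dist x' x < d1 \<Longrightarrow> dist (u x') (u x) < \<omega>"
      using uc(1)[unfolded uniformly_continuous_on_def, rule_format, OF \<omega>(1)] by blast
    obtain d2 where d2: "0 < d2" "\<And>x x'. x \<in> {0..T} \<Longrightarrow> x' \<in> {0..T} \<Longrightarrow> dist x' x < d2 \<Longrightarrow> dist (E x') (E x) < e"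
      using uc(2)[unfolded uniformly_continuous_on_def, rule_format, OF e] by blast
    define d where "d = min d1 d2"
    have d: "0 < d" using d1 d2 by (simp add: d_def)
    obtain N0 where N0: "(t - s) / d < real N0" using reals_Archimedean2 by blast
    \<comment> \<open>The \<open>N\<close> offset points are a_0, ..., a_N0 and bound only
      \<open>N0\<close> cells; the pieces [s, a_0] and [a_N0, t] at the ends are shorter than
      \<open>d\<close>.\<close>
    define N where "N = Suc N0"
    define \<delta> where "\<delta> = (t - s) / real N"
    have N: "0 < N" by (simp add: N_def)
    have \<delta>: "0 < \<delta>" "\<delta> < d" "real N * \<delta> = t - s"
    proof -
      have "(t - s) / d < real N" using N0 by (simp add: N_def)
      then show "\<delta> < d" using d N by (simp add: \<delta>_def field_simps)
    qed (use \<open>s < t\<close> N in \<open>auto simp: \<delta>_def\<close>)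
    obtain r where r: "0 < r" "r < \<delta>" "\<And>i. i < N \<Longrightarrow> s + real i * \<delta> + r \<notin> Z"
      "\<delta> * (\<Sum>i<N. R (s + real i * \<delta> + r)) \<le> integral {s..t} R"
      by (rule average_partition_offset[OF absolutely_integrable_on_Icc[OF RM st(1,3)] Z \<open>s < t\<close> N, folded \<delta>_def]) blast
    define a where "a i = s + real i * \<delta> + r" for i
    have aS: "a (Suc i) - a i = \<delta>" for i
      by (simp add: a_def algebra_simps)
    have a_mono: "a i \<le> a j" if "i \<le> j" for i j
      using that \<delta>(1) by (simp add: a_def)
    have a0: "0 < a 0" "s < a 0" "a 0 - s < d"
      using r st \<delta> by (auto simp: a_def)
    have aN: "a N0 < t" "t - a N0 < d"
      using r \<delta> by (auto simp: a_def N_def algebra_simps)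
    have a_range: "0 < a i" "a i < T" "a i \<notin> Z" if "i \<le> N0" for i
      using a_mono[of 0 i] a_mono[of i N0] that a0 aN st r(3)[of i] by (auto simp: N_def a_def)
    have chain: "\<bar>E (a n) - E (a 0)\<bar> \<le> integral {a 0..a n} \<Psi> + \<eta> / 2 * \<delta> * (\<Sum>i<n. R (a i) + R (a (Suc i)))"
      if "n \<le> N0" for n
      using that
    proof (induction n)
      case (Suc n)
      have n: "n \<le> N0" "Suc n \<le> N0" using Suc.prems by auto
      have osc: "norm (u x - u \<tau>) \<le> \<omega>" if "\<tau> \<in> {a n..a (Suc n)}" "x \<in> {a n..a (Suc n)}" for x \<tau>
      proof -
        have "\<tau> \<in> {0..T}" "x \<in> {0..T}"
          using that a_range[OF n(1)] a_range[OF n(2)] by auto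
        moreover have "dist x \<tau> < d1"
          using that aS[of n] \<delta> by (auto simp: dist_real_def d_def)
        ultimately show ?thesis
          using d1(2)[of \<tau> x] by (simp add: dist_norm)
      qed
      have "\<bar>E (a (Suc n)) - E (a n)\<bar> \<le> integral {a n..a (Suc n)} \<Psi> + \<eta> / 2 * (a (Suc n) - a n) * (R (a n) + R (a (Suc n)))"
        unfolding \<Psi>_def D_def
        using a_range[OF n(1)] a_range[OF n(2)] a_mono[of n "Suc n"] \<omega> \<eta> osc h
        by (intro local) auto
      moreover have "integral {a 0..a n} \<Psi> + integral {a n..a (Suc n)} \<Psi> = integral {a 0..a (Suc n)} \<Psi>"
        using a_mono[of 0 n] a_mono[of n "Suc n"] a_range[OF n(2)] a0
        by (intro Henstock_Kurzweil_Integration.integral_combine HK[OF \<Psi>M]) auto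
      ultimately show ?case
        using Suc.IH[OF n(1)] unfolding aS by (simp add: algebra_simps)
    qed simp
    \<comment> \<open>Each partition point belongs to at most two cells.\<close>
    have "(\<Sum>i<N0. R (a i) + R (a (Suc i))) \<le> 2 * (\<Sum>i<N. R (a i))"
    proof -
      have "(\<Sum>i<N0. R (a i)) \<le> (\<Sum>i<N. R (a i))"
        by (simp add: N_def R_def)
      moreover have "(\<Sum>i<N0. R (a (Suc i))) \<le> (\<Sum>i<N. R (a i))"
        unfolding N_def sum.lessThan_Suc_shift by (simp add: R_def)
      ultimately show ?thesis by (simp add: sum.distrib)
    qed
    then have "\<eta> / 2 * \<delta> * (\<Sum>i<N0. R (a i) + R (a (Suc i))) \<le> \<eta> / 2 * \<delta> * (2 * (\<Sum>i<N. R (a i)))"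
      using \<eta> \<delta> by (intro mult_left_mono) auto
    also have "\<dots> = \<eta> * (\<delta> * (\<Sum>i<N. R (a i)))"
      by simp
    also have "\<dots> \<le> \<eta> * integral {s..t} R"
      using \<eta> r(4) by (intro mult_left_mono) (auto simp: a_def)
    also have "\<dots> \<le> \<eta> * I"
      unfolding I_def using \<eta> st
      by (intro mult_left_mono integral_subset_le HK[OF RM]) (auto simp: R_def)
    finally have "\<bar>E (a N0) - E (a 0)\<bar> \<le> integral {a 0..a N0} \<Psi> + \<eta> * I"
      using chain[of N0] by simp
    moreover have "integral {a 0..a N0} \<Psi> \<le> integral {0..T} \<Psi>"
      using a_range[of 0] a_range[of N0] by (intro integral_subset_le HK[OF \<Psi>M]) (auto simp: \<Psi>0)
    \<comment> \<open>The three contributions: 2 \<omega> B <= e, the approximation error at most e,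
      and \<eta> I occurring twice, once from \<Psi> and once from the point values. The end pieces
      add 2 e.\<close>
    ultimately have "\<bar>E (a N0) - E (a 0)\<bar> \<le> 3 * e"
      using \<Psi>I D \<omega>(2) \<eta>(2) by linarith
    moreover have "\<bar>E t - E (a N0)\<bar> < e"
      using d2(2)[of "a N0" t] aN a_range[of N0] st by (auto simp: dist_real_def d_def)
    moreover have "\<bar>E (a 0) - E s\<bar> < e"
      using d2(2)[of s "a 0"] a0 a_range[of 0] st by (auto simp: dist_real_def d_def)
    ultimately show ?thesis by linarith
  qed
  \<comment> \<open>With this value of \<open>e\<close> the bound says that |E t - E s| is at most
    half of itself.\<close>
  from this[of "\<bar>E t - E s\<bar> / 10"] have "E t = E s"
    by (cases "E t = E s") auto
  then show ?thesis
    using Ediff[OF st] by (simp add: \<beta>_def[abs_def])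
qed simp

section \<open>The a priori estimate\<close>

text \<open>The right-hand side of the integral inequality, multiplied by the integrating factor
  exp(-Ks), is nonincreasing. The conclusion bounds this right-hand side rather than \<phi>, so that
  a further term on the left of the energy inequality is not lost.\<close>

lemma gronwall_integral:
  fixes \<phi> :: "real \<Rightarrow> real"
  assumes \<phi>: "continuous_on {0..t} \<phi>" and "0 \<le> t" "0 \<le> K"
    and le: "\<And>s. s \<in> {0..t} \<Longrightarrow> \<phi> s \<le> B + K * integral {0..s} \<phi>"
  shows "B + K * integral {0..t} \<phi> \<le> B * exp (K * t)"
proof -
  define z where "z s = (B + K * integral {0..s} \<phi>) * exp (- K * s)" for s
  have "z t \<le> z 0"
  proof (rule DERIV_nonpos_imp_decreasing_open[OF \<open>0 \<le> t\<close>])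
    have "continuous_on {0..t} (\<lambda>s. integral {0..s} \<phi>)"
      by (intro indefinite_integral_continuous_1 integrable_continuous_interval \<phi>)
    then show "continuous_on {0..t} z"
      unfolding z_def by (intro continuous_intros)
    fix s assume s: "0 < s" "s < t"
    have "((\<lambda>s. integral {0..s} \<phi>) has_real_derivative \<phi> s) (at s within {0..t})"
      using \<phi> s by (intro integral_has_real_derivative) auto
    then have "((\<lambda>s. integral {0..s} \<phi>) has_real_derivative \<phi> s) (at s)"
      using s by (simp add: at_within_Icc_at)
    then have "(z has_real_derivative (K * \<phi> s - K * (B + K * integral {0..s} \<phi>)) * exp (- K * s)) (at s)"
      unfolding z_def by (auto intro!: derivative_eq_intros simp: algebra_simps)
    moreover have "(K * \<phi> s - K * (B + K * integral {0..s} \<phi>)) * exp (- K * s) \<le> 0"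
      using mult_left_mono[OF le[of s] \<open>0 \<le> K\<close>] s by (intro mult_nonpos_nonneg) auto
    ultimately show "\<exists>y. (z has_real_derivative y) (at s) \<and> y \<le> 0" by blast
  qed
  then have "(B + K * integral {0..t} \<phi>) * exp (- K * t) \<le> B"
    by (simp add: z_def)
  then show ?thesis
    by (simp add: exp_minus field_simps)
qed

text \<open>Both candidates have the same integrals over intervals, namely the increments of
  \<open>u\<close>, when tested with any \<open>v\<close>. It is needed because
  \<open>L2_deriv\<close> is an arbitrary choice and must be compared with f - Ay.\<close>

lemma has_L2_deriv_AE_unique:
  fixes \<iota> :: "'v::{chilbert_space, second_countable_topology} \<Rightarrow> 'h::chilbert_space"
  assumes G: "gelfand_triple \<iota>" and u: "continuous_on {0..T} u"
    and g: "has_L2_deriv T (embed \<iota> \<circ> u) g" and g': "has_L2_deriv T (embed \<iota> \<circ> u) g'"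
  shows "AE t in lebesgue_on {0<..<T}. g t = g' t"
proof -
  let ?M = "lebesgue_on {0<..<T}"
  have L2: "g \<in> L2 T" "g' \<in> L2 T"
    using g g' by (auto simp: has_L2_deriv_def)
  have int: "integrable ?M h" if "h \<in> L2 T" for h :: "real \<Rightarrow> 'v antidual"
    using L2_imp_integrable_norm[OF that] that by (simp add: L2_def integrable_norm_iff)
  have "AE t in ?M. g t - g' t = 0"
  proof (rule AE_zero_of_interval_integrals)
    show int_diff: "integrable ?M (\<lambda>t. g t - g' t)"
      using int L2 by simp
    fix s t assume st: "0 < s" "s \<le> t" "t < T"
    have "{s<..t} \<in> sets ?M"
      using st by (auto simp: sets_restrict_space_iff)
    then have ind: "integrable ?M (\<lambda>x. indicat_real {s<..t} x *\<^sub>R (g x - g' x))"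
      by (rule integrable_mult_indicator[OF _ int_diff])
    have "pairing (LINT x:{s<..t}|?M. g x - g' x) v = 0" for v
    proof -
      interpret P: bounded_bilinear "pairing :: 'v antidual \<Rightarrow> 'v \<Rightarrow> complex"
        by (rule bounded_bilinear_pairing)
      have pint: "integrable ?M (\<lambda>x. pairing (g x) v)" "integrable ?M (\<lambda>x. pairing (g' x) v)"
        by (intro integrable_pairing_const L2)+
      have "pairing (LINT x:{s<..t}|?M. g x - g' x) v = (LINT x:{s<..t}|?M. pairing (g x) v - pairing (g' x) v)"
        using integral_bounded_linear[OF P.bounded_linear_left[of v] ind]
        by (simp add: set_lebesgue_integral_def P.scaleR_left P.diff_left)
      also have "\<dots> = integral {s..t} (\<lambda>x. pairing (g x) v - pairing (g' x) v)"
        using pint st by (intro set_LINT_eq_integral_Icc) auto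
      also have "\<dots> = integral {s..t} (\<lambda>x. pairing (g x) v) - integral {s..t} (\<lambda>x. pairing (g' x) v)"
        using st by (intro Henstock_Kurzweil_Integration.integral_diff
            absolutely_integrable_on_Icc[OF pint(1), THEN absolutely_integrable_on_def[THEN iffD1, THEN conjunct1]]
            absolutely_integrable_on_Icc[OF pint(2), THEN absolutely_integrable_on_def[THEN iffD1, THEN conjunct1]]) auto
      also have "\<dots> = 0"
        using weak_derivative_increment[OF G u g st, of v] weak_derivative_increment[OF G u g' st, of v] by simp
      finally show ?thesis .
    qed
    then show "(LINT x:{s<..t}|?M. g x - g' x) = 0"
      by (simp add: pairing_inject[symmetric] fun_eq_iff zero_antidual.rep_eq)
  qed
  then show ?thesis by simp
qed

section \<open>From the equation to the energy inequality\<close>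

lemma bounded_linear_lax_milgram:
  fixes a :: "'v::complex_normed_vector \<Rightarrow> 'v \<Rightarrow> complex"
  assumes a: "sesquilinear a" "bounded_form a C3" and C3: "0 < C3"
  shows "bounded_linear (lax_milgram a)" "norm (lax_milgram a v) \<le> C3 * norm v"
proof -
  note pa = pairing_lax_milgram[OF a]
  show bound: "norm (lax_milgram a v) \<le> C3 * norm v" for v
  proof (rule norm_antidual_bound)
    show "cmod (pairing (lax_milgram a v) w) \<le> C3 * norm v * norm w" for w
      using a(2) by (simp add: pa bounded_form_def)
  qed (use C3 in simp)
  show "bounded_linear (lax_milgram a)"
  proof (rule bounded_linear_intro)
    fix x y and r :: real
    show "lax_milgram a (x + y) = lax_milgram a x + lax_milgram a y"
      using a(1) by (simp add: pairing_inject[symmetric] fun_eq_iff pa plus_antidual.rep_eq sesquilinear_def)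
    show "lax_milgram a (r *\<^sub>R x) = r *\<^sub>R lax_milgram a x"
      using a(1) by (simp add: pairing_inject[symmetric] fun_eq_iff pa scaleR_antidual.rep_eq sesquilinear_def
          scaleR_scaleC[of r x] scaleR_conv_of_real)
    show "norm (lax_milgram a x) \<le> norm x * C3"
      using bound[of x] by (simp add: mult.commute)
  qed
qed

lemma power2_norm_diff_le:
  fixes x y :: "'a::real_normed_vector"
  shows "(norm (x - y))\<^sup>2 \<le> 2 * (norm x)\<^sup>2 + 2 * (norm y)\<^sup>2"
proof -
  have "(norm (x - y))\<^sup>2 \<le> (norm x + norm y)\<^sup>2"
    by (intro power_mono norm_triangle_ineq4) simp
  also have "\<dots> \<le> 2 * (norm x)\<^sup>2 + 2 * (norm y)\<^sup>2"
    using zero_le_power2[of "norm x - norm y"] by (simp add: power2_sum power2_diff)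
  finally show ?thesis .
qed

text \<open>The equation says that f - Ay is a weak derivative of \<open>u\<close>, to which the
  energy identity applies. The dissipation C4 R is kept on the left of the first bound because it
  alone controls the \<open>V\<close>-norm.\<close>

lemma solves_cauchy_energy_estimate:
  fixes \<iota> :: "'v::{chilbert_space, second_countable_topology} \<Rightarrow> 'h::{chilbert_space, second_countable_topology}"
  assumes G: "gelfand_triple \<iota>" and a: "sesquilinear a" "bounded_form a C3" and C3: "0 < C3"
    and C4: "0 < C4" and k: "0 \<le> k" and coercive: "coercive_form \<iota> a C4 k"
    and f: "f \<in> L2 T" and sol: "solves_cauchy \<iota> a T f u0 u" and t: "t \<in> {0..T}"
  defines "R \<equiv> LINT s|lebesgue_on {0<..<t}. (norm (inv \<iota> (u s)))\<^sup>2"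
    and "F \<equiv> LINT s|lebesgue_on {0<..<t}. (norm (f s))\<^sup>2"
  shows "(norm (u t))\<^sup>2 + C4 * R \<le> ((norm u0)\<^sup>2 + F / C4) * exp (2 * k * t)"
    and "(LINT s|lebesgue_on {0<..<t}. (norm (L2_deriv T (embed \<iota> \<circ> u) s))\<^sup>2) \<le> 2 * F + 2 * C3\<^sup>2 * R"
proof -
  let ?M = "lebesgue_on {0<..<T}"
  \<comment> \<open>Outside the range of \<iota> the value of \<open>inv\<close> is arbitrary; by
    \<open>AEy\<close> this concerns only a null set of times.\<close>
  define y where "y = inv \<iota> \<circ> u"
  define g where "g \<tau> = f \<tau> - lax_milgram a (y \<tau>)" for \<tau>
  note HK = absolutely_integrable_on_Icc[THEN absolutely_integrable_on_def[THEN iffD1, THEN conjunct1]]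
  have u: "continuous_on {0..T} u" and yL2: "y \<in> L2 T" and u0: "u 0 = u0"
    and AEy: "AE \<tau> in ?M. \<iota> (y \<tau>) = u \<tau>" and H1: "embed \<iota> \<circ> u \<in> H1 T"
    and eq: "\<And>\<phi>. \<phi> \<in> test_functions T \<Longrightarrow> distr_deriv (regular T (embed \<iota> \<circ> u)) \<phi>
      + regular T (lax_milgram a \<circ> y) \<phi> = regular T f \<phi>"
    using sol by (auto simp: solves_cauchy_def sol_space_def y_def f_inv_into_f comp_assoc elim: eventually_mono)
  note A = bounded_linear_lax_milgram[OF a C3]
  have R2: "integrable ?M (\<lambda>\<tau>. (norm (y \<tau>))\<^sup>2)" and F2: "integrable ?M (\<lambda>\<tau>. (norm (f \<tau>))\<^sup>2)"
    using yL2 f by (auto simp: L2_def)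
  have Aym: "(\<lambda>\<tau>. lax_milgram a (y \<tau>)) \<in> borel_measurable ?M"
  proof (rule measurable_compose[where f=y and N=borel and g="lax_milgram a"])
    show "y \<in> borel_measurable ?M" using yL2 by (simp add: L2_def)
    show "lax_milgram a \<in> borel_measurable borel"
      by (rule borel_measurable_continuous_onI[OF linear_continuous_on[OF A(1)]])
  qed
  have gm: "g \<in> borel_measurable ?M"
    unfolding g_def using Aym f by (intro borel_measurable_diff) (auto simp: L2_def)
  have g_le: "(norm (g \<tau>))\<^sup>2 \<le> 2 * (norm (f \<tau>))\<^sup>2 + 2 * C3\<^sup>2 * (norm (y \<tau>))\<^sup>2" for \<tau>
  proof -
    have "(norm (lax_milgram a (y \<tau>)))\<^sup>2 \<le> (C3 * norm (y \<tau>))\<^sup>2"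
      by (intro power_mono A) simp
    then show ?thesis
      using power2_norm_diff_le[of "f \<tau>" "lax_milgram a (y \<tau>)"] by (simp add: g_def power_mult_distrib)
  qed
  have dom: "integrable ?M (\<lambda>\<tau>. 2 * (norm (f \<tau>))\<^sup>2 + 2 * C3\<^sup>2 * (norm (y \<tau>))\<^sup>2)"
    using R2 F2 by simp
  have G2: "integrable ?M (\<lambda>\<tau>. (norm (g \<tau>))\<^sup>2)"
  proof (rule Bochner_Integration.integrable_bound[OF dom])
    show "(\<lambda>\<tau>. (norm (g \<tau>))\<^sup>2) \<in> borel_measurable ?M" using gm by simp
    show "AE \<tau> in ?M. norm ((norm (g \<tau>))\<^sup>2) \<le> norm (2 * (norm (f \<tau>))\<^sup>2 + 2 * C3\<^sup>2 * (norm (y \<tau>))\<^sup>2)"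
      using g_le by (intro AE_I2) (simp add: abs_of_nonneg)
  qed
  have gL2: "g \<in> L2 T" using gm G2 by (simp add: L2_def)
  have AyL2: "(\<lambda>\<tau>. lax_milgram a (y \<tau>)) \<in> L2 T"
  proof -
    have "integrable ?M (\<lambda>\<tau>. (norm (lax_milgram a (y \<tau>)))\<^sup>2)"
    proof (rule Bochner_Integration.integrable_bound[OF integrable_mult_right[OF R2, of "C3\<^sup>2"]])
      show "(\<lambda>\<tau>. (norm (lax_milgram a (y \<tau>)))\<^sup>2) \<in> borel_measurable ?M" using Aym by simp
      have "(norm (lax_milgram a (y \<tau>)))\<^sup>2 \<le> (C3 * norm (y \<tau>))\<^sup>2" for \<tau>
        by (intro power_mono A) simp
      then show "AE \<tau> in ?M. norm ((norm (lax_milgram a (y \<tau>)))\<^sup>2) \<le> norm (C3\<^sup>2 * (norm (y \<tau>))\<^sup>2)"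
        by (intro AE_I2) (simp add: power_mult_distrib)
    qed
    then show ?thesis using Aym by (simp add: L2_def)
  qed
  have derivg: "has_L2_deriv T (embed \<iota> \<circ> u) g"
    unfolding has_L2_deriv_def
  proof (intro conjI ballI gL2)
    fix \<phi> assume \<phi>: "\<phi> \<in> test_functions T"
    have "continuous_on {0..T} \<phi>"
      using test_function_continuous(1)[OF \<phi>] continuous_on_subset by blast
    then have int: "integrable ?M (\<lambda>x. \<phi> x *\<^sub>C h x)" if "h \<in> L2 T" for h :: "real \<Rightarrow> 'v antidual"
      using that L2_imp_integrable_norm[OF that] by (intro integrable_scaleC_continuous) (auto simp: L2_def)
    interpret S: bounded_bilinear "scaleC :: complex \<Rightarrow> 'v antidual \<Rightarrow> 'v antidual"
      by (rule bounded_bilinear_scaleC)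
    have "regular T g \<phi> = regular T f \<phi> - regular T (lax_milgram a \<circ> y) \<phi>"
      unfolding regular_def g_def S.diff_right comp_def
      by (rule Bochner_Integration.integral_diff[OF int[OF f] int[OF AyL2]])
    then show "distr_deriv (regular T (embed \<iota> \<circ> u)) \<phi> = regular T g \<phi>"
      using eq[OF \<phi>] by (metis add_diff_cancel_right')
  qed
  define F' where "F' s = integral {0..s} (\<lambda>\<tau>. (norm (f \<tau>))\<^sup>2)" for s
  define R' where "R' s = integral {0..s} (\<lambda>\<tau>. (norm (y \<tau>))\<^sup>2)" for s
  have tT: "0 \<le> t" "t \<le> T" using t by auto
  have FF: "F = F' t" and RR: "R = R' t"
    unfolding F_def R_def F'_def R'_def
    using LINT_eq_integral_Icc[OF F2 order_refl tT(2)] LINT_eq_integral_Icc[OF R2 order_refl tT(2)]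
    by (simp_all add: y_def)
  have Z: "negligible {\<tau> \<in> {0<..<T}. \<iota> (y \<tau>) \<noteq> u \<tau>}"
    by (rule AE_lebesgue_on_imp_negligible[OF AEy])
  have cont2: "continuous_on {0..t} (\<lambda>\<tau>. (norm (u \<tau>))\<^sup>2)"
    using tT by (intro continuous_intros continuous_on_subset[OF u]) auto
  have energy: "(norm (u s))\<^sup>2 + C4 * R' s \<le> (norm u0)\<^sup>2 + F' s / C4 + 2 * k * integral {0..s} (\<lambda>\<tau>. (norm (u \<tau>))\<^sup>2)"
    if s: "s \<in> {0..t}" for s
  proof -
    have sT: "0 \<le> s" "s \<le> T" using s tT by auto
    have "(norm (u s))\<^sup>2 - (norm (u 0))\<^sup>2 = 2 * integral {0..s} (\<lambda>\<tau>. Re (pairing (g \<tau>) (y \<tau>)))"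
      by (rule energy_identity[OF G u gL2 yL2 AEy weak_derivative_increment[OF G u derivg]]) (use sT in auto)
    also have "\<dots> = integral {0..s} (\<lambda>\<tau>. 2 * Re (pairing (g \<tau>) (y \<tau>)))"
      by simp
    also have "\<dots> \<le> integral {0..s} (\<lambda>\<tau>. (norm (f \<tau>))\<^sup>2 / C4 - C4 * (norm (y \<tau>))\<^sup>2 + 2 * k * (norm (u \<tau>))\<^sup>2)"
    \<comment> \<open>The almost-everywhere statement speaks of the open interval only, so the
      points 0 and T join the exceptional set.\<close>
    proof (rule integral_le_negligible[OF _ _ negligible_Un[OF Z negligible_finite[of "{0, T}"]]])
      have "integrable ?M (\<lambda>\<tau>. 2 * Re (pairing (g \<tau>) (y \<tau>)))"
        by (intro integrable_mult_right integrable_Re integrable_pairing_L2 gL2 yL2)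
      then show "(\<lambda>\<tau>. 2 * Re (pairing (g \<tau>) (y \<tau>))) integrable_on {0..s}"
        by (rule HK) (use sT in auto)
      have "(\<lambda>\<tau>. (norm (u \<tau>))\<^sup>2) integrable_on {0..s}"
        using s by (intro integrable_continuous_interval continuous_on_subset[OF cont2]) auto
      then show "(\<lambda>\<tau>. (norm (f \<tau>))\<^sup>2 / C4 - C4 * (norm (y \<tau>))\<^sup>2 + 2 * k * (norm (u \<tau>))\<^sup>2) integrable_on {0..s}"
        using HK[OF F2 order_refl sT(2)] HK[OF R2 order_refl sT(2)]
        by (intro Henstock_Kurzweil_Integration.integrable_add Henstock_Kurzweil_Integration.integrable_diff
            integrable_on_mult_right integrable_on_divide)
      fix \<tau> assume \<tau>: "\<tau> \<in> {0..s} - ({\<tau> \<in> {0<..<T}. \<iota> (y \<tau>) \<noteq> u \<tau>} \<union> {0, T})"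
      then have y\<tau>: "\<iota> (y \<tau>) = u \<tau>" using sT by auto
      have "Re (pairing (g \<tau>) (y \<tau>)) = Re (pairing (f \<tau>) (y \<tau>)) - Re (a (y \<tau>) (y \<tau>))"
        by (simp add: g_def minus_antidual.rep_eq pairing_lax_milgram[OF a])
      moreover have "Re (a (y \<tau>) (y \<tau>)) \<ge> C4 * (norm (y \<tau>))\<^sup>2 - k * (norm (u \<tau>))\<^sup>2"
        using coercive y\<tau> by (metis coercive_form_def)
      ultimately have 1: "2 * Re (pairing (g \<tau>) (y \<tau>))
          \<le> 2 * Re (pairing (f \<tau>) (y \<tau>)) - 2 * C4 * (norm (y \<tau>))\<^sup>2 + 2 * k * (norm (u \<tau>))\<^sup>2"
        by (simp add: algebra_simps)
      have "Re (pairing (f \<tau>) (y \<tau>)) \<le> norm (f \<tau>) * norm (y \<tau>)"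
        by (rule order_trans[OF complex_Re_le_cmod norm_pairing])
      \<comment> \<open>The weight C4 is chosen such that half of the coercive term 2 C4 |y|^2 is
        absorbed and half remains.\<close>
      moreover have "2 * (norm (f \<tau>) * norm (y \<tau>)) \<le> (norm (f \<tau>))\<^sup>2 / C4 + C4 * (norm (y \<tau>))\<^sup>2"
      proof -
        have "0 \<le> (norm (f \<tau>) - C4 * norm (y \<tau>))\<^sup>2 / C4" using C4 by simp
        also have "\<dots> = (norm (f \<tau>))\<^sup>2 / C4 + C4 * (norm (y \<tau>))\<^sup>2 - 2 * (norm (f \<tau>) * norm (y \<tau>))"
          using C4 by (simp add: power2_eq_square field_simps)
        finally show ?thesis by simp
      qed
      ultimately show "2 * Re (pairing (g \<tau>) (y \<tau>))
          \<le> (norm (f \<tau>))\<^sup>2 / C4 - C4 * (norm (y \<tau>))\<^sup>2 + 2 * k * (norm (u \<tau>))\<^sup>2"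
        using 1 by linarith
    qed simp
    also have "\<dots> = F' s / C4 - C4 * R' s + 2 * k * integral {0..s} (\<lambda>\<tau>. (norm (u \<tau>))\<^sup>2)"
    proof -
      have "(\<lambda>\<tau>. (norm (u \<tau>))\<^sup>2) integrable_on {0..s}"
        using s by (intro integrable_continuous_interval continuous_on_subset[OF cont2]) auto
      from HK[OF F2 order_refl sT(2), THEN integrable_integral] HK[OF R2 order_refl sT(2), THEN integrable_integral]
        this[THEN integrable_integral]
      show ?thesis
        unfolding F'_def R'_def
        by (intro integral_unique has_integral_add has_integral_diff has_integral_mult_right has_integral_divide)
    qed
    finally show ?thesis by (simp add: u0)
  qed
  \<comment> \<open>Taking the data up to the final time \<open>t\<close> makes \<open>B\<close>
    independent of \<open>s\<close>. The term C4 R' is dropped while checking Gronwall's hypothesis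
    and recovered from \<open>energy\<close> at s = t.\<close>
  define B where "B = (norm u0)\<^sup>2 + F' t / C4"
  have R'0: "0 \<le> R' s" if "s \<le> T" for s
    unfolding R'_def by (rule Henstock_Kurzweil_Integration.integral_nonneg[OF HK[OF R2 order_refl that]]) simp
  have "B + 2 * k * integral {0..t} (\<lambda>\<tau>. (norm (u \<tau>))\<^sup>2) \<le> B * exp (2 * k * t)"
  proof (rule gronwall_integral[OF cont2 tT(1)])
    fix s assume s: "s \<in> {0..t}"
    have "F' s \<le> F' t"
      unfolding F'_def using s tT by (intro integral_subset_le HK[OF F2]) auto
    then have "F' s / C4 \<le> F' t / C4" using C4 by (simp add: divide_right_mono)
    moreover have "0 \<le> C4 * R' s" using C4 R'0[of s] s tT by simp
    ultimately show "(norm (u s))\<^sup>2 \<le> B + 2 * k * integral {0..s} (\<lambda>\<tau>. (norm (u \<tau>))\<^sup>2)"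
      using energy[OF s] unfolding B_def by linarith
  qed (use k in simp)
  then show "(norm (u t))\<^sup>2 + C4 * R \<le> ((norm u0)\<^sup>2 + F / C4) * exp (2 * k * t)"
    using energy[of t] tT unfolding FF RR B_def by simp
  have "\<exists>g. has_L2_deriv T (embed \<iota> \<circ> u) g" using derivg by blast
  then have "has_L2_deriv T (embed \<iota> \<circ> u) (L2_deriv T (embed \<iota> \<circ> u))"
    unfolding L2_deriv_def by (rule someI_ex)
  note deriv = this
  define g' where "g' = L2_deriv T (embed \<iota> \<circ> u)"
  have G2': "integrable ?M (\<lambda>\<tau>. (norm (g' \<tau>))\<^sup>2)"
    using deriv by (simp add: g'_def has_L2_deriv_def L2_def)
  have Z': "negligible {\<tau> \<in> {0<..<T}. g' \<tau> \<noteq> g \<tau>}"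
    unfolding g'_def by (rule AE_lebesgue_on_imp_negligible[OF has_L2_deriv_AE_unique[OF G u deriv derivg]])
  have "(LINT s|lebesgue_on {0<..<t}. (norm (g' s))\<^sup>2) = integral {0..t} (\<lambda>\<tau>. (norm (g' \<tau>))\<^sup>2)"
    by (rule LINT_eq_integral_Icc[OF G2' order_refl tT(2)])
  also have "\<dots> \<le> integral {0..t} (\<lambda>\<tau>. 2 * (norm (f \<tau>))\<^sup>2 + 2 * C3\<^sup>2 * (norm (y \<tau>))\<^sup>2)"
  proof (rule integral_le_negligible[OF HK[OF G2' order_refl tT(2)] HK[OF dom order_refl tT(2)]
        negligible_Un[OF Z' negligible_finite[of "{0, T}"]]])
    fix \<tau> assume \<tau>: "\<tau> \<in> {0..t} - ({\<tau> \<in> {0<..<T}. g' \<tau> \<noteq> g \<tau>} \<union> {0, T})"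
    then have "g' \<tau> = g \<tau>" using tT by auto
    then show "(norm (g' \<tau>))\<^sup>2 \<le> 2 * (norm (f \<tau>))\<^sup>2 + 2 * C3\<^sup>2 * (norm (y \<tau>))\<^sup>2"
      using g_le[of \<tau>] by simp
  qed simp
  also have "\<dots> = 2 * F' t + 2 * C3\<^sup>2 * R' t"
    using HK[OF F2 order_refl tT(2), THEN integrable_integral] HK[OF R2 order_refl tT(2), THEN integrable_integral]
    unfolding F'_def R'_def by (intro integral_unique has_integral_add has_integral_mult_right)
  finally show "(LINT s|lebesgue_on {0<..<t}. (norm (L2_deriv T (embed \<iota> \<circ> u) s))\<^sup>2) \<le> 2 * F + 2 * C3\<^sup>2 * R"
    by (simp add: g'_def FF RR)
qed

section \<open>Combining the bounds into the stated constant\<close>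

lemma estimate_constants:
  fixes C3 C4 e n F R S D :: real
  assumes C4: "0 < C4" and pos: "0 \<le> n" "0 \<le> F"
    and R: "C4 * R \<le> (n + F / C4) * e" and S: "S \<le> (n + F / C4) * e" and D: "D \<le> 2 * F + 2 * C3\<^sup>2 * R"
  shows "R + S + D \<le> (2 + (2 * C3\<^sup>2 + C4 + 1) / C4\<^sup>2 * e) * (C4 * n + F)"
proof -
  define X where "X = n + F / C4"
  have X: "C4 * n + F = C4 * X" using C4 by (simp add: X_def field_simps)
  have "R \<le> X * e / C4" using R C4 by (simp add: X_def pos_le_divide_eq mult.commute)
  \<comment> \<open>\<open>R\<close> counts once for itself and 2 C3^2 times through
    \<open>D\<close>. Adding the supremum term X e and factoring out C4 X gives (2 C3^2 + C4 +
    1)/C4^2; the leading 2 stems from the summand 2 F of \<open>D\<close>.\<close>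
  then have "(1 + 2 * C3\<^sup>2) * R \<le> (1 + 2 * C3\<^sup>2) * (X * e / C4)"
    by (intro mult_left_mono) (auto simp: add_nonneg_nonneg)
  moreover have "R + S + D \<le> (1 + 2 * C3\<^sup>2) * R + X * e + 2 * F"
    using S D by (simp add: X_def algebra_simps)
  moreover have "2 * F \<le> 2 * (C4 * X)"
    using pos C4 unfolding X[symmetric] by simp
  ultimately have "R + S + D \<le> (1 + 2 * C3\<^sup>2) * (X * e / C4) + X * e + 2 * (C4 * X)"
    by linarith
  also have "\<dots> = (2 + (2 * C3\<^sup>2 + C4 + 1) / C4\<^sup>2 * e) * (C4 * X)"
    using C4 by (simp add: field_simps power2_eq_square)
  finally show ?thesis by (simp add: X)
qed

lemma solves_cauchy_estimate:
  fixes \<iota> :: "'v::{chilbert_space, second_countable_topology} \<Rightarrow> 'h::{chilbert_space, second_countable_topology}"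
  assumes G: "gelfand_triple \<iota>" and a: "sesquilinear a" "bounded_form a C3" and C3: "0 < C3"
    and C4: "0 < C4" and k: "0 \<le> k" and coercive: "coercive_form \<iota> a C4 k"
    and f: "f \<in> L2 T" and sol: "solves_cauchy \<iota> a T f u0 u" and t: "t \<in> {0..T}"
  shows "(LINT s|lebesgue_on {0<..<t}. (norm (inv \<iota> (u s)))\<^sup>2)
      + (SUP s\<in>{0..t}. (norm (u s))\<^sup>2)
      + (LINT s|lebesgue_on {0<..<t}. (norm (L2_deriv T (embed \<iota> \<circ> u) s))\<^sup>2)
      \<le> (2 + (2 * C3\<^sup>2 + C4 + 1) / C4\<^sup>2 * exp (2 * k * t))
        * (C4 * (norm u0)\<^sup>2 + (LINT s|lebesgue_on {0<..<t}. (norm (f s))\<^sup>2))"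
proof -
  note est = solves_cauchy_energy_estimate[OF G a C3 C4 k coercive f sol]
  define F where "F t = (LINT s|lebesgue_on {0<..<t}. (norm (f s))\<^sup>2)" for t
  define R where "R t = (LINT s|lebesgue_on {0<..<t}. (norm (inv \<iota> (u s)))\<^sup>2)" for t
  have R0: "0 \<le> R t" and F0: "0 \<le> F t" for t
    by (simp_all add: R_def F_def)
  have F2: "integrable (lebesgue_on {0<..<T}) (\<lambda>s. (norm (f s))\<^sup>2)"
    using f by (simp add: L2_def)
  \<comment> \<open>The first energy bound is used at every earlier time; its right-hand side is
    nondecreasing in time because \<open>k\<close> is nonnegative.\<close>
  have sup: "(norm (u s))\<^sup>2 \<le> ((norm u0)\<^sup>2 + F t / C4) * exp (2 * k * t)" if s: "s \<in> {0..t}" for s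
  proof -
    have sT: "s \<in> {0..T}" using s t by auto
    have "F s \<le> F t"
    proof -
      have "F s = integral {0..s} (\<lambda>s. (norm (f s))\<^sup>2)" "F t = integral {0..t} (\<lambda>s. (norm (f s))\<^sup>2)"
        unfolding F_def using sT t by (intro LINT_eq_integral_Icc[OF F2]; simp)+
      moreover have "integral {0..s} (\<lambda>s. (norm (f s))\<^sup>2) \<le> integral {0..t} (\<lambda>s. (norm (f s))\<^sup>2)"
        using s t sT by (intro integral_subset_le
            absolutely_integrable_on_Icc[OF F2, THEN absolutely_integrable_on_def[THEN iffD1, THEN conjunct1]]) auto
      ultimately show ?thesis by simp
    qed
    then have "F s / C4 \<le> F t / C4" using C4 by (simp add: divide_right_mono)
    moreover have "exp (2 * k * s) \<le> exp (2 * k * t)"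
      using s k by (simp add: mult_left_mono)
    ultimately have "((norm u0)\<^sup>2 + F s / C4) * exp (2 * k * s) \<le> ((norm u0)\<^sup>2 + F t / C4) * exp (2 * k * t)"
      using F0[of t] C4 by (intro mult_mono) auto
    moreover have "(norm (u s))\<^sup>2 + C4 * R s \<le> ((norm u0)\<^sup>2 + F s / C4) * exp (2 * k * s)"
      using est(1)[OF sT] by (simp add: R_def F_def)
    moreover have "0 \<le> C4 * R s" using C4 R0 by simp
    ultimately show ?thesis by linarith
  qed
  have "R t + (SUP s\<in>{0..t}. (norm (u s))\<^sup>2) + (LINT s|lebesgue_on {0<..<t}. (norm (L2_deriv T (embed \<iota> \<circ> u) s))\<^sup>2)
      \<le> (2 + (2 * C3\<^sup>2 + C4 + 1) / C4\<^sup>2 * exp (2 * k * t)) * (C4 * (norm u0)\<^sup>2 + F t)"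
  proof (rule estimate_constants[OF C4 _ F0])
    have "(norm (u t))\<^sup>2 + C4 * R t \<le> ((norm u0)\<^sup>2 + F t / C4) * exp (2 * k * t)"
      using est(1)[OF t] by (simp add: R_def F_def)
    \<comment> \<open>The dissipation and the supremum are each bounded by the full right-hand side,
      since the supremum may be attained before \<open>t\<close>.\<close>
    then show "C4 * R t \<le> ((norm u0)\<^sup>2 + F t / C4) * exp (2 * k * t)"
      using zero_le_power2[of "norm (u t)"] by linarith
    show "(SUP s\<in>{0..t}. (norm (u s))\<^sup>2) \<le> ((norm u0)\<^sup>2 + F t / C4) * exp (2 * k * t)"
      using t sup by (intro cSUP_least) auto
    show "(LINT s|lebesgue_on {0<..<t}. (norm (L2_deriv T (embed \<iota> \<circ> u) s))\<^sup>2) \<le> 2 * F t + 2 * C3\<^sup>2 * R t"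
      using est(2)[OF t] by (simp add: R_def F_def)
  qed simp
  then show ?thesis by (simp add: R_def F_def)
qed

theorem proposition7:
  fixes \<iota> :: "'v::{chilbert_space, second_countable_topology} \<Rightarrow> 'h::{chilbert_space, second_countable_topology}"
    and a :: "'v \<Rightarrow> 'v \<Rightarrow> complex"
    and C3 C4 k T :: real
  assumes "gelfand_triple \<iota>"
    and "sesquilinear a"
    and "0 < C3" and "bounded_form a C3"
    and "0 < C4" and "0 \<le> k" and "coercive_form \<iota> a C4 k"
    and "0 < T"
  shows "(\<forall>f\<in>L2 T. \<forall>u0 u. solves_cauchy \<iota> a T f u0 u \<longrightarrow>
            (\<forall>t\<in>{0..T}.
               (LINT s|lebesgue_on {0<..<t}. (norm (inv \<iota> (u s)))\<^sup>2)
               + (SUP s\<in>{0..t}. (norm (u s))\<^sup>2)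
               + (LINT s|lebesgue_on {0<..<t}. (norm (L2_deriv T (embed \<iota> \<circ> u) s))\<^sup>2)
               \<le> (2 + (2 * C3\<^sup>2 + C4 + 1) / C4\<^sup>2 * exp (2 * k * t))
                 * (C4 * (norm u0)\<^sup>2 + (LINT s|lebesgue_on {0<..<t}. (norm (f s))\<^sup>2)))) \<and>
         (\<exists>C\<ge>0. \<forall>f\<in>L2 T. \<forall>u0 u. solves_cauchy \<iota> a T f u0 u \<longrightarrow>
            sol_norm \<iota> T u \<le> C * sqrt ((LINT s|lebesgue_on {0<..<T}. (norm (f s))\<^sup>2) + (norm u0)\<^sup>2))"
proof (intro conjI ballI allI impI)
  fix f u0 u t
  assume "f \<in> L2 T" "solves_cauchy \<iota> a T f u0 u" "t \<in> {0..T}"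
  with assms show "(LINT s|lebesgue_on {0<..<t}. (norm (inv \<iota> (u s)))\<^sup>2)
      + (SUP s\<in>{0..t}. (norm (u s))\<^sup>2)
      + (LINT s|lebesgue_on {0<..<t}. (norm (L2_deriv T (embed \<iota> \<circ> u) s))\<^sup>2)
      \<le> (2 + (2 * C3\<^sup>2 + C4 + 1) / C4\<^sup>2 * exp (2 * k * t))
        * (C4 * (norm u0)\<^sup>2 + (LINT s|lebesgue_on {0<..<t}. (norm (f s))\<^sup>2))"
    by (intro solves_cauchy_estimate)
next
  let ?M = "lebesgue_on {0<..<T}"
  obtain C1 C2 where "0 < C2"
    "\<And>v. norm (embed \<iota> (\<iota> v)) \<le> C1 * norm (\<iota> v) \<and> C1 * norm (\<iota> v) \<le> C2 * norm v"
    using gelfand_triple_constants[OF assms(1)] by blast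
  then have C2: "0 < C2" "\<And>v. norm (embed \<iota> (\<iota> v)) \<le> C2 * norm v"
    using order_trans by blast+
  define K where "K = 2 + (2 * C3\<^sup>2 + C4 + 1) / C4\<^sup>2 * exp (2 * k * T)"
  have K: "0 \<le> K" using assms by (simp add: K_def)
  \<comment> \<open>The norm of \<open>X\<close> has one term more than the estimate, the antidual
    norm of \<open>u\<close>, which costs C2^2; C4 + 1 turns C4 |u0|^2 + F into a multiple of F +
    |u0|^2.\<close>
  define C where "C = sqrt ((1 + C2\<^sup>2) * K * (C4 + 1))"
  show "\<exists>C\<ge>0. \<forall>f\<in>L2 T. \<forall>u0 u. solves_cauchy \<iota> a T f u0 u \<longrightarrow>
      sol_norm \<iota> T u \<le> C * sqrt ((LINT s|?M. (norm (f s))\<^sup>2) + (norm u0)\<^sup>2)"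
  proof (intro exI[of _ C] conjI ballI allI impI)
    show "0 \<le> C" using K assms by (simp add: C_def)
    fix f u0 u
    assume f: "f \<in> L2 T" and sol: "solves_cauchy \<iota> a T f u0 u"
    define F where "F = (LINT s|?M. (norm (f s))\<^sup>2)"
    define R where "R = (LINT s|?M. (norm (inv \<iota> (u s)))\<^sup>2)"
    define S where "S = (SUP t\<in>{0..T}. (norm (u t))\<^sup>2)"
    define g where "g = L2_deriv T (embed \<iota> \<circ> u)"
    define D where "D = (LINT s|?M. (norm (g s))\<^sup>2)"
    have u: "continuous_on {0..T} u" and range: "AE t in ?M. u t \<in> range \<iota>"
      and y: "inv \<iota> \<circ> u \<in> L2 T" and H1: "embed \<iota> \<circ> u \<in> H1 T"
      using sol by (auto simp: solves_cauchy_def sol_space_def)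
    have R2: "integrable ?M (\<lambda>t. (norm (inv \<iota> (u t)))\<^sup>2)"
      using y by (simp add: L2_def)
    have w2: "integrable ?M (\<lambda>t. (norm (embed \<iota> (u t)))\<^sup>2)"
      using H1 by (simp add: H1_def L2_def)
    have "\<exists>g. has_L2_deriv T (embed \<iota> \<circ> u) g"
      using H1 by (simp add: H1_def)
    then have "has_L2_deriv T (embed \<iota> \<circ> u) g"
      unfolding g_def L2_deriv_def by (rule someI_ex)
    then have g2: "integrable ?M (\<lambda>t. (norm (g t))\<^sup>2)"
      by (simp add: has_L2_deriv_def L2_def)
    have "(LINT t|?M. (norm (embed \<iota> (u t)))\<^sup>2) \<le> (LINT t|?M. C2\<^sup>2 * (norm (inv \<iota> (u t)))\<^sup>2)"
    proof (rule integral_mono_AE[OF w2 integrable_mult_right[OF R2]])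
      show "AE t in ?M. (norm (embed \<iota> (u t)))\<^sup>2 \<le> C2\<^sup>2 * (norm (inv \<iota> (u t)))\<^sup>2"
        using range
      proof eventually_elim
        case (elim t)
        then have "norm (embed \<iota> (u t)) \<le> C2 * norm (inv \<iota> (u t))"
          using C2(2)[of "inv \<iota> (u t)"] by (simp add: f_inv_into_f)
        then have "(norm (embed \<iota> (u t)))\<^sup>2 \<le> (C2 * norm (inv \<iota> (u t)))\<^sup>2"
          by (intro power_mono) auto
        then show ?case by (simp add: power_mult_distrib)
      qed
    qed
    then have w: "(LINT t|?M. (norm (embed \<iota> (u t)))\<^sup>2) \<le> C2\<^sup>2 * R"
      by (simp add: R_def)
    have nonneg: "0 \<le> R" "0 \<le> F" "0 \<le> D"
      by (simp_all add: R_def F_def D_def)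
    have S: "0 \<le> S"
    proof -
      \<comment> \<open>A real supremum is informative only for a bounded set; boundedness comes
        from continuity on the compact interval.\<close>
      have "bdd_above ((\<lambda>t. (norm (u t))\<^sup>2) ` {0..T})"
        by (intro bounded_imp_bdd_above compact_imp_bounded compact_continuous_image continuous_intros u) simp
      then have "(norm (u 0))\<^sup>2 \<le> S"
        unfolding S_def using assms(8) by (intro cSUP_upper) auto
      then show ?thesis using zero_le_power2[of "norm (u 0)"] by linarith
    qed
    have "R + S + D \<le> K * (C4 * (norm u0)\<^sup>2 + F)"
      using solves_cauchy_estimate[OF assms(1,2,4,3,5,6,7) f sol, of T] assms(8)
      by (simp add: R_def S_def D_def g_def K_def F_def)
    also have "\<dots> \<le> K * ((C4 + 1) * (F + (norm u0)\<^sup>2))"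
      using K nonneg assms(5) by (intro mult_left_mono) (auto simp: algebra_simps)
    finally have main: "R + S + D \<le> K * ((C4 + 1) * (F + (norm u0)\<^sup>2))" .
    have "sol_norm \<iota> T u = sqrt (R + S + ((LINT t|?M. (norm (embed \<iota> (u t)))\<^sup>2) + D))"
      unfolding sol_norm_def R_def S_def D_def g_def[symmetric] using w2 g2 by simp
    also have "\<dots> \<le> sqrt ((1 + C2\<^sup>2) * (R + S + D))"
    proof (rule real_sqrt_le_mono)
      have "0 \<le> C2\<^sup>2 * (S + D)" using S nonneg by simp
      then show "R + S + ((LINT t|?M. (norm (embed \<iota> (u t)))\<^sup>2) + D) \<le> (1 + C2\<^sup>2) * (R + S + D)"
        using w by (simp add: algebra_simps)
    qed
    also have "\<dots> \<le> sqrt ((1 + C2\<^sup>2) * (K * ((C4 + 1) * (F + (norm u0)\<^sup>2))))"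
      by (intro real_sqrt_le_mono mult_left_mono main) (simp add: add_nonneg_nonneg)
    also have "\<dots> = C * sqrt (F + (norm u0)\<^sup>2)"
      unfolding C_def real_sqrt_mult[symmetric] by (simp add: mult.assoc)
    finally show "sol_norm \<iota> T u \<le> C * sqrt ((LINT s|?M. (norm (f s))\<^sup>2) + (norm u0)\<^sup>2)"
      by (simp add: F_def)
  qed
qed

end
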